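(* Let $(R,\mathfrak m,k)$ be a Noetherian local ring with infinite residue field $k=R/\mathfrak m$, and let $I_1,\dots,I_s$ be ideals in $R$. Let $\underline n=(n_1,\dots,n_s)\in\mathbb N^s$ and $(r_1,\dots,r_s)\in\mathbb N^s$ with $n_1+\cdots+n_s\ge1$ and $r_1+\cdots+r_s\ge0$, and suppose $$\mu(I_1^{n_1}\cdots I_s^{n_s})<\binom{n_1+r_1}{r_1}\cdots\binom{n_s+r_s}{r_s}.$$ Then for all $1\le i\le s$ there exist general elements $x_{i1},\dots,x_{ir_i}\in I_i$ such that for all $\underline m=(m_1,\dots,m_s)\ge\underline n$, $$I_1^{m_1}\cdots I_s^{m_s}=\sum_{i=1}^s(x_{i1},\dots,x_{ir_i})\,I_1^{m_1}\cdots I_i^{m_i-1}\cdots I_s^{m_s}.$$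
   Context: $\mathbb N=\{0,1,2,\dots\}$; $\underline m\ge\underline n$ means $m_i\ge n_i$ for all $i$. $\mu(I)$ is the minimal number of generators of an ideal $I$. The empty list generates the zero ideal. In the sum, the $i$-th summand is taken to be $0$ if $m_i=0$. General elements: for a finite-dimensional $k$-vector space $W$, identified with $k^N$ by choosing a basis, a non-empty Zariski-open subset is a non-empty finite union of sets $\{w:f(w)\ne0\}$ with $f$ a non-zero polynomial. The conclusion "there exist general elements $x_{i1},\dots,x_{ir_i}\in I_i$ ($1\le i\le s$) such that $\mathcal P$ holds" means: there is a non-empty Zariski-open subset $U$ of $\prod_{i=1}^s(I_i/\mathfrak m I_i)^{r_i}$ such that $\mathcal P$ holds for all $x_{ij}\in I_i$ whose tuple of residue classes $(x_{ij}+\mathfrak m I_i)_{i,j}$ lies in $U$. *)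

theory Defs
  imports "HOL-Algebra.Algebra"
begin

subsection \<open>Ideals in local rings\<close>

locale noetherian_local_ring = cring R + noetherian_ring R + maximalideal \<mm> R
  for \<mm> and R (structure) +
  assumes maximal_unique: "maximalideal J R \<Longrightarrow> J = \<mm>"

text \<open>The empty set generates the zero ideal, which therefore has \<open>0\<close> minimal generators.\<close>

definition min_gens :: "('a, 'b) ring_scheme \<Rightarrow> 'a set \<Rightarrow> nat" where
  "min_gens R I = (LEAST n. \<exists>A. finite A \<and> A \<subseteq> carrier R \<and> card A = n \<and> genideal R A = I)"

text \<open>\<open>I\<^sub>1\<^bsup>m\<^sub>1\<^esup> \<cdots> I\<^sub>s\<^bsup>m\<^sub>s\<^esup>\<close>, formed in the semiring of ideals of \<open>R\<close>; in particular \<open>I\<^bsup>0\<^esup> = R\<close>.\<close>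

definition ideal_monomial ::
    "('a, 'b) ring_scheme \<Rightarrow> nat \<Rightarrow> (nat \<Rightarrow> 'a set) \<Rightarrow> (nat \<Rightarrow> nat) \<Rightarrow> 'a set" where
  "ideal_monomial R s I m =
     (\<Otimes>\<^bsub>ideals_set R\<^esub>i\<in>{1..s}. I i [^]\<^bsub>ideals_set R\<^esub> m i)"

subsection \<open>Vector spaces over the residue field\<close>

text \<open>
  \<open>I/\<mm>I\<close> as a module over \<open>R Quot \<mm>\<close>. Every product \<open>a \<otimes> y\<close> with \<open>a \<in> \<mm> + r\<close> and
  \<open>y \<in> \<mm>I + x\<close> lies in \<open>\<mm>I + (r \<otimes> x)\<close>, so the coset product of the library is the scalar
  multiplication. The ring fields \<open>mult\<close> and \<open>one\<close> of a module record play no role.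
\<close>

definition ideal_fibre ::
    "('a, 'b) ring_scheme \<Rightarrow> 'a set \<Rightarrow> 'a set \<Rightarrow> ('a set, 'a set) module" where
  "ideal_fibre R \<mm> I =
     \<lparr>carrier = (\<lambda>x. (\<mm> \<cdot>\<^bsub>R\<^esub> I) +>\<^bsub>R\<^esub> x) ` I,
      monoid.mult = undefined, one = undefined,
      ring.zero = \<mm> \<cdot>\<^bsub>R\<^esub> I, add = set_add R,
      smult = rcoset_mult R (\<mm> \<cdot>\<^bsub>R\<^esub> I)\<rparr>"

lemma (in cring) ideal_fibre_smult:
  assumes "ideal \<mm> R" "ideal I R" "r \<in> carrier R" "x \<in> I"
  shows "(\<mm> +> r) \<odot>\<^bsub>ideal_fibre R \<mm> I\<^esub> ((\<mm> \<cdot> I) +> x) = (\<mm> \<cdot> I) +> (r \<otimes> x)"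
proof -
  interpret M: ideal \<mm> R by fact
  interpret I: ideal I R by fact
  interpret P: ideal "\<mm> \<cdot> I" R using assms ideal_prod_is_ideal by blast
  have eq: "(\<mm> \<cdot> I) +> (a \<otimes> y) = (\<mm> \<cdot> I) +> (r \<otimes> x)"
    if a: "a \<in> \<mm> +> r" and y: "y \<in> (\<mm> \<cdot> I) +> x" for a y
  proof -
    obtain h where h: "h \<in> \<mm>" "a = h \<oplus> r"
      using a by (auto simp: a_r_coset_def r_coset_def)
    obtain p where p: "p \<in> \<mm> \<cdot> I" "y = p \<oplus> x"
      using y by (auto simp: a_r_coset_def r_coset_def)
    have c: "h \<in> carrier R" "p \<in> carrier R" "x \<in> carrier R" "r \<in> carrier R"
      using h p assms M.Icarr P.Icarr I.Icarr by auto
    have "h \<otimes> x \<in> \<mm> \<cdot> I" using h assms by (auto intro: ideal_prod.prod)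
    then have "(h \<otimes> p \<oplus> h \<otimes> x) \<oplus> r \<otimes> p \<in> \<mm> \<cdot> I"
      using c p P.I_l_closed by auto
    moreover have "a \<otimes> y = ((h \<otimes> p \<oplus> h \<otimes> x) \<oplus> r \<otimes> p) \<oplus> r \<otimes> x"
      unfolding h p using c by (simp add: l_distr r_distr a_ac)
    ultimately have "a \<otimes> y \<in> (\<mm> \<cdot> I) +> (r \<otimes> x)"
      by (auto simp: a_r_coset_def r_coset_def)
    then show ?thesis
      using a_repr_independence[OF _ _ P.a_subgroup, of "a \<otimes> y" "r \<otimes> x"] c by simp
  qed
  have "r \<in> \<mm> +> r" "x \<in> (\<mm> \<cdot> I) +> x"
    using assms I.Icarr M.a_rcos_self P.a_rcos_self by auto
  with eq have "(\<Union>a\<in>\<mm> +> r. \<Union>y\<in>(\<mm> \<cdot> I) +> x. (\<mm> \<cdot> I) +> (a \<otimes> y)) = (\<mm> \<cdot> I) +> (r \<otimes> x)"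
    by blast
  then show ?thesis
    by (simp add: ideal_fibre_def rcoset_mult_def)
qed

definition product_module ::
    "'i set \<Rightarrow> ('i \<Rightarrow> ('a, 'b) module) \<Rightarrow> ('a, 'i \<Rightarrow> 'b) module" where
  "product_module J V =
     \<lparr>carrier = (\<Pi>\<^sub>E p\<in>J. carrier (V p)),
      monoid.mult = undefined, one = undefined,
      ring.zero = (\<lambda>p\<in>J. \<zero>\<^bsub>V p\<^esub>), add = (\<lambda>v w. \<lambda>p\<in>J. v p \<oplus>\<^bsub>V p\<^esub> w p),
      smult = (\<lambda>a v. \<lambda>p\<in>J. a \<odot>\<^bsub>V p\<^esub> v p)\<rparr>"

definition lin_comb ::
    "('k, 'v, 'c) module_scheme \<Rightarrow> nat \<Rightarrow> (nat \<Rightarrow> 'v) \<Rightarrow> (nat \<Rightarrow> 'k) \<Rightarrow> 'v" where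
  "lin_comb W N b c = (\<Oplus>\<^bsub>W\<^esub>l\<in>{..<N}. c l \<odot>\<^bsub>W\<^esub> b l)"

definition is_basis ::
    "('k, 'd) ring_scheme \<Rightarrow> ('k, 'v, 'c) module_scheme \<Rightarrow> nat \<Rightarrow> (nat \<Rightarrow> 'v) \<Rightarrow> bool" where
  "is_basis K W N b \<longleftrightarrow>
     b \<in> {..<N} \<rightarrow> carrier W \<and>
     (\<forall>w\<in>carrier W. \<exists>c\<in>{..<N} \<rightarrow> carrier K. w = lin_comb W N b c) \<and>
     (\<forall>c\<in>{..<N} \<rightarrow> carrier K. lin_comb W N b c = \<zero>\<^bsub>W\<^esub> \<longrightarrow> (\<forall>l<N. c l = \<zero>\<^bsub>K\<^esub>))"

subsection \<open>Zariski-open sets\<close>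

text \<open>
  The library's \<open>ring.indexed_eval\<close> does not evaluate a polynomial at a point. A monomial
  is a multiset of variables.
\<close>

definition point_eval ::
    "('k, 'd) ring_scheme \<Rightarrow> nat \<Rightarrow> (nat multiset \<Rightarrow> 'k) \<Rightarrow> (nat \<Rightarrow> 'k) \<Rightarrow> 'k" where
  "point_eval K N f c =
     (\<Oplus>\<^bsub>K\<^esub>u\<in>{u. f u \<noteq> \<zero>\<^bsub>K\<^esub>}. f u \<otimes>\<^bsub>K\<^esub> (\<Otimes>\<^bsub>K\<^esub>l\<in>{..<N}. c l [^]\<^bsub>K\<^esub> count u l))"

definition affine_open :: "('k, 'd) ring_scheme \<Rightarrow> nat \<Rightarrow> (nat \<Rightarrow> 'k) set \<Rightarrow> bool" where
  "affine_open K N A \<longleftrightarrow>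
     (\<exists>F. finite F \<and>
       F \<subseteq> ring.indexed_pset K {..<N} (carrier K) - {ring.indexed_const K \<zero>\<^bsub>K\<^esub>} \<and>
       A = (\<Union>f\<in>F. {c \<in> {..<N} \<rightarrow>\<^sub>E carrier K. point_eval K N f c \<noteq> \<zero>\<^bsub>K\<^esub>}))"

text \<open>
  A basis identifies \<open>W\<close> with \<open>K\<^sup>N\<close> through \<open>lin_comb\<close>. A change of basis is a linear
  automorphism of \<open>K\<^sup>N\<close>, so over a field the notion does not depend on the basis.
\<close>

definition zariski_open ::
    "('k, 'd) ring_scheme \<Rightarrow> ('k, 'v, 'c) module_scheme \<Rightarrow> 'v set \<Rightarrow> bool" where
  "zariski_open K W U \<longleftrightarrow>
     (\<exists>N b A. is_basis K W N b \<and> affine_open K N A \<and> U = lin_comb W N b ` A)"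

subsection \<open>General elements\<close>

definition residue_space ::
    "('a, 'b) ring_scheme \<Rightarrow> 'a set \<Rightarrow> nat \<Rightarrow> (nat \<Rightarrow> 'a set) \<Rightarrow> (nat \<Rightarrow> nat)
      \<Rightarrow> ('a set, nat \<times> nat \<Rightarrow> 'a set) module" where
  "residue_space R \<mm> s I r =
     product_module (SIGMA i:{1..s}. {1..r i}) (\<lambda>(i, j). ideal_fibre R \<mm> (I i))"

definition residue_tuple ::
    "('a, 'b) ring_scheme \<Rightarrow> 'a set \<Rightarrow> nat \<Rightarrow> (nat \<Rightarrow> 'a set) \<Rightarrow> (nat \<Rightarrow> nat)
      \<Rightarrow> (nat \<Rightarrow> nat \<Rightarrow> 'a) \<Rightarrow> nat \<times> nat \<Rightarrow> 'a set" where
  "residue_tuple R \<mm> s I r x =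
     (\<lambda>(i, j)\<in>(SIGMA i:{1..s}. {1..r i}). (\<mm> \<cdot>\<^bsub>R\<^esub> I i) +>\<^bsub>R\<^esub> x i j)"

definition for_general_elements ::
    "('a, 'b) ring_scheme \<Rightarrow> 'a set \<Rightarrow> nat \<Rightarrow> (nat \<Rightarrow> 'a set) \<Rightarrow> (nat \<Rightarrow> nat)
      \<Rightarrow> ((nat \<Rightarrow> nat \<Rightarrow> 'a) \<Rightarrow> bool) \<Rightarrow> bool" where
  "for_general_elements R \<mm> s I r P \<longleftrightarrow>
     (\<exists>U. zariski_open (R Quot \<mm>) (residue_space R \<mm> s I r) U \<and> U \<noteq> {} \<and>
       (\<forall>x. (\<forall>i\<in>{1..s}. \<forall>j\<in>{1..r i}. x i j \<in> I i) \<longrightarrow>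
            residue_tuple R \<mm> s I r x \<in> U \<longrightarrow> P x))"

end

theory Submission
  imports Defs
begin

text \<open>
  Write \<open>\<Delta>\<close> for the number \<open>\<Prod>i. (n i + r i) choose r i\<close> and \<open>I\<^sup>n\<close> for \<open>ideal_monomial R s I n\<close>. The
  reason for the theorem is a count in one degree. For elements \<open>x i j \<in> I i\<close> consider the statement
  \<open>I\<^sup>n \<subseteq> J + \<Sum>i,j. x i j \<cdot> I\<^bsup>n - e\<^sub>i\<^esup>\<close>, where \<open>J\<close> is an ideal with
  \<open>\<mm> \<cdot> I\<^sup>n \<subseteq> J \<subseteq> I\<^sup>n\<close> and \<open>e\<^sub>i\<close> is the \<open>i\<close>-th unit vector (\<open>generates_modulo\<close>). It has a
  solution whenever the vector space \<open>I\<^sup>n/J\<close> has dimension less than \<open>\<Delta>\<close>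
  (\<open>exists_generating_tuple\<close>). The proof is by induction on \<open>n\<close> and \<open>r\<close>. Fix \<open>p\<close> with
  \<open>n p, r p \<ge> 1\<close>. By Pascal's rule \<open>\<Delta> = \<Delta>' + \<Delta>''\<close>, where \<open>\<Delta>'\<close> belongs to \<open>(n - e\<^sub>p, r)\<close> and \<open>\<Delta>''\<close> to
  \<open>(n, r - e\<^sub>p)\<close>. For \<open>x \<in> I p\<close> the ideal \<open>J\<^sub>x = J + x I\<^bsup>n - e\<^sub>p\<^esup>\<close> splits the dimension of
  \<open>I\<^sup>n/J\<close> in two.

  If \<open>I\<^sup>n/J\<^sub>x\<close> has dimension less than \<open>\<Delta>''\<close> for some \<open>x\<close>, the induction hypothesis for
  \<open>(n, r - e\<^sub>p)\<close> and \<open>J\<^sub>x\<close> gives all elements but one, and \<open>x\<close> is the missing one. Otherwise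
  \<open>J\<^sub>x/J\<close>, which is isomorphic to \<open>I\<^bsup>n - e\<^sub>p\<^esup>\<close> modulo \<open>(J : x)\<close>, has dimension less than
  \<open>\<Delta>'\<close> for every \<open>x \<in> I p\<close>, and the induction hypothesis for \<open>(n - e\<^sub>p, r)\<close> and \<open>(J : x)\<close> gives
  elements \<open>y\<close>, depending on \<open>x\<close>, with
  \<open>x I\<^bsup>n - e\<^sub>p\<^esup> \<subseteq> J + \<Sum>i,j. y i j \<cdot> I\<^bsup>n - e\<^sub>i\<^esup>\<close>. To be a solution is an open condition
  on \<open>y\<close> (\<open>generates_modulo_open\<close>), and over an infinite field finitely many non-empty open sets
  have a common point (\<open>polyfun_family_common_nonzero\<close>). So one \<open>y\<close> serves for all \<open>x\<close> in a finite
  set of generators of \<open>I p\<close>, and as \<open>I\<^sup>n = I p \<cdot> I\<^bsup>n - e\<^sub>p\<^esup>\<close>, it is a solution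
  (\<open>generates_modulo_quotient_step\<close>).

  For \<open>J = \<mm> \<cdot> I\<^sup>n\<close> the dimension is at most \<open>\<mu>(I\<^sup>n) < \<Delta>\<close>. One solution exists, so by openness a
  general tuple is a solution. Nakayama's lemma removes \<open>J\<close>, and multiplication by
  \<open>I\<^bsup>m - n\<^esup>\<close> gives all \<open>m \<ge> n\<close> (\<open>monomial_eq_sum\<close>).

  Vector spaces over the residue field are avoided: their dimension is measured by strict chains of
  ideals, and linear algebra is done with elements of \<open>R\<close>, where elements outside \<open>\<mm>\<close> are
  units. The residue field enters through the finiteness of roots of polynomials and in the comparison with
  Zariski-open sets at the end.
\<close>

section \<open>Ideals of the form \<open>J + xU\<close>\<close>

lemma ideal_subset_carrier: "ideal L R \<Longrightarrow> L \<subseteq> carrier R"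
  by (rule subsetI) (rule ideal.Icarr)

definition (in cring) plus_multiples :: "'a set \<Rightarrow> 'a \<Rightarrow> 'a set \<Rightarrow> 'a set" where
  "plus_multiples J x U = {e \<oplus> x \<otimes> u | e u. e \<in> J \<and> u \<in> U}"

lemma (in cring) plus_multiplesI:
  "e \<in> J \<Longrightarrow> u \<in> U \<Longrightarrow> e \<oplus> x \<otimes> u \<in> plus_multiples J x U"
  by (auto simp: plus_multiples_def)

lemma (in cring) plus_multiplesE:
  assumes "z \<in> plus_multiples J x U"
  obtains e u where "e \<in> J" "u \<in> U" "z = e \<oplus> x \<otimes> u"
  using assms by (auto simp: plus_multiples_def)

lemma (in cring) plus_multiples_ideal:
  assumes "ideal J R" "ideal U R" "x \<in> carrier R"
  shows "ideal (plus_multiples J x U) R"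
proof -
  interpret J: ideal J R by fact
  interpret U: ideal U R by fact
  have sub: "plus_multiples J x U \<subseteq> carrier R"
    using assms(3) J.a_subset U.a_subset unfolding plus_multiples_def by blast
  have l: "t \<otimes> z \<in> plus_multiples J x U" if z: "z \<in> plus_multiples J x U" and t: "t \<in> carrier R" for t z
  proof -
    obtain e u where eu: "e \<in> J" "u \<in> U" "z = e \<oplus> x \<otimes> u" using z by (rule plus_multiplesE)
    then have "t \<otimes> z = t \<otimes> e \<oplus> x \<otimes> (t \<otimes> u)"
      using t assms(3) J.Icarr U.Icarr by (simp add: r_distr m_lcomm)
    then show ?thesis using eu t by (simp add: plus_multiplesI J.I_l_closed U.I_l_closed)
  qed
  show ?thesis
  proof (rule idealI[OF ring_axioms])
    show "subgroup (plus_multiples J x U) (add_monoid R)"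
    proof (rule add.subgroupI)
      show "plus_multiples J x U \<noteq> {}"
        using plus_multiplesI[OF J.zero_closed U.zero_closed] by blast
    next
      fix a assume a: "a \<in> plus_multiples J x U"
      have "\<ominus> a = (\<ominus> \<one>) \<otimes> a" using a sub by (simp add: l_minus subset_iff)
      then show "\<ominus> a \<in> plus_multiples J x U"
        using l[OF a] by simp
    next
      fix a b assume a: "a \<in> plus_multiples J x U" and b: "b \<in> plus_multiples J x U"
      obtain e u where eu: "e \<in> J" "u \<in> U" "a = e \<oplus> x \<otimes> u" using a by (rule plus_multiplesE)
      obtain e' u' where eu': "e' \<in> J" "u' \<in> U" "b = e' \<oplus> x \<otimes> u'" using b by (rule plus_multiplesE)
      have "a \<oplus> b = (e \<oplus> e') \<oplus> x \<otimes> (u \<oplus> u')"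
        using eu eu' assms(3) by (simp add: J.Icarr U.Icarr r_distr a_ac)
      then show "a \<oplus> b \<in> plus_multiples J x U"
        using eu eu' by (simp add: plus_multiplesI)
    qed (use sub in auto)
  next
    fix a t assume a: "a \<in> plus_multiples J x U" and t: "t \<in> carrier R"
    show "t \<otimes> a \<in> plus_multiples J x U" using l[OF a t] .
    then show "a \<otimes> t \<in> plus_multiples J x U" using m_comm[of a t] a t sub by auto
  qed
qed

lemma (in cring) plus_multiples_minimal:
  assumes "ideal V R" "J \<subseteq> V" "\<And>u. u \<in> U \<Longrightarrow> x \<otimes> u \<in> V"
  shows "plus_multiples J x U \<subseteq> V"
proof -
  interpret V: ideal V R by fact
  show ?thesis using assms(2,3) V.a_closed unfolding plus_multiples_def by blast
qed

lemma (in cring) plus_multiples_superset: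
  assumes "ideal J R" "ideal U R" "x \<in> carrier R"
  shows "J \<subseteq> plus_multiples J x U" "u \<in> U \<Longrightarrow> x \<otimes> u \<in> plus_multiples J x U"
proof -
  interpret J: ideal J R by fact
  interpret U: ideal U R by fact
  show "J \<subseteq> plus_multiples J x U"
  proof
    fix e assume "e \<in> J"
    then show "e \<in> plus_multiples J x U"
      using plus_multiplesI[of e J \<zero> U x] assms(3) J.Icarr by simp
  qed
  show "x \<otimes> u \<in> plus_multiples J x U" if "u \<in> U"
    using plus_multiplesI[of \<zero> J u U x] assms(3) U.Icarr that by simp
qed

abbreviation (in cring) adjoin :: "'a set \<Rightarrow> 'a \<Rightarrow> 'a set" where
  "adjoin L v \<equiv> plus_multiples L v (carrier R)"

lemma (in cring) adjoin_ideal: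
  "ideal L R \<Longrightarrow> v \<in> carrier R \<Longrightarrow> ideal (adjoin L v) R"
  by (simp add: plus_multiples_ideal oneideal)

lemma (in cring) adjoin_superset:
  assumes "ideal L R" "v \<in> carrier R"
  shows "L \<subseteq> adjoin L v" "v \<in> adjoin L v"
  using plus_multiples_superset(1)[OF assms(1) oneideal assms(2)]
    plus_multiples_superset(2)[OF assms(1) oneideal assms(2) one_closed] assms(2)
  by simp_all

lemma (in cring) adjoin_minimal:
  assumes "ideal V R" "L \<subseteq> V" "v \<in> V"
  shows "adjoin L v \<subseteq> V"
  by (rule plus_multiples_minimal[OF assms(1,2)]) (rule ideal.I_r_closed[OF assms(1,3)])

lemma (in cring) Idl_insert:
  assumes "S \<subseteq> carrier R" "v \<in> carrier R"
  shows "Idl (insert v S) = adjoin (Idl S) v"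
proof
  have iS: "ideal (Idl S) R" using assms(1) by (rule genideal_ideal)
  have vS: "insert v S \<subseteq> carrier R" using assms by simp
  show "Idl (insert v S) \<subseteq> adjoin (Idl S) v"
  proof (rule genideal_minimal[OF adjoin_ideal[OF iS assms(2)]])
    show "insert v S \<subseteq> adjoin (Idl S) v"
      using adjoin_superset[OF iS assms(2)] genideal_self[OF assms(1)] by blast
  qed
  show "adjoin (Idl S) v \<subseteq> Idl (insert v S)"
  proof (rule adjoin_minimal[OF genideal_ideal[OF vS]])
    show "Idl S \<subseteq> Idl (insert v S)" using vS by (rule subset_Idl_subset) blast
    show "v \<in> Idl (insert v S)" using genideal_self[OF vS] by blast
  qed
qed

text \<open>
  The ideal quotient \<open>(E : W)\<close>. To show \<open>x \<otimes> w \<in> E\<close> for all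
  \<open>x\<close> in an ideal, it is enough to check generators, because this set is an ideal.
\<close>
lemma (in cring) ideal_quotient_ideal:
  assumes "ideal E R" "W \<subseteq> carrier R"
  shows "ideal {x \<in> carrier R. \<forall>w\<in>W. x \<otimes> w \<in> E} R"
proof -
  interpret E: ideal E R by fact
  have W: "w \<in> carrier R" if "w \<in> W" for w using assms that by auto
  show ?thesis
  proof (rule idealI[OF ring_axioms])
    show "subgroup {x \<in> carrier R. \<forall>w\<in>W. x \<otimes> w \<in> E} (add_monoid R)"
    proof (rule add.subgroupI)
      have "\<zero> \<in> {x \<in> carrier R. \<forall>w\<in>W. x \<otimes> w \<in> E}" using W by simp
      then show "{x \<in> carrier R. \<forall>w\<in>W. x \<otimes> w \<in> E} \<noteq> {}" by blast
    qed (use W in \<open>auto simp: l_distr l_minus\<close>)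
  next
    fix a x assume a: "a \<in> {x \<in> carrier R. \<forall>w\<in>W. x \<otimes> w \<in> E}" and x: "x \<in> carrier R"
    then show "x \<otimes> a \<in> {x \<in> carrier R. \<forall>w\<in>W. x \<otimes> w \<in> E}"
      using W by (auto simp: m_assoc E.I_l_closed)
    then show "a \<otimes> x \<in> {x \<in> carrier R. \<forall>w\<in>W. x \<otimes> w \<in> E}"
      using a m_comm[OF x, of a] by simp
  qed
qed

text \<open>
  The partial spans are kept, because independence is later expressed by
  \<open>b l \<notin> span_upto L b l\<close>.
\<close>
primrec (in cring) span_upto :: "'a set \<Rightarrow> (nat \<Rightarrow> 'a) \<Rightarrow> nat \<Rightarrow> 'a set" where
  "span_upto L b 0 = L"
| "span_upto L b (Suc d) = adjoin (span_upto L b d) (b d)"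

lemma (in cring) span_upto_ideal:
  "ideal L R \<Longrightarrow> (\<And>l. l < d \<Longrightarrow> b l \<in> carrier R) \<Longrightarrow> ideal (span_upto L b d) R"
  by (induction d) (auto simp: adjoin_ideal)

lemma (in cring) span_upto_superset:
  assumes "ideal L R" "\<And>l. l < d \<Longrightarrow> b l \<in> carrier R"
  shows "L \<subseteq> span_upto L b d"
  using assms(2)
proof (induction d)
  case (Suc d)
  then show ?case
    using adjoin_superset(1)[OF span_upto_ideal[OF assms(1), of d b], of "b d"] by auto
qed auto

lemma (in cring) span_upto_cong:
  "(\<And>l. l < d \<Longrightarrow> b l = b' l) \<Longrightarrow> span_upto L b d = span_upto L b' d"
  by (induction d) auto

lemma (in cring) span_upto_minimal:
  assumes "ideal V R" "L \<subseteq> V" "\<And>l. l < d \<Longrightarrow> b l \<in> V"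
  shows "span_upto L b d \<subseteq> V"
  using assms(3)
proof (induction d)
  case (Suc d)
  then show ?case using adjoin_minimal[OF assms(1), of "span_upto L b d" "b d"] by simp
qed (use assms in auto)

text \<open>
  The generators are passed through one by one, and those that already lie in the span of \<open>L\<close> and
  the earlier ones are dropped.
\<close>
lemma (in cring) exists_independent_span:
  assumes "ideal L R" "finite A" "A \<subseteq> carrier R"
  shows "\<exists>b d. span_upto L b d = Idl (L \<union> A) \<and>
    (\<forall>l<d. b l \<in> carrier R \<and> b l \<notin> span_upto L b l)"
  using assms(2,3)
proof induction
  case empty
  have "Idl L = L"
    using genideal_minimal[OF assms(1) subset_refl]
      genideal_self[OF ideal_subset_carrier[OF assms(1)]] by (rule subset_antisym)
  then show ?case by (intro exI[of _ "\<lambda>_. \<zero>"] exI[of _ 0]) auto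
next
  case (insert a A)
  then obtain b d where b: "span_upto L b d = Idl (L \<union> A)"
    "\<forall>l<d. b l \<in> carrier R \<and> b l \<notin> span_upto L b l" by auto
  have LA: "L \<union> A \<subseteq> carrier R"
    using insert.prems ideal_subset_carrier[OF assms(1)] by auto
  have eq: "Idl (L \<union> insert a A) = adjoin (Idl (L \<union> A)) a"
    using Idl_insert[OF LA, of a] insert by simp
  show ?case
  proof (cases "a \<in> span_upto L b d")
    case True
    then have "adjoin (Idl (L \<union> A)) a = Idl (L \<union> A)"
      using adjoin_minimal[OF genideal_ideal[OF LA] subset_refl, of a]
        adjoin_superset[OF genideal_ideal[OF LA], of a] insert b by auto
    with b eq show ?thesis by metis
  next
    case False
    have *: "span_upto L (b(d := a)) l = span_upto L b l" if "l \<le> d" for l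
      by (rule span_upto_cong) (use that in auto)
    have "span_upto L (b(d := a)) (Suc d) = Idl (L \<union> insert a A)"
      using *[of d] b(1) eq by simp
    moreover have "(b(d := a)) l \<in> carrier R \<and> (b(d := a)) l \<notin> span_upto L (b(d := a)) l"
      if "l < Suc d" for l
    proof (cases "l = d")
      case True
      then show ?thesis using *[of d] False insert by simp
    next
      case False
      with that *[of l] b(2) show ?thesis by simp
    qed
    ultimately show ?thesis by blast
  qed
qed

section \<open>Chains of ideals as a measure of dimension\<close>

text \<open>
  For \<open>\<mm> \<cdot> V \<subseteq> L\<close> the ideals between \<open>L\<close> and \<open>V\<close>
  are the subspaces of \<open>V/L\<close>, so this says that the dimension of \<open>V/L\<close> is at least
  \<open>d\<close>. In this form the inequality \<open>dim V/L \<ge> dim U/L + dim V/U\<close> is a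
  concatenation of chains.
\<close>
primrec has_ideal_chain :: "('a, 'b) ring_scheme \<Rightarrow> nat \<Rightarrow> 'a set \<Rightarrow> 'a set \<Rightarrow> bool" where
  "has_ideal_chain R 0 L V \<longleftrightarrow> L \<subseteq> V"
| "has_ideal_chain R (Suc d) L V \<longleftrightarrow> (\<exists>U. ideal U R \<and> L \<subset> U \<and> has_ideal_chain R d U V)"

lemma has_ideal_chain_SucE:
  assumes "has_ideal_chain R (Suc d) L V"
  obtains U where "ideal U R" "L \<subset> U" "has_ideal_chain R d U V"
  using assms by (simp only: has_ideal_chain.simps) blast

lemma has_ideal_chain_SucI:
  "ideal U R \<Longrightarrow> L \<subset> U \<Longrightarrow> has_ideal_chain R d U V \<Longrightarrow> has_ideal_chain R (Suc d) L V"
  unfolding has_ideal_chain.simps by blast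

lemma has_ideal_chain_subset: "has_ideal_chain R d L V \<Longrightarrow> L \<subseteq> V"
proof (induction d arbitrary: L)
  case (Suc d)
  from Suc.prems obtain U where "L \<subset> U" "has_ideal_chain R d U V"
    by (rule has_ideal_chain_SucE)
  with Suc.IH[of U] show ?case by blast
qed simp

lemma has_ideal_chain_lower:
  assumes "has_ideal_chain R d U V" "L \<subseteq> U"
  shows "has_ideal_chain R d L V"
proof (cases d)
  case (Suc c)
  from assms(1)[unfolded Suc] obtain W where
    W: "ideal W R" "U \<subset> W" "has_ideal_chain R c W V"
    by (rule has_ideal_chain_SucE)
  moreover have "L \<subset> W" using W(2) assms(2) by blast
  ultimately show ?thesis unfolding Suc by (intro has_ideal_chain_SucI)
qed (use assms in auto)

lemma has_ideal_chain_append: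
  assumes "has_ideal_chain R d L U" "has_ideal_chain R e U V"
  shows "has_ideal_chain R (d + e) L V"
  using assms(1)
proof (induction d arbitrary: L)
  case 0
  then show ?case using has_ideal_chain_lower[OF assms(2)] by simp
next
  case (Suc d)
  from Suc.prems obtain W where "ideal W R" "L \<subset> W" "has_ideal_chain R d W U"
    by (rule has_ideal_chain_SucE)
  with Suc.IH show ?case by (simp only: add_Suc) (rule has_ideal_chain_SucI)
qed

text \<open>
  Multiplication by \<open>x\<close> induces an isomorphism from \<open>V\<close> modulo
  \<open>V \<inter> (J : x)\<close> to \<open>J + xV\<close> modulo \<open>J\<close>, and so preserves strict
  inclusions.
\<close>
lemma (in cring) has_ideal_chain_colon:
  assumes "ideal J R" "x \<in> carrier R"
    and "ideal U R" "{a \<in> V. x \<otimes> a \<in> J} \<subseteq> U" "ideal V R"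
    and "has_ideal_chain R d U V"
  shows "has_ideal_chain R d (plus_multiples J x U) (plus_multiples J x V)"
  using assms(3,4,6)
proof (induction d arbitrary: U)
  case 0
  then show ?case by (auto simp: plus_multiples_def)
next
  case (Suc d)
  interpret J: ideal J R by fact
  interpret V: ideal V R by fact
  from Suc.prems(3) obtain U' where U': "ideal U' R" "U \<subset> U'" "has_ideal_chain R d U' V"
    by (rule has_ideal_chain_SucE)
  interpret U: ideal U R by fact
  interpret U': ideal U' R by fact
  let ?F = "plus_multiples J x"
  have "U' \<subseteq> V" using U' has_ideal_chain_subset by blast
  obtain u' where u': "u' \<in> U'" "u' \<notin> U" using U' by auto
  have "x \<otimes> u' \<in> ?F U'"
    using plus_multiples_superset(2)[OF assms(1) U'(1) assms(2)] u' by auto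
  moreover have "x \<otimes> u' \<notin> ?F U"
  proof
    assume "x \<otimes> u' \<in> ?F U"
    then obtain e u where eu: "x \<otimes> u' = e \<oplus> x \<otimes> u" "e \<in> J" "u \<in> U"
      by (auto elim: plus_multiplesE)
    have c: "u \<in> carrier R" "u' \<in> carrier R" "e \<in> carrier R"
      using eu u' U.Icarr U'.Icarr J.Icarr by auto
    have "x \<otimes> (u' \<ominus> u) = x \<otimes> u' \<ominus> x \<otimes> u"
      using c assms(2) by (simp add: r_distr r_minus minus_eq)
    also have "\<dots> = e" using eu c assms(2) by (simp add: minus_eq a_assoc r_neg)
    finally have "x \<otimes> (u' \<ominus> u) \<in> J" using eu by simp
    moreover have "u' \<ominus> u \<in> V"
      using u' eu \<open>U' \<subseteq> V\<close> U'(2) by (auto simp: minus_eq)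
    ultimately have "u' \<ominus> u \<in> U" using Suc.prems by auto
    then have "(u' \<ominus> u) \<oplus> u \<in> U" using eu by auto
    then show False using u' c by (simp add: minus_eq a_assoc l_neg)
  qed
  moreover have "?F U \<subseteq> ?F U'" using U'(2) by (auto simp: plus_multiples_def)
  ultimately have "?F U \<subset> ?F U'" by blast
  moreover have "ideal (?F U') R" using plus_multiples_ideal[OF assms(1) U'(1) assms(2)] .
  moreover have "has_ideal_chain R d (?F U') (?F V)"
    using Suc.IH[OF U'(1) _ U'(3)] Suc.prems(2) U'(2) by blast
  ultimately show ?case by (intro has_ideal_chain_SucI)
qed

section \<open>Local rings: units, Nakayama's lemma, chains and generators\<close>

context noetherian_local_ring
begin

lemma finitely_generated:
  assumes "ideal V R"
  obtains A where "finite A" "A \<subseteq> carrier R" "V = Idl A"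
  using finetely_gen[OF assms] by auto

lemma max_carrier: "a \<in> \<mm> \<Longrightarrow> a \<in> carrier R"
  by (rule Icarr)

text \<open>
  Otherwise, as \<open>R\<close> is Noetherian, a maximal element exists among the proper ideals that contain
  \<open>a\<close>. It is a maximal ideal, hence equal to \<open>\<mm>\<close>.
\<close>
lemma inverse_outside_maximal:
  assumes "a \<in> carrier R" "a \<notin> \<mm>"
  obtains u where "u \<in> carrier R" "u \<otimes> a = \<one>"
proof -
  have "\<one> \<in> PIdl a"
  proof (rule ccontr)
    assume n: "\<one> \<notin> PIdl a"
    let ?A = "{J. ideal J R \<and> a \<in> J \<and> \<one> \<notin> J}"
    have ne: "?A \<noteq> {}" using n cgenideal_ideal[OF assms(1)] cgenideal_self[OF assms(1)] by blast
    have "\<exists>M\<in>?A. \<forall>Z\<in>?A. M \<subseteq> Z \<longrightarrow> Z = M"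
    proof (rule subset_Zorn_nonempty[OF ne])
      fix C assume C: "C \<noteq> {}" "subset.chain ?A C"
      then have "subset.chain {I. ideal I R} C" by (auto simp: subset_chain_def)
      then have "\<Union>C \<in> C" using ideal_chain_is_trivial[OF C(1)] by blast
      then show "\<Union>C \<in> ?A" using C by (auto simp: subset_chain_def)
    qed
    then obtain M where M: "ideal M R" "a \<in> M" "\<one> \<notin> M"
      "\<And>Z. ideal Z R \<Longrightarrow> a \<in> Z \<Longrightarrow> \<one> \<notin> Z \<Longrightarrow> M \<subseteq> Z \<Longrightarrow> Z = M" by auto
    have "maximalideal M R"
    proof (rule maximalidealI[OF M(1)])
      show "carrier R \<noteq> M" using M by auto
      fix J assume J: "ideal J R" "M \<subseteq> J" "J \<subseteq> carrier R"
      show "J = M \<or> J = carrier R"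
        using M J ideal.one_imp_carrier by blast
    qed
    then show False using maximal_unique M(2) assms(2) by auto
  qed
  then show ?thesis using that by (auto simp: cgenideal_def)
qed

lemma unit_multiple_cancel:
  assumes "ideal L R" "t \<in> carrier R" "t \<notin> \<mm>" "v \<in> carrier R" "t \<otimes> v \<in> L"
  shows "v \<in> L"
proof -
  obtain u where u: "u \<in> carrier R" "u \<otimes> t = \<one>" using inverse_outside_maximal assms by metis
  have "u \<otimes> (t \<otimes> v) \<in> L" using ideal.I_l_closed[OF assms(1,5) u(1)] .
  then show ?thesis using assms u by (simp flip: m_assoc)
qed


text \<open>
  By induction on the generators: modulo \<open>L + (a)\<close> there is one generator less. Then
  \<open>a = e + a t\<close> with \<open>e \<in> L\<close> and \<open>t \<in> \<mm>\<close>, and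
  \<open>1 - t\<close> is a unit.
\<close>
lemma nakayama_generators:
  assumes L: "ideal L R" and "finite A" "A \<subseteq> carrier R"
    and sub: "\<And>a. a \<in> A \<Longrightarrow> a \<in> Idl (L \<union> {t \<otimes> b | t b. t \<in> \<mm> \<and> b \<in> A})"
  shows "A \<subseteq> L"
  using assms(2,3,1,4)
proof (induction A arbitrary: L rule: finite_induct)
  case (insert a A)
  let ?B = "\<lambda>A. {t \<otimes> b | t b. t \<in> \<mm> \<and> b \<in> A}"
  let ?L = "adjoin L a"
  have LC: "L \<subseteq> carrier R" using insert.prems(2) by (rule ideal_subset_carrier)
  have BC: "?B A \<subseteq> carrier R" using insert.prems max_carrier by auto
  have aC: "a \<in> carrier R" using insert.prems by auto
  have iL: "ideal ?L R" using insert.prems aC by (simp add: adjoin_ideal)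
  interpret L': ideal ?L R by fact
  \<comment> \<open>Modulo \<open>a\<close> the remaining generators satisfy the same hypothesis.\<close>
  have "A \<subseteq> ?L"
  proof (rule insert.IH[OF _ iL])
    fix b assume "b \<in> A"
    then have "b \<in> Idl (L \<union> ?B (insert a A))" using insert.prems by auto
    moreover have "Idl (L \<union> ?B (insert a A)) \<subseteq> Idl (?L \<union> ?B A)"
    proof (rule genideal_minimal)
      have sub: "?L \<union> ?B A \<subseteq> carrier R" using L'.a_subset BC by auto
      show "ideal (Idl (?L \<union> ?B A)) R" using sub by (rule genideal_ideal)
      have "t \<otimes> a \<in> ?L" if "t \<in> \<mm>" for t
        using adjoin_superset(2)[OF insert.prems(2) aC] L'.I_l_closed max_carrier that by auto
      then have "L \<union> ?B (insert a A) \<subseteq> ?L \<union> ?B A"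
        using adjoin_superset(1)[OF insert.prems(2) aC] by auto
      then show "L \<union> ?B (insert a A) \<subseteq> Idl (?L \<union> ?B A)"
        using genideal_self[OF sub] by (rule order_trans)
    qed
    ultimately show "b \<in> Idl (?L \<union> ?B A)" by auto
  qed (use insert.prems in auto)
  \<comment> \<open>Hence \<open>a\<close> is, modulo \<open>L\<close>, a multiple of itself by an element of the maximal ideal.\<close>
  have iN: "ideal (plus_multiples L a \<mm>) R"
    using insert.prems(2) aC is_ideal by (simp add: plus_multiples_ideal)
  have "Idl (L \<union> ?B (insert a A)) \<subseteq> plus_multiples L a \<mm>"
  proof (rule genideal_minimal[OF iN])
    have "t \<otimes> b \<in> plus_multiples L a \<mm>" if tb: "t \<in> \<mm>" "b \<in> ?L" for t b
    proof -
      obtain e u where eu: "e \<in> L" "u \<in> carrier R" "b = e \<oplus> a \<otimes> u"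
        using tb(2) by (rule plus_multiplesE)
      have "t \<otimes> b = t \<otimes> e \<oplus> a \<otimes> (t \<otimes> u)"
        using eu max_carrier[OF tb(1)] aC LC by (simp add: r_distr m_lcomm subset_iff)
      moreover have "t \<otimes> e \<in> L" using insert.prems(2) eu max_carrier[OF tb(1)]
        by (simp add: ideal.I_l_closed)
      ultimately show ?thesis using tb eu by (simp add: plus_multiplesI I_r_closed)
    qed
    then show "L \<union> ?B (insert a A) \<subseteq> plus_multiples L a \<mm>"
      using \<open>A \<subseteq> ?L\<close> adjoin_superset(2)[OF insert.prems(2) aC]
        plus_multiples_superset(1)[OF insert.prems(2) is_ideal aC] by auto
  qed
  then have "a \<in> plus_multiples L a \<mm>" using insert.prems by auto
  then obtain e t where et: "e \<in> L" "t \<in> \<mm>" "a = e \<oplus> a \<otimes> t"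
    by (rule plus_multiplesE)
  have eC: "e \<in> carrier R" and tC: "t \<in> carrier R" using et LC max_carrier by auto
  have "(\<one> \<ominus> t) \<otimes> a = a \<ominus> a \<otimes> t"
    using aC tC m_comm[of t a] by (simp add: minus_eq l_distr l_minus)
  also have "\<dots> = (e \<oplus> a \<otimes> t) \<ominus> a \<otimes> t"
    by (rule arg_cong[OF et(3), of "\<lambda>z. z \<ominus> a \<otimes> t"])
  also have "\<dots> = e" using aC tC eC by (simp add: minus_eq a_assoc r_neg)
  finally have "(\<one> \<ominus> t) \<otimes> a \<in> L" using et by simp
  moreover have "\<one> \<ominus> t \<notin> \<mm>"
  proof
    assume "\<one> \<ominus> t \<in> \<mm>"
    then have "(\<one> \<ominus> t) \<oplus> t \<in> \<mm>" using et by simp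
    then have "\<one> \<in> \<mm>" using tC by (simp add: minus_eq a_assoc l_neg)
    then show False using I_notcarr one_imp_carrier by blast
  qed
  ultimately have "a \<in> L"
    using unit_multiple_cancel[OF insert.prems(2), of "\<one> \<ominus> t" a] aC tC by simp
  moreover from this have "?L \<subseteq> L" using insert.prems(2) by (simp add: adjoin_minimal)
  ultimately show ?case using \<open>A \<subseteq> ?L\<close> by auto
qed auto

lemma nakayama:
  assumes V: "ideal V R" and S: "S \<subseteq> carrier R"
    and "V \<subseteq> Idl (\<mm> \<cdot> V \<union> S)"
  shows "V \<subseteq> Idl S"
proof -
  interpret V: ideal V R by fact
  obtain A where A: "finite A" "A \<subseteq> carrier R" "V = Idl A" using finitely_generated[OF V] .
  let ?B = "{t \<otimes> b | t b. t \<in> \<mm> \<and> b \<in> A}"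
  have BC: "Idl S \<union> ?B \<subseteq> carrier R"
    using A max_carrier ideal_subset_carrier[OF genideal_ideal[OF S]] by auto
  have iE: "ideal (Idl (Idl S \<union> ?B)) R" using BC by (rule genideal_ideal)
  have AV: "A \<subseteq> V" using A genideal_self[OF A(2)] by simp
  have 1: "\<mm> \<cdot> V \<subseteq> Idl (Idl S \<union> ?B)"
  proof
    fix z assume "z \<in> \<mm> \<cdot> V"
    then show "z \<in> Idl (Idl S \<union> ?B)"
    proof induction
      case (prod t v)
      have tC: "t \<in> carrier R" using prod max_carrier by auto
      have "V \<subseteq> {v \<in> carrier R. \<forall>w\<in>{t}. v \<otimes> w \<in> Idl (Idl S \<union> ?B)}"
        unfolding A(3)
      proof (rule genideal_minimal[OF ideal_quotient_ideal[OF iE]])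
        show "A \<subseteq> {v \<in> carrier R. \<forall>w\<in>{t}. v \<otimes> w \<in> Idl (Idl S \<union> ?B)}"
        proof
          fix a assume a: "a \<in> A"
          then have "t \<otimes> a \<in> ?B" using prod by blast
          then have "t \<otimes> a \<in> Idl (Idl S \<union> ?B)" using genideal_self[OF BC] by blast
          then show "a \<in> {v \<in> carrier R. \<forall>w\<in>{t}. v \<otimes> w \<in> Idl (Idl S \<union> ?B)}"
            using a A tC m_comm[of t a] by auto
        qed
      qed (use tC in auto)
      then show ?case using prod tC V.Icarr m_comm[of t v] by auto
    next
      case (sum s1 s2)
      then show ?case by (intro additive_subgroup.a_closed ideal.axioms(1) iE)
    qed
  qed
  have 2: "S \<subseteq> Idl (Idl S \<union> ?B)"
    using genideal_self[OF BC] genideal_self[OF S] by blast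
  have "A \<subseteq> Idl S"
  proof (rule nakayama_generators[OF genideal_ideal[OF S] A(1,2)])
    fix a assume "a \<in> A"
    then have "a \<in> Idl (\<mm> \<cdot> V \<union> S)" using AV assms(3) by auto
    moreover have "Idl (\<mm> \<cdot> V \<union> S) \<subseteq> Idl (Idl S \<union> ?B)"
      using 1 2 iE by (intro genideal_minimal) auto
    ultimately show "a \<in> Idl (Idl S \<union> ?B)" by auto
  qed
  then show ?thesis unfolding A(3) by (intro genideal_minimal genideal_ideal S)
qed

text \<open>
  Adding \<open>a\<close> to every member of a chain makes at most one inclusion an equality. Indeed, an
  inclusion of \<open>L\<close> in \<open>U\<close> stays strict unless \<open>a \<in> U\<close>: if
  \<open>u = e + a t\<close> lies in \<open>U\<close> but not in \<open>L\<close>, then \<open>t\<close> is a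
  unit, as \<open>\<mm> a \<subseteq> L\<close>, and \<open>a \<in> U\<close>.
\<close>
lemma has_ideal_chain_adjoin:
  assumes "ideal L R" "ideal V R" "a \<in> V" "\<And>t v. t \<in> \<mm> \<Longrightarrow> v \<in> V \<Longrightarrow> t \<otimes> v \<in> L"
    and "has_ideal_chain R (Suc d) L V"
  shows "has_ideal_chain R d (adjoin L a) V"
  using assms(1,4,5)
proof (induction d arbitrary: L)
  case 0
  then have "L \<subseteq> V" using has_ideal_chain_subset by blast
  then show ?case using adjoin_minimal[OF assms(2) _ assms(3)] by simp
next
  case (Suc d)
  interpret V: ideal V R by fact
  interpret L: ideal L R by fact
  have aC: "a \<in> carrier R" using assms(3) V.Icarr by auto
  from Suc.prems(3) obtain U where U: "ideal U R" "L \<subset> U" "has_ideal_chain R (Suc d) U V"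
    by (rule has_ideal_chain_SucE)
  interpret U: ideal U R by fact
  have UV: "U \<subseteq> V" using U has_ideal_chain_subset by blast
  show ?case
  proof (cases "a \<in> U")
    case True
    then have "adjoin L a \<subseteq> U" using U by (intro adjoin_minimal) auto
    then show ?thesis using U has_ideal_chain_lower by blast
  next
    case False
    have "adjoin L a \<subset> adjoin U a"
    proof
      show "adjoin L a \<subseteq> adjoin U a" using U by (auto simp: plus_multiples_def)
      obtain u where u: "u \<in> U" "u \<notin> L" using U by auto
      have "u \<notin> adjoin L a"
      proof
        assume "u \<in> adjoin L a"
        then obtain e t where et: "e \<in> L" "t \<in> carrier R" "u = e \<oplus> a \<otimes> t" by (rule plus_multiplesE)
        show False
        proof (cases "t \<in> \<mm>")
          case True
          then have "a \<otimes> t \<in> L" using Suc.prems(2)[OF True assms(3)] m_comm[of a t] aC et by simp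
          then show False using u et by auto
        next
          case False
          have "u \<ominus> e \<in> U" using u et U(2) by (auto simp: minus_eq)
          moreover have "u \<ominus> e = t \<otimes> a"
            using et aC L.Icarr[OF et(1)] by (simp add: minus_eq a_ac r_neg1 r_neg r_neg2 m_comm)
          ultimately have "a \<in> U" using unit_multiple_cancel[OF U(1) et(2) False aC] by simp
          then show False using \<open>a \<notin> U\<close> by simp
        qed
      qed
      then show "adjoin L a \<noteq> adjoin U a"
        using u adjoin_superset(1)[OF U(1) aC] by auto
    qed
    moreover have "has_ideal_chain R d (adjoin U a) V"
      using Suc.IH[OF U(1) _ U(3)] Suc.prems(2) U(2) by blast
    ultimately show ?thesis using adjoin_ideal[OF U(1) aC] by (intro has_ideal_chain_SucI)
  qed
qed

lemma has_ideal_chain_le_card: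
  assumes "finite A" "ideal L R" "V = Idl (L \<union> A)" "A \<subseteq> V"
    "\<And>t v. t \<in> \<mm> \<Longrightarrow> v \<in> V \<Longrightarrow> t \<otimes> v \<in> L" "ideal V R" "has_ideal_chain R d L V"
  shows "d \<le> card A"
  using assms
proof (induction A arbitrary: L d rule: finite_induct)
  case empty
  have "V \<subseteq> L" using empty.prems(2) genideal_minimal[OF empty.prems(1), of L] by simp
  show ?case
  proof (cases d)
    case (Suc c)
    from empty.prems(6)[unfolded Suc] obtain U where "L \<subset> U" "has_ideal_chain R c U V"
      by (rule has_ideal_chain_SucE)
    then show ?thesis using \<open>V \<subseteq> L\<close> has_ideal_chain_subset by blast
  qed simp
next
  case (insert a A)
  have aV: "a \<in> V" and aC: "a \<in> carrier R" using insert.prems(3) ideal_subset_carrier[OF insert.prems(5)] by auto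
  show ?case
  proof (cases d)
    case (Suc c)
    have LC: "L \<subseteq> carrier R" using insert.prems(1) by (rule ideal_subset_carrier)
    have VC: "V \<subseteq> carrier R" using insert.prems(5) by (rule ideal_subset_carrier)
    have sup: "L \<subseteq> adjoin L a" "a \<in> adjoin L a" using adjoin_superset[OF insert.prems(1) aC] by auto
    have iL: "ideal (adjoin L a) R" using adjoin_ideal[OF insert.prems(1) aC] .
    have c: "adjoin L a \<union> A \<subseteq> carrier R" using ideal_subset_carrier[OF iL] insert.prems(3) VC by auto
    have "c \<le> card A"
    proof (rule insert.IH[OF iL])
      show "V = Idl (adjoin L a \<union> A)"
      proof
        show "V \<subseteq> Idl (adjoin L a \<union> A)" unfolding insert.prems(2)
          using genideal_self[OF c] genideal_ideal[OF c] sup by (intro genideal_minimal) auto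
        have "L \<subseteq> V" using has_ideal_chain_subset insert.prems(6) by blast
        then show "Idl (adjoin L a \<union> A) \<subseteq> V"
          using insert.prems(3) adjoin_minimal[OF insert.prems(5) _ aV]
          by (intro genideal_minimal insert.prems(5)) simp
      qed
      show "has_ideal_chain R c (adjoin L a) V"
        using has_ideal_chain_adjoin[OF insert.prems(1,5) aV insert.prems(4)] insert.prems(6) Suc by blast
    qed (use insert.prems sup in auto)
    then show ?thesis using Suc insert by simp
  qed simp
qed

end

section \<open>Polynomial functions over an infinite residue field\<close>

lemma (in abelian_group) add_diff_cancel_left:
  assumes "e \<in> carrier G" "z \<in> carrier G"
  shows "(e \<oplus> z) \<ominus> e = z"
proof -
  have "(e \<oplus> z) \<ominus> e = (z \<oplus> e) \<oplus> \<ominus> e" using assms by (simp only: minus_eq a_comm)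
  then show ?thesis using assms by (simp add: a_assoc r_neg)
qed

lemma (in abelian_group) add_diff_cancel_right:
  assumes "e \<in> carrier G" "z \<in> carrier G"
  shows "e \<oplus> (z \<ominus> e) = z"
proof -
  have "e \<oplus> (z \<ominus> e) = (z \<ominus> e) \<oplus> e" using assms by (intro a_comm) auto
  then show ?thesis using assms by (simp add: minus_eq a_assoc l_neg)
qed

lemma (in ring) add_minus_one_multiple:
  assumes "a \<in> carrier R" "f \<in> carrier R" "u \<in> carrier R"
  shows "(a \<oplus> ((\<ominus> \<one>) \<otimes> f) \<otimes> u) \<oplus> f \<otimes> u = a"
  using assms by (simp add: l_minus a_assoc l_neg)

lemma (in ideal) quotient_carrierE:
  assumes "x \<in> carrier (R Quot I)"
  obtains t where "t \<in> carrier R" "x = I +> t"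
  using assms unfolding FactRing_def A_RCOSETS_def' by auto

text \<open>
  Polynomial functions are treated as functions on \<open>R\<close> with an arbitrary index set of variables.
  Their nonvanishing means \<open>f c \<notin> \<mm>\<close>, which is nonvanishing of the reduction modulo
  \<open>\<mm>\<close>.
\<close>
inductive_set polyfun :: "('a, 'b) ring_scheme \<Rightarrow> 'v set \<Rightarrow> (('v \<Rightarrow> 'a) \<Rightarrow> 'a) set"
  for R Y where
  polyfun_const: "a \<in> carrier R \<Longrightarrow> (\<lambda>c. a) \<in> polyfun R Y"
| polyfun_var: "i \<in> Y \<Longrightarrow> (\<lambda>c. c i) \<in> polyfun R Y"
| polyfun_add: "f \<in> polyfun R Y \<Longrightarrow> g \<in> polyfun R Y \<Longrightarrow> (\<lambda>c. f c \<oplus>\<^bsub>R\<^esub> g c) \<in> polyfun R Y"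
| polyfun_mult: "f \<in> polyfun R Y \<Longrightarrow> g \<in> polyfun R Y \<Longrightarrow> (\<lambda>c. f c \<otimes>\<^bsub>R\<^esub> g c) \<in> polyfun R Y"

lemma (in ring) polyfun_closed:
  assumes "f \<in> polyfun R Y" "c \<in> Y \<rightarrow> carrier R"
  shows "f c \<in> carrier R"
  using assms(1) by induction (use assms(2) in auto)

lemma polyfun_cong:
  assumes "f \<in> polyfun R Y" "\<And>i. i \<in> Y \<Longrightarrow> c i = c' i"
  shows "f c = f c'"
  using assms(1) by induction (use assms(2) in auto)

text \<open>
  Reduced modulo a maximal ideal, the restriction to a line is a polynomial in one variable over a field; it
  has finitely many roots unless it is zero.
\<close>
lemma (in maximalideal) polyfun_on_line:
  assumes "cring R" "f \<in> polyfun R Y" "c \<in> Y \<rightarrow> carrier R" "d \<in> Y \<rightarrow> carrier R"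
  shows "\<exists>p\<in>carrier (poly_ring (R Quot I)). \<forall>t\<in>carrier R.
    I +> f (\<lambda>i. c i \<oplus> t \<otimes> d i) = ring.eval (R Quot I) p (I +> t)"
proof -
  interpret R: cring R by fact
  let ?K = "R Quot I"
  interpret K: field ?K using quotient_is_field[OF assms(1)] .
  interpret h: ring_hom_ring R ?K "(+>) I" by (rule rcos_ring_hom_ring)
  have sr: "subring (carrier ?K) ?K" by (rule K.carrier_is_subring)
  interpret P: domain "poly_ring ?K" using K.univ_poly_is_domain[OF sr] .
  have ev: "K.eval (p \<oplus>\<^bsub>poly_ring ?K\<^esub> q) x = K.eval p x \<oplus>\<^bsub>?K\<^esub> K.eval q x"
    "K.eval (p \<otimes>\<^bsub>poly_ring ?K\<^esub> q) x = K.eval p x \<otimes>\<^bsub>?K\<^esub> K.eval q x"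
    if "p \<in> carrier (poly_ring ?K)" "q \<in> carrier (poly_ring ?K)" "x \<in> carrier ?K" for p q x
    using ring_hom_add[OF K.eval_is_hom[OF sr that(3)] that(1,2)]
      ring_hom_mult[OF K.eval_is_hom[OF sr that(3)] that(1,2)] by auto
  have const: "\<exists>p\<in>carrier (poly_ring ?K). \<forall>x\<in>carrier ?K. K.eval p x = a" if "a \<in> carrier ?K" for a
  proof (cases "a = \<zero>\<^bsub>?K\<^esub>")
    case True
    then show ?thesis by (intro bexI[of _ "[]"]) auto
  next
    case False
    then have "[a] \<in> carrier (poly_ring ?K)"
      using that by (simp add: univ_poly_def polynomial_def)
    then show ?thesis using that by (intro bexI[of _ "[a]"]) auto
  qed
  from assms(2) show ?thesis
  proof induction
    case (polyfun_const a)
    then obtain p where "p \<in> carrier (poly_ring ?K)" "\<forall>x\<in>carrier ?K. K.eval p x = I +> a"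
      using const[of "I +> a"] by auto
    then show ?case by (intro bexI[of _ p]) auto
  next
    case (polyfun_var i)
    have ci: "c i \<in> carrier R" "d i \<in> carrier R" using polyfun_var assms(3,4) by auto
    obtain p where p: "p \<in> carrier (poly_ring ?K)" "\<forall>x\<in>carrier ?K. K.eval p x = I +> c i"
      using const[of "I +> c i"] ci by auto
    obtain q where q: "q \<in> carrier (poly_ring ?K)" "\<forall>x\<in>carrier ?K. K.eval q x = I +> d i"
      using const[of "I +> d i"] ci by auto
    have Y: "X\<^bsub>?K\<^esub> \<in> carrier (poly_ring ?K)" using K.var_closed[OF sr] by simp
    let ?r = "p \<oplus>\<^bsub>poly_ring ?K\<^esub> (X\<^bsub>?K\<^esub> \<otimes>\<^bsub>poly_ring ?K\<^esub> q)"
    have "I +> (c i \<oplus> t \<otimes> d i) = K.eval ?r (I +> t)" if "t \<in> carrier R" for t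
      using that ci p q Y K.eval_var[of "I +> t"] by (simp add: ev)
    moreover have "?r \<in> carrier (poly_ring ?K)" using p q Y by simp
    ultimately show ?case by blast
  next
    case (polyfun_add f g)
    then obtain p q where pq: "p \<in> carrier (poly_ring ?K)" "q \<in> carrier (poly_ring ?K)"
      "\<forall>t\<in>carrier R. I +> f (\<lambda>i. c i \<oplus> t \<otimes> d i) = K.eval p (I +> t)"
      "\<forall>t\<in>carrier R. I +> g (\<lambda>i. c i \<oplus> t \<otimes> d i) = K.eval q (I +> t)" by blast
    have "(\<lambda>i. c i \<oplus> t \<otimes> d i) \<in> Y \<rightarrow> carrier R" if "t \<in> carrier R" for t
      using that assms(3,4) by (auto simp: Pi_iff)
    then have "f (\<lambda>i. c i \<oplus> t \<otimes> d i) \<in> carrier R" "g (\<lambda>i. c i \<oplus> t \<otimes> d i) \<in> carrier R"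
      if "t \<in> carrier R" for t
      using polyfun_closed[OF polyfun_add.hyps(1)] polyfun_closed[OF polyfun_add.hyps(2)] that
      by simp_all
    then show ?case using pq by (intro bexI[of _ "p \<oplus>\<^bsub>poly_ring ?K\<^esub> q"]) (auto simp: ev)
  next
    case (polyfun_mult f g)
    then obtain p q where pq: "p \<in> carrier (poly_ring ?K)" "q \<in> carrier (poly_ring ?K)"
      "\<forall>t\<in>carrier R. I +> f (\<lambda>i. c i \<oplus> t \<otimes> d i) = K.eval p (I +> t)"
      "\<forall>t\<in>carrier R. I +> g (\<lambda>i. c i \<oplus> t \<otimes> d i) = K.eval q (I +> t)" by blast
    have "(\<lambda>i. c i \<oplus> t \<otimes> d i) \<in> Y \<rightarrow> carrier R" if "t \<in> carrier R" for t
      using that assms(3,4) by (auto simp: Pi_iff)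
    then have "f (\<lambda>i. c i \<oplus> t \<otimes> d i) \<in> carrier R" "g (\<lambda>i. c i \<oplus> t \<otimes> d i) \<in> carrier R"
      if "t \<in> carrier R" for t
      using polyfun_closed[OF polyfun_mult.hyps(1)] polyfun_closed[OF polyfun_mult.hyps(2)] that
      by simp_all
    then show ?case using pq by (intro bexI[of _ "p \<otimes>\<^bsub>poly_ring ?K\<^esub> q"]) (auto simp: ev)
  qed
qed

lemma (in maximalideal) rcos_eq_zero_iff:
  "a \<in> carrier R \<Longrightarrow> I +> a = \<zero>\<^bsub>R Quot I\<^esub> \<longleftrightarrow> a \<in> I"
  using a_rcos_self[of a] a_rcos_const[of a] by (auto simp: FactRing_def)

text \<open>
  On the line \<open>c0 + t (c1 - c0)\<close> the function \<open>f\<close> does not vanish at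
  \<open>t = 0\<close>, and \<open>g\<close> does not vanish at \<open>t = 1\<close>. So each vanishes for
  finitely many residue classes of \<open>t\<close> only.
\<close>
lemma (in maximalideal) polyfun_common_nonzero:
  assumes "cring R" "infinite (carrier (R Quot I))"
    and f: "f \<in> polyfun R Y" "c0 \<in> Y \<rightarrow> carrier R" "f c0 \<notin> I"
    and g: "g \<in> polyfun R Y" "c1 \<in> Y \<rightarrow> carrier R" "g c1 \<notin> I"
  shows "\<exists>c\<in>Y \<rightarrow> carrier R. f c \<notin> I \<and> g c \<notin> I"
proof -
  interpret R: cring R by fact
  let ?K = "R Quot I"
  interpret K: field ?K using quotient_is_field[OF assms(1)] .
  interpret h: ring_hom_ring R ?K "(+>) I" by (rule rcos_ring_hom_ring)
  let ?d = "\<lambda>i. c1 i \<ominus> c0 i" and ?l = "\<lambda>t i. c0 i \<oplus> t \<otimes> (c1 i \<ominus> c0 i)"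
  have cC: "c0 i \<in> carrier R" "c1 i \<in> carrier R" if "i \<in> Y" for i using f(2) g(2) that by auto
  then have d: "?d \<in> Y \<rightarrow> carrier R" by auto
  have l: "?l t \<in> Y \<rightarrow> carrier R" if "t \<in> carrier R" for t using cC that by auto
  have fin: "finite {x \<in> carrier ?K. \<exists>t\<in>carrier R. x = I +> t \<and> h (?l t) \<in> I}"
    if h: "h \<in> polyfun R Y" and t0: "t0 \<in> carrier R" "h (?l t0) \<notin> I" for h t0
  proof -
    obtain p where p: "p \<in> carrier (poly_ring ?K)"
      "\<forall>t\<in>carrier R. I +> h (?l t) = K.eval p (I +> t)"
      using polyfun_on_line[OF assms(1) h f(2) d] by blast
    have z: "h (?l t) \<in> I \<longleftrightarrow> K.eval p (I +> t) = \<zero>\<^bsub>?K\<^esub>" if "t \<in> carrier R" for t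
      using p(2) that rcos_eq_zero_iff[OF polyfun_closed[OF h l[OF that]]] by simp
    have "p \<noteq> []" using z[OF t0(1)] t0(2) by auto
    then have "{x \<in> carrier ?K. \<exists>t\<in>carrier R. x = I +> t \<and> h (?l t) \<in> I} \<subseteq> {x. K.is_root p x}"
      using z by (auto simp: K.is_root_def)
    then show ?thesis using K.finite_number_of_roots[OF p(1)] by (rule finite_subset)
  qed
  have "f (?l \<zero>) = f c0" using cC by (intro polyfun_cong[OF f(1)]) simp
  moreover have "g (?l \<one>) = g c1"
    using cC by (intro polyfun_cong[OF g(1)]) (simp add: add_diff_cancel_right)
  ultimately have "finite ({x \<in> carrier ?K. \<exists>t\<in>carrier R. x = I +> t \<and> f (?l t) \<in> I} \<union>
      {x \<in> carrier ?K. \<exists>t\<in>carrier R. x = I +> t \<and> g (?l t) \<in> I})"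
    using fin[OF f(1), of \<zero>] fin[OF g(1), of \<one>] f(3) g(3) by auto
  then obtain x where x: "x \<in> carrier ?K"
    "x \<notin> {x \<in> carrier ?K. \<exists>t\<in>carrier R. x = I +> t \<and> f (?l t) \<in> I} \<union>
      {x \<in> carrier ?K. \<exists>t\<in>carrier R. x = I +> t \<and> g (?l t) \<in> I}"
    using assms(2) by (meson finite_subset subsetI)
  obtain t where "t \<in> carrier R" "x = I +> t" using x(1) by (rule quotient_carrierE)
  then show ?thesis using x l by (intro bexI[of _ "?l t"]) auto
qed

section \<open>Generation is an open condition\<close>

text \<open>
  The vectors \<open>v c = \<Sum>l<d. f\<^sub>l c \<otimes> b l\<close> modulo \<open>L\<close> with
  polynomial functions \<open>f\<^sub>l\<close> as coefficients. The recursion splits off the last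
  coefficient, which is the one that elimination has to reach.
\<close>
primrec (in cring) polyvec :: "'v set \<Rightarrow> 'a set \<Rightarrow> (nat \<Rightarrow> 'a) \<Rightarrow> nat \<Rightarrow> (('v \<Rightarrow> 'a) \<Rightarrow> 'a) \<Rightarrow> bool" where
  "polyvec Y L b 0 v \<longleftrightarrow> (\<forall>c\<in>Y \<rightarrow> carrier R. v c \<in> L)"
| "polyvec Y L b (Suc d) v \<longleftrightarrow> (\<exists>f\<in>polyfun R Y. \<exists>w. polyvec Y L b d w \<and>
     (\<forall>c\<in>Y \<rightarrow> carrier R. v c = w c \<oplus> b d \<otimes> f c))"

lemma (in cring) polyvec_cong:
  assumes "polyvec Y L b d v" "\<And>c. c \<in> Y \<rightarrow> carrier R \<Longrightarrow> v' c = v c"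
  shows "polyvec Y L b d v'"
  using assms by (cases d) simp_all

lemma (in cring) polyvec_mem:
  assumes "polyvec Y L b d v" "c \<in> Y \<rightarrow> carrier R"
  shows "v c \<in> span_upto L b d"
  using assms(1)
proof (induction d arbitrary: v)
  case (Suc d)
  then obtain f w where "f \<in> polyfun R Y" "polyvec Y L b d w" "v c = w c \<oplus> b d \<otimes> f c"
    using assms(2) by auto
  then show ?case
    using Suc.IH[of w] polyfun_closed[OF _ assms(2)] by (simp add: plus_multiplesI)
qed (use assms(2) in auto)

lemma (in cring) polyvec_add:
  assumes "ideal L R" "\<And>l. l < d \<Longrightarrow> b l \<in> carrier R"
    "polyvec Y L b d v" "polyvec Y L b d v'"
  shows "polyvec Y L b d (\<lambda>c. v c \<oplus> v' c)"
  using assms(2-)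
proof (induction d arbitrary: v v')
  case 0
  interpret L: ideal L R by fact
  from 0 show ?case by auto
next
  case (Suc d)
  from Suc.prems obtain f w f' w' where
    w: "f \<in> polyfun R Y" "polyvec Y L b d w" "\<forall>c\<in>Y \<rightarrow> carrier R. v c = w c \<oplus> b d \<otimes> f c"
      "f' \<in> polyfun R Y" "polyvec Y L b d w'" "\<forall>c\<in>Y \<rightarrow> carrier R. v' c = w' c \<oplus> b d \<otimes> f' c"
    unfolding polyvec.simps by blast
  have c: "w c \<in> carrier R" "w' c \<in> carrier R" if "c \<in> Y \<rightarrow> carrier R" for c
    using polyvec_mem[OF w(2) that] polyvec_mem[OF w(5) that]
      ideal_subset_carrier[OF span_upto_ideal[OF assms(1), of d b]] Suc.prems(1) by auto
  show ?case unfolding polyvec.simps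
  proof (intro bexI[of _ "\<lambda>c. f c \<oplus> f' c"] exI[of _ "\<lambda>c. w c \<oplus> w' c"] conjI ballI)
    show "polyvec Y L b d (\<lambda>c. w c \<oplus> w' c)" using Suc.IH w Suc.prems(1) by auto
    fix c assume cX: "c \<in> Y \<rightarrow> carrier R"
    then show "v c \<oplus> v' c = w c \<oplus> w' c \<oplus> b d \<otimes> (f c \<oplus> f' c)"
      using w c[OF cX] polyfun_closed[OF w(1) cX] polyfun_closed[OF w(4) cX] Suc.prems(1)[of d]
      by (simp add: r_distr a_ac)
  qed (use polyfun.polyfun_add[OF w(1,4)] in simp)
qed

lemma (in cring) polyvec_mult:
  assumes "ideal L R" "\<And>l. l < d \<Longrightarrow> b l \<in> carrier R"
    "polyvec Y L b d v" "f \<in> polyfun R Y"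
  shows "polyvec Y L b d (\<lambda>c. f c \<otimes> v c)"
  using assms(2,3)
proof (induction d arbitrary: v)
  case 0
  then show ?case using ideal.I_l_closed[OF assms(1)] polyfun_closed[OF assms(4)] by auto
next
  case (Suc d)
  from Suc.prems obtain g w where
    w: "g \<in> polyfun R Y" "polyvec Y L b d w" "\<forall>c\<in>Y \<rightarrow> carrier R. v c = w c \<oplus> b d \<otimes> g c"
    unfolding polyvec.simps by blast
  have c: "w c \<in> carrier R" if "c \<in> Y \<rightarrow> carrier R" for c
    using polyvec_mem[OF w(2) that]
      ideal_subset_carrier[OF span_upto_ideal[OF assms(1), of d b]] Suc.prems(1) by auto
  show ?case unfolding polyvec.simps
  proof (intro bexI[of _ "\<lambda>c. f c \<otimes> g c"] exI[of _ "\<lambda>c. f c \<otimes> w c"] conjI ballI)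
    show "polyvec Y L b d (\<lambda>c. f c \<otimes> w c)" using Suc.IH w Suc.prems(1) by auto
    fix c assume cX: "c \<in> Y \<rightarrow> carrier R"
    then show "f c \<otimes> v c = f c \<otimes> w c \<oplus> b d \<otimes> (f c \<otimes> g c)"
      using w c[OF cX] polyfun_closed[OF w(1) cX] polyfun_closed[OF assms(4) cX] Suc.prems(1)[of d]
      by (simp add: r_distr m_lcomm)
  qed (use polyfun.polyfun_mult[OF assms(4) w(1)] in simp)
qed

lemma (in cring) polyvec_const:
  assumes "a \<in> span_upto L b d"
  shows "polyvec Y L b d (\<lambda>c. a)"
  using assms
proof (induction d arbitrary: a)
  case (Suc d)
  then obtain e t where "e \<in> span_upto L b d" "t \<in> carrier R" "a = e \<oplus> b d \<otimes> t"
    by (auto elim: plus_multiplesE)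
  with Suc.IH show ?case unfolding polyvec.simps
    by (intro bexI[of _ "\<lambda>c. t"] exI[of _ "\<lambda>c. e"]) (auto intro: polyfun.polyfun_const)
qed simp

text \<open>
  If vectors that depend polynomially on \<open>c\<close> generate modulo \<open>L\<close> at one point
  \<open>c0\<close>, they do so wherever a suitable polynomial function \<open>f\<close> with
  \<open>f c0 \<noteq> 0\<close> (modulo \<open>\<mm>\<close>) does not vanish. In place of a determinant,
  \<open>f\<close> is the product of the pivots of a Gaussian elimination without division: some
  \<open>u\<close> has a last coefficient \<open>F u\<close> that is a unit at \<open>c0\<close>, and
  \<open>F u \<otimes> v - F v \<otimes> u\<close> has last coefficient \<open>0\<close> for every vector
  \<open>v\<close>. Where \<open>F u\<close> is a unit, the old vectors generate the span of
  \<open>d + 1\<close> basis elements as soon as the new ones generate the span of the first \<open>d\<close>.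
\<close>
lemma (in noetherian_local_ring) generic_generation:
  fixes Q :: "(('v \<Rightarrow> 'a) \<Rightarrow> 'a) set"
  assumes L: "ideal L R"
    and b: "\<And>l. l < d \<Longrightarrow> b l \<in> carrier R" "\<And>l. l < d \<Longrightarrow> b l \<notin> span_upto L b l"
    and m: "\<And>t l. t \<in> \<mm> \<Longrightarrow> l < d \<Longrightarrow> t \<otimes> b l \<in> L"
    and Q: "\<And>v. v \<in> Q \<Longrightarrow> polyvec Y L b d v"
    and c0: "c0 \<in> Y \<rightarrow> carrier R"
    and gen: "span_upto L b d \<subseteq> Idl (L \<union> (\<lambda>v. v c0) ` Q)"
  shows "\<exists>f\<in>polyfun R Y. f c0 \<notin> \<mm> \<and> (\<forall>c\<in>Y \<rightarrow> carrier R. f c \<notin> \<mm> \<longrightarrow>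
    span_upto L b d \<subseteq> Idl (L \<union> (\<lambda>v. v c) ` Q))"
  using b m Q gen
proof (induction d arbitrary: Q)
  case 0
  have "\<one> \<notin> \<mm>" using I_notcarr one_imp_carrier by auto
  moreover have "L \<subseteq> Idl (L \<union> (\<lambda>v. v c) ` Q)" if "c \<in> Y \<rightarrow> carrier R" for c
  proof -
    have "(\<lambda>v. v c) ` Q \<subseteq> L" using 0 that by auto
    then show ?thesis using genideal_self[of "L \<union> (\<lambda>v. v c) ` Q"] ideal_subset_carrier[OF L] by auto
  qed
  ultimately show ?case by (intro bexI[of _ "\<lambda>c. \<one>"]) (auto intro: polyfun.polyfun_const)
next
  case (Suc d)
  let ?V = "span_upto L b d" and ?W = "span_upto L b (Suc d)"
  have bC: "b l \<in> carrier R" if "l \<le> d" for l using Suc.prems(1) that by auto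
  have iV: "ideal ?V R" and iW: "ideal ?W R"
    using span_upto_ideal[OF L] bC by (simp_all del: span_upto.simps)
  interpret V: ideal ?V R by fact
  interpret L: ideal L R by fact
  have LV: "L \<subseteq> ?V" by (rule span_upto_superset[OF L bC]) simp
  have VW: "?V \<subseteq> ?W" using adjoin_superset(1)[OF iV, of "b d"] bC by simp
  have bV: "b d \<notin> ?V" using Suc.prems(2) by simp
  have mW: "w \<otimes> t \<in> L" if tw: "t \<in> \<mm>" "w \<in> ?W" for t w
  proof -
    have tC: "t \<in> carrier R" using tw max_carrier by auto
    have "?W \<subseteq> {x \<in> carrier R. \<forall>w\<in>{t}. x \<otimes> w \<in> L}"
    proof (rule span_upto_minimal[OF ideal_quotient_ideal[OF L]])
      show "L \<subseteq> {x \<in> carrier R. \<forall>w\<in>{t}. x \<otimes> w \<in> L}"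
        using tC L.I_r_closed L.a_subset by auto
      fix l assume "l < Suc d"
      then show "b l \<in> {x \<in> carrier R. \<forall>w\<in>{t}. x \<otimes> w \<in> L}"
        using Suc.prems(3)[OF tw(1), of l] bC[of l] tC m_comm[of "b l" t] by simp
    qed (use tC in auto)
    then show ?thesis using tw by auto
  qed
  have "\<forall>v\<in>Q. \<exists>f w. f \<in> polyfun R Y \<and> polyvec Y L b d w \<and>
      (\<forall>c\<in>Y \<rightarrow> carrier R. v c = w c \<oplus> b d \<otimes> f c)"
    using Suc.prems(4) unfolding polyvec.simps by blast
  then obtain F where "\<forall>v\<in>Q. \<exists>w. F v \<in> polyfun R Y \<and> polyvec Y L b d w \<and>
      (\<forall>c\<in>Y \<rightarrow> carrier R. v c = w c \<oplus> b d \<otimes> F v c)"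
    by (rule bchoice[THEN exE])
  then obtain G where FG: "\<And>v. v \<in> Q \<Longrightarrow> F v \<in> polyfun R Y"
    "\<And>v. v \<in> Q \<Longrightarrow> polyvec Y L b d (G v)"
    "\<And>v c. v \<in> Q \<Longrightarrow> c \<in> Y \<rightarrow> carrier R \<Longrightarrow> v c = G v c \<oplus> b d \<otimes> F v c"
    by (rule bchoice[THEN exE]) blast
  have GV: "G v c \<in> ?V" if "v \<in> Q" "c \<in> Y \<rightarrow> carrier R" for v c
    using polyvec_mem[OF FG(2)[OF that(1)] that(2)] .
  have vW: "v c \<in> ?W" if "v \<in> Q" "c \<in> Y \<rightarrow> carrier R" for v c
    using polyvec_mem[OF Suc.prems(4)[OF that(1)] that(2)] .
  have WC: "?W \<subseteq> carrier R" using ideal_subset_carrier[OF iW] .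
  have QC: "L \<union> (\<lambda>v. v c) ` Q \<subseteq> carrier R" if "c \<in> Y \<rightarrow> carrier R" for c
    using vW[OF _ that] WC L.a_subset by auto
  \<comment> \<open>A pivot exists: otherwise all vectors would lie in \<open>?V\<close> at \<open>c0\<close>, but they generate \<open>b d\<close>.\<close>
  have "\<exists>v\<in>Q. F v c0 \<notin> \<mm>"
  proof (rule ccontr)
    assume *: "\<not> (\<exists>v\<in>Q. F v c0 \<notin> \<mm>)"
    have "v c0 \<in> ?V" if "v \<in> Q" for v
    proof -
      have "b d \<otimes> F v c0 \<in> L" using mW[of "F v c0" "b d"] * that
          adjoin_superset(2)[OF iV, of "b d"] bC by auto
      then show ?thesis using FG(3)[OF that c0] GV[OF that c0] LV by auto
    qed
    then have "Idl (L \<union> (\<lambda>v. v c0) ` Q) \<subseteq> ?V"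
      using LV by (intro genideal_minimal[OF iV]) auto
    moreover have "b d \<in> ?W" using adjoin_superset(2)[OF iV, of "b d"] bC by simp
    ultimately show False using bV Suc.prems(5) by auto
  qed
  then obtain u where u: "u \<in> Q" "F u c0 \<notin> \<mm>" by blast
  \<comment> \<open>Elimination. The coefficient is written as \<open>(\<ominus> \<one>) \<otimes> F v c\<close> to be visibly a polynomial function.\<close>
  let ?e = "\<lambda>v c. F u c \<otimes> v c \<oplus> ((\<ominus> \<one>) \<otimes> F v c) \<otimes> u c"
  let ?Q' = "?e ` Q"
  have FC: "F v c \<in> carrier R" if "v \<in> Q" "c \<in> Y \<rightarrow> carrier R" for v c
    using polyfun_closed[OF FG(1)[OF that(1)] that(2)] .
  have vC: "v c \<in> carrier R" if "v \<in> Q" "c \<in> Y \<rightarrow> carrier R" for v c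
    using vW[OF that] WC by auto
  have vG: "v c \<ominus> G v c = F v c \<otimes> b d" if "v \<in> Q" "c \<in> Y \<rightarrow> carrier R" for v c
    unfolding FG(3)[OF that] m_comm[OF bC[OF le_refl] FC[OF that]]
    using GV[OF that] V.a_subset FC[OF that] bC[of d] by (intro add_diff_cancel_left) auto
  have Q': "polyvec Y L b d (?e v)" if "v \<in> Q" for v
  proof (rule polyvec_cong)
    have m1: "(\<lambda>c. (\<ominus> \<one>) \<otimes> F v c) \<in> polyfun R Y"
      using polyfun.polyfun_mult[OF polyfun.polyfun_const FG(1)[OF that]] by simp
    show "polyvec Y L b d (\<lambda>c. F u c \<otimes> G v c \<oplus> ((\<ominus> \<one>) \<otimes> F v c) \<otimes> G u c)"
      by (intro polyvec_add polyvec_mult L FG m1 bC u that) auto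
    fix c assume c: "c \<in> Y \<rightarrow> carrier R"
    have "G v c \<in> carrier R" "G u c \<in> carrier R" using GV[OF that c] GV[OF u(1) c] V.a_subset by auto
    then show "?e v c = F u c \<otimes> G v c \<oplus> ((\<ominus> \<one>) \<otimes> F v c) \<otimes> G u c"
      using FG(3)[OF that c] FG(3)[OF u(1) c] FC[OF that c] FC[OF u(1) c] bC[of d]
      by (simp add: r_distr l_minus r_minus m_ac a_ac minus_add r_neg r_neg1)
  qed
  have eV: "?e v c \<in> ?V" if "v \<in> Q" "c \<in> Y \<rightarrow> carrier R" for v c
    using polyvec_mem[OF Q'[OF that(1)] that(2)] .
  have Q'C: "L \<union> (\<lambda>v. v c) ` ?Q' \<subseteq> carrier R" if "c \<in> Y \<rightarrow> carrier R" for c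
    using eV[OF _ that] V.a_subset L.a_subset by auto
  \<comment> \<open>The reduced vectors generate \<open>?V\<close> at \<open>c0\<close>: an element of \<open>?V\<close> needs a multiple \<open>t u\<close> of the pivot vector,
    but \<open>t\<close> cannot be a unit, as this would put \<open>b d\<close> into \<open>?V\<close>; so \<open>t u\<close> lies in \<open>L\<close>.\<close>
  have gen': "?V \<subseteq> Idl (L \<union> (\<lambda>v. v c0) ` ?Q')"
  proof
    fix x assume x: "x \<in> ?V"
    let ?E = "Idl (L \<union> (\<lambda>v. v c0) ` ?Q')"
    have iE: "ideal ?E R" using Q'C[OF c0] by (rule genideal_ideal)
    interpret E: ideal ?E R by fact
    have EV: "?E \<subseteq> ?V" using eV[OF _ c0] LV by (intro genideal_minimal[OF iV]) auto
    have uC: "u c0 \<in> carrier R" using vC[OF u(1) c0] .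
    have iA: "ideal (adjoin ?E (u c0)) R" using iE uC by (rule adjoin_ideal)
    interpret A: ideal "adjoin ?E (u c0)" R by fact
    have EA: "?E \<subseteq> adjoin ?E (u c0)" "u c0 \<in> adjoin ?E (u c0)" using adjoin_superset[OF iE uC] by auto
    have sE: "L \<union> (\<lambda>v. v c0) ` ?Q' \<subseteq> ?E" using genideal_self[OF Q'C[OF c0]] .
    have "v c0 \<in> adjoin ?E (u c0)" if "v \<in> Q" for v
    proof -
      have "?e v c0 \<in> adjoin ?E (u c0)" using sE EA(1) that by blast
      moreover have "F v c0 \<otimes> u c0 \<in> adjoin ?E (u c0)"
        using A.I_l_closed[OF EA(2) FC[OF that c0]] .
      ultimately have "?e v c0 \<oplus> F v c0 \<otimes> u c0 \<in> adjoin ?E (u c0)" by simp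
      moreover have "?e v c0 \<oplus> F v c0 \<otimes> u c0 = F u c0 \<otimes> v c0"
        by (rule add_minus_one_multiple[OF m_closed[OF FC[OF u(1) c0] vC[OF that c0]] FC[OF that c0] uC])
      ultimately show ?thesis
        using unit_multiple_cancel[OF iA FC[OF u(1) c0] u(2) vC[OF that c0]] by simp
    qed
    then have "Idl (L \<union> (\<lambda>v. v c0) ` Q) \<subseteq> adjoin ?E (u c0)"
      using sE EA(1) by (intro genideal_minimal[OF iA]) auto
    then have "x \<in> adjoin ?E (u c0)" using x VW Suc.prems(5) by blast
    then obtain e t where et: "e \<in> ?E" "t \<in> carrier R" "x = e \<oplus> u c0 \<otimes> t"
      by (rule plus_multiplesE)
    have eC: "e \<in> carrier R" using et(1) E.Icarr by simp
    have "x \<ominus> e \<in> ?V" using x et(1) EV by (auto simp: minus_eq)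
    moreover have "x \<ominus> e = t \<otimes> u c0"
      using et eC uC m_comm[of t "u c0"] by (simp add: add_diff_cancel_left)
    ultimately have tu: "t \<otimes> u c0 \<in> ?V" by simp
    have "t \<in> \<mm>"
    proof (rule ccontr)
      assume "t \<notin> \<mm>"
      then have "u c0 \<in> ?V" using unit_multiple_cancel[OF iV et(2) _ uC tu] by simp
      then have "u c0 \<ominus> G u c0 \<in> ?V" using GV[OF u(1) c0] by (auto simp: minus_eq)
      moreover have "u c0 \<ominus> G u c0 = F u c0 \<otimes> b d" by (rule vG[OF u(1) c0])
      ultimately have "b d \<in> ?V"
        using unit_multiple_cancel[OF iV FC[OF u(1) c0] u(2), of "b d"] bC by simp
      then show False using bV by simp
    qed
    then have "u c0 \<otimes> t \<in> ?E" using mW[OF _ vW[OF u(1) c0]] sE by auto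
    then show "x \<in> ?E" using et by simp
  qed
  have "\<exists>f\<in>polyfun R Y. f c0 \<notin> \<mm> \<and> (\<forall>c\<in>Y \<rightarrow> carrier R. f c \<notin> \<mm> \<longrightarrow>
    ?V \<subseteq> Idl (L \<union> (\<lambda>v. v c) ` ?Q'))"
  proof (rule Suc.IH[OF _ _ _ _ gen'])
    show "polyvec Y L b d v" if "v \<in> ?Q'" for v using that Q' by auto
  qed (use Suc.prems(1-3) in auto)
  then obtain f where f: "f \<in> polyfun R Y" "f c0 \<notin> \<mm>"
    "\<And>c. c \<in> Y \<rightarrow> carrier R \<Longrightarrow> f c \<notin> \<mm> \<Longrightarrow> ?V \<subseteq> Idl (L \<union> (\<lambda>v. v c) ` ?Q')" by blast
  have pr: "primeideal \<mm> R" using maximalideal_prime[OF is_maximalideal] .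
  show ?case
  proof (intro bexI[of _ "\<lambda>c. F u c \<otimes> f c"] conjI ballI impI)
    show "F u c0 \<otimes> f c0 \<notin> \<mm>"
      using primeideal.I_prime[OF pr FC[OF u(1) c0] polyfun_closed[OF f(1) c0]] u(2) f(2) by auto
    show "(\<lambda>c. F u c \<otimes> f c) \<in> polyfun R Y" using polyfun.polyfun_mult[OF FG(1)[OF u(1)] f(1)] .
    fix c assume c: "c \<in> Y \<rightarrow> carrier R" and nm: "F u c \<otimes> f c \<notin> \<mm>"
    let ?E = "Idl (L \<union> (\<lambda>v. v c) ` Q)"
    have iE: "ideal ?E R" using QC[OF c] by (rule genideal_ideal)
    interpret E: ideal ?E R by fact
    have sE: "L \<union> (\<lambda>v. v c) ` Q \<subseteq> ?E" using genideal_self[OF QC[OF c]] .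
    have Fu: "F u c \<notin> \<mm>" using nm I_r_closed[OF _ polyfun_closed[OF f(1) c]] by auto
    have fc: "f c \<notin> \<mm>" using nm I_l_closed[OF _ FC[OF u(1) c]] by auto
    have "(\<lambda>v. v c) ` ?Q' \<subseteq> ?E"
    proof (clarsimp)
      fix v assume v: "v \<in> Q"
      have "v c \<in> ?E" "u c \<in> ?E" using sE v u(1) by auto
      then show "?e v c \<in> ?E" using FC[OF v c] FC[OF u(1) c] E.I_l_closed by simp
    qed
    then have "L \<union> (\<lambda>v. v c) ` ?Q' \<subseteq> ?E" using sE by blast
    then have "Idl (L \<union> (\<lambda>v. v c) ` ?Q') \<subseteq> ?E" by (rule genideal_minimal[OF iE])
    then have VE: "?V \<subseteq> ?E" using f(3)[OF c fc] by (rule order_trans[rotated])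
    have "u c \<in> ?E" "G u c \<in> ?E" using sE u(1) VE GV[OF u(1) c] by blast+
    then have "u c \<ominus> G u c \<in> ?E" by (simp add: minus_eq)
    moreover have "u c \<ominus> G u c = F u c \<otimes> b d" by (rule vG[OF u(1) c])
    ultimately have "b d \<in> ?E"
      using unit_multiple_cancel[OF iE FC[OF u(1) c] Fu, of "b d"] bC by simp
    then show "?W \<subseteq> ?E" using VE by (simp add: adjoin_minimal[OF iE])
  qed
qed

text \<open>
  The product of the functions is built up one factor at a time; \<open>polyfun_common_nonzero\<close>
  provides a point where the next product does not vanish.
\<close>
lemma (in maximalideal) polyfun_family_common_nonzero:
  fixes f :: "nat \<Rightarrow> ('v \<Rightarrow> 'a) \<Rightarrow> 'a"
  assumes "cring R" "infinite (carrier (R Quot I))"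
    and f: "\<And>l. l < k \<Longrightarrow> f l \<in> polyfun R Y \<and> (\<exists>c\<in>Y \<rightarrow> carrier R. f l c \<notin> I)"
  shows "\<exists>c\<in>Y \<rightarrow> carrier R. \<forall>l<k. f l c \<notin> I"
proof -
  interpret R: cring R by fact
  \<comment> \<open>\<open>h\<close> is the product of the functions.\<close>
  have "\<exists>h\<in>polyfun R Y. (\<exists>c\<in>Y \<rightarrow> carrier R. h c \<notin> I) \<and>
      (\<forall>c\<in>Y \<rightarrow> carrier R. h c \<notin> I \<longrightarrow> (\<forall>l<k. f l c \<notin> I))"
    using f
  proof (induction k)
    case 0
    have "\<one> \<notin> I" using I_notcarr one_imp_carrier by auto
    moreover have "(\<lambda>i. \<zero>) \<in> Y \<rightarrow> carrier R" by simp
    ultimately show ?case by (intro bexI[of _ "\<lambda>c. \<one>"] conjI) (auto intro: polyfun_const)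
  next
    case (Suc k)
    from Suc.IH[OF Suc.prems[OF less_SucI]] obtain h where h: "h \<in> polyfun R Y"
      "\<exists>c\<in>Y \<rightarrow> carrier R. h c \<notin> I"
      "\<forall>c\<in>Y \<rightarrow> carrier R. h c \<notin> I \<longrightarrow> (\<forall>l<k. f l c \<notin> I)" by blast
    have fk: "f k \<in> polyfun R Y" "\<exists>c\<in>Y \<rightarrow> carrier R. f k c \<notin> I" using Suc.prems[of k] by auto
    obtain c where c: "c \<in> Y \<rightarrow> carrier R" "h c \<notin> I" "f k c \<notin> I"
      using polyfun_common_nonzero[OF assms(1,2) h(1) _ _ fk(1)] h(2) fk(2) by blast
    have pr: "primeideal I R" using R.maximalideal_prime[OF is_maximalideal] .
    have iff: "h c \<otimes> f k c \<notin> I \<longleftrightarrow> h c \<notin> I \<and> f k c \<notin> I" if "c \<in> Y \<rightarrow> carrier R" for c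
      using primeideal.I_prime[OF pr, of "h c" "f k c"] polyfun_closed[OF h(1) that]
        polyfun_closed[OF fk(1) that] I_l_closed[of "f k c" "h c"] I_r_closed[of "h c" "f k c"] by blast
    show ?case
    proof (intro bexI[of _ "\<lambda>c. h c \<otimes> f k c"] conjI ballI impI allI)
      show "\<exists>c\<in>Y \<rightarrow> carrier R. h c \<otimes> f k c \<notin> I" using c iff by blast
      show "f l c \<notin> I" if "c \<in> Y \<rightarrow> carrier R" "h c \<otimes> f k c \<notin> I" "l < Suc k" for c l
        using that h(3) iff[OF that(1)] less_Suc_eq[of l k] by metis
      show "(\<lambda>c. h c \<otimes> f k c) \<in> polyfun R Y" using polyfun_mult[OF h(1) fk(1)] .
    qed
  qed
  then show ?thesis by blast
qed

lemma (in cring) span_upto_coefficients: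
  assumes "ideal L R" "\<And>l. l < d \<Longrightarrow> b l \<in> carrier R" "x \<in> span_upto L b d"
  shows "\<exists>c\<in>{..<d} \<rightarrow> carrier R. \<exists>e\<in>L. x = e \<oplus> (\<Oplus>l\<in>{..<d}. c l \<otimes> b l)"
  using assms(2,3)
proof (induction d arbitrary: x)
  case 0
  then show ?case using ideal.Icarr[OF assms(1)] by (auto intro!: bexI[of _ x])
next
  case (Suc d)
  from Suc.prems(2) obtain z t where z: "z \<in> span_upto L b d" "t \<in> carrier R" "x = z \<oplus> b d \<otimes> t"
    by (auto elim: plus_multiplesE)
  from Suc.IH[OF _ z(1)] Suc.prems(1) obtain c e where
    c: "c \<in> {..<d} \<rightarrow> carrier R" "e \<in> L" "z = e \<oplus> (\<Oplus>l\<in>{..<d}. c l \<otimes> b l)" by auto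
  have bC: "b l \<in> carrier R" if "l \<le> d" for l using Suc.prems(1) that by simp
  have eC: "e \<in> carrier R" using ideal.Icarr[OF assms(1) c(2)] .
  have cC: "c l \<in> carrier R" if "l < d" for l using c(1) that by (simp add: Pi_iff)
  have sC: "(\<Oplus>l\<in>{..<d}. c l \<otimes> b l) \<in> carrier R"
    by (rule finsum_closed) (use cC bC in auto)
  have "(\<Oplus>l\<in>{..<d}. (c(d := t)) l \<otimes> b l) = (\<Oplus>l\<in>{..<d}. c l \<otimes> b l)"
    by (rule finsum_cong') (use cC bC in auto)
  moreover have "(\<Oplus>l\<in>{..<Suc d}. (c(d := t)) l \<otimes> b l) =
      (c(d := t)) d \<otimes> b d \<oplus> (\<Oplus>l\<in>{..<d}. (c(d := t)) l \<otimes> b l)"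
    unfolding lessThan_Suc by (rule finsum_insert) (use cC bC z(2) in auto)
  ultimately have "x = e \<oplus> (\<Oplus>l\<in>{..<Suc d}. (c(d := t)) l \<otimes> b l)"
    using z(2,3) c(3) eC sC bC[of d] m_comm[of "b d" t]
      a_comm[of "t \<otimes> b d" "\<Oplus>l\<in>{..<d}. c l \<otimes> b l"]
    by (simp add: a_assoc)
  moreover have "c(d := t) \<in> {..<Suc d} \<rightarrow> carrier R" using c(1) z(2) by (auto simp: Pi_iff less_Suc_eq)
  ultimately show ?case using c(2) by blast
qed

section \<open>Monomials in the ideals\<close>

text \<open>
  The elements \<open>g i 0, \<dots>, g i (N i - 1)\<close> represent a basis of
  \<open>I i / \<mm> I i\<close>. They serve as coordinates on tuples of elements.
\<close>
locale minimally_generated_ideals = noetherian_local_ring \<mm> R for \<mm> and R (structure) +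
  fixes s :: nat and I :: "nat \<Rightarrow> 'a set" and g :: "nat \<Rightarrow> nat \<Rightarrow> 'a" and N :: "nat \<Rightarrow> nat"
  assumes ideals: "i \<in> {1..s} \<Longrightarrow> ideal (I i) R"
    and span_gens: "i \<in> {1..s} \<Longrightarrow> span_upto (\<mm> \<cdot> I i) (g i) (N i) = I i"
    and gens_carrier: "i \<in> {1..s} \<Longrightarrow> l < N i \<Longrightarrow> g i l \<in> carrier R"
    and gens_independent: "i \<in> {1..s} \<Longrightarrow> l < N i \<Longrightarrow> g i l \<notin> span_upto (\<mm> \<cdot> I i) (g i) l"
    and infinite_residue_field: "infinite (carrier (R Quot \<mm>))"
begin

interpretation IS: comm_monoid "ideals_set R" by (rule ideals_set_is_comm_monoid)

abbreviation Mon :: "(nat \<Rightarrow> nat) \<Rightarrow> 'a set" where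
  "Mon n \<equiv> ideal_monomial R s I n"

lemma ideals_carrier: "i \<in> {1..s} \<Longrightarrow> I i \<in> carrier (ideals_set R)"
  using ideals by (simp add: ideals_set_def)

lemma power_carrier: "i \<in> {1..s} \<Longrightarrow> I i [^]\<^bsub>ideals_set R\<^esub> (k::nat) \<in> carrier (ideals_set R)"
  using ideals_carrier by simp

lemma monomial_ideal: "ideal (Mon n) R"
proof -
  have "Mon n \<in> carrier (ideals_set R)"
    unfolding ideal_monomial_def by (rule IS.finprod_closed) (use power_carrier in blast)
  then show ?thesis by (simp add: ideals_set_def)
qed

lemma monomial_cong: "(\<And>i. i \<in> {1..s} \<Longrightarrow> n i = k i) \<Longrightarrow> Mon n = Mon k"
  unfolding ideal_monomial_def by (rule IS.finprod_cong') (use power_carrier in auto)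

lemma monomial_add: "Mon (\<lambda>i. n i + k i) = Mon n \<cdot> Mon k"
proof -
  have "Mon (\<lambda>i. n i + k i) = Mon n \<otimes>\<^bsub>ideals_set R\<^esub> Mon k"
    unfolding ideal_monomial_def
    using IS.finprod_multf[of "\<lambda>i. I i [^]\<^bsub>ideals_set R\<^esub> n i" "{1..s}" "\<lambda>i. I i [^]\<^bsub>ideals_set R\<^esub> k i"]
      power_carrier ideals_carrier
    by (simp add: Pi_iff IS.nat_pow_mult cong: IS.finprod_cong)
  then show ?thesis by (simp add: ideals_set_def)
qed

lemma monomial_unit:
  assumes "p \<in> {1..s}"
  shows "Mon (\<lambda>i. if p = i then 1 else 0) = I p"
proof -
  have "Mon (\<lambda>i. if p = i then 1 else 0) =
      (\<Otimes>\<^bsub>ideals_set R\<^esub>i\<in>{1..s}. if p = i then I i else \<one>\<^bsub>ideals_set R\<^esub>)"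
    unfolding ideal_monomial_def
    by (rule IS.finprod_cong') (use ideals_carrier in \<open>auto simp: IS.nat_pow_eone\<close>)
  also have "\<dots> = I p" by (rule IS.finprod_singleton) (use assms ideals_carrier in auto)
  finally show ?thesis .
qed

lemma monomial_step:
  assumes "p \<in> {1..s}" "0 < n p"
  shows "Mon n = I p \<cdot> Mon (n(p := n p - 1))"
proof -
  have "Mon n = Mon (\<lambda>i. (if p = i then 1 else 0) + (n(p := n p - 1)) i)"
    by (rule monomial_cong) (use assms in auto)
  also have "\<dots> = Mon (\<lambda>i. if p = i then 1 else 0) \<cdot> Mon (n(p := n p - 1))"
    by (rule monomial_add)
  finally show ?thesis using monomial_unit[OF assms(1)] by simp
qed

lemma monomial_mult:
  assumes "p \<in> {1..s}" "0 < n p" "x \<in> I p" "a \<in> Mon (n(p := n p - 1))"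
  shows "x \<otimes> a \<in> Mon n"
  using ideal_prod.prod[OF assms(3,4), of R] monomial_step[of p n, OF assms(1,2)] by simp

lemma ideal_prod_subset:
  assumes "ideal E R" "\<And>x a. x \<in> A \<Longrightarrow> a \<in> B \<Longrightarrow> x \<otimes> a \<in> E"
  shows "A \<cdot> B \<subseteq> E"
proof
  fix z assume "z \<in> A \<cdot> B"
  then show "z \<in> E"
    by induction (use assms additive_subgroup.a_closed[OF ideal.axioms(1)[OF assms(1)]] in auto)
qed

section \<open>Elements that generate a monomial in one degree\<close>

definition multiples :: "(nat \<Rightarrow> nat) \<Rightarrow> (nat \<Rightarrow> nat) \<Rightarrow> (nat \<Rightarrow> nat \<Rightarrow> 'a) \<Rightarrow> 'a set" where
  "multiples n r y = {y i j \<otimes> a | i j a. i \<in> {1..s} \<and> 0 < n i \<and> j \<in> {1..r i} \<and>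
     a \<in> Mon (n(i := n i - 1))}"

definition generates_modulo ::
    "(nat \<Rightarrow> nat) \<Rightarrow> (nat \<Rightarrow> nat) \<Rightarrow> 'a set \<Rightarrow> (nat \<Rightarrow> nat \<Rightarrow> 'a) \<Rightarrow> bool" where
  "generates_modulo n r J y \<longleftrightarrow> Mon n \<subseteq> Idl (J \<union> multiples n r y)"

definition tuples :: "(nat \<Rightarrow> nat) \<Rightarrow> (nat \<Rightarrow> nat \<Rightarrow> 'a) set" where
  "tuples r = {y. \<forall>i\<in>{1..s}. \<forall>j\<in>{1..r i}. y i j \<in> I i}"

definition variables :: "(nat \<Rightarrow> nat) \<Rightarrow> (nat \<times> nat \<times> nat) set" where
  "variables r = {(i, j, l). i \<in> {1..s} \<and> j \<in> {1..r i} \<and> l < N i}"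

text \<open>
  The tuple with coordinates \<open>c\<close>; every tuple is of this form modulo
  \<open>\<mm> \<cdot> I i\<close> in its entries of index \<open>i\<close>.
\<close>
definition tuple_of :: "(nat \<times> nat \<times> nat \<Rightarrow> 'a) \<Rightarrow> nat \<Rightarrow> nat \<Rightarrow> 'a" where
  "tuple_of c i j = (\<Oplus>l\<in>{..<N i}. c (i, j, l) \<otimes> g i l)"

lemma gens_mem:
  assumes "i \<in> {1..s}" "l < N i"
  shows "g i l \<in> I i"
proof -
  have iL: "ideal (\<mm> \<cdot> I i) R" using ideal_prod_is_ideal[OF is_ideal ideals[OF assms(1)]] .
  have "g i l \<in> span_upto (\<mm> \<cdot> I i) (g i) k" if "l < k" "k \<le> N i" for k
    using that
  proof (induction k)
    case (Suc k)
    have "ideal (span_upto (\<mm> \<cdot> I i) (g i) k) R"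
      by (rule span_upto_ideal[OF iL]) (use gens_carrier[OF assms(1)] Suc.prems in auto)
    from adjoin_superset[OF this, of "g i k"] show ?case
      using Suc gens_carrier[OF assms(1), of k] by (cases "l = k") auto
  qed simp
  then show ?thesis using span_gens[OF assms(1)] assms(2) by blast
qed

lemma tuple_of_mem:
  assumes "variables r \<subseteq> Y" "c \<in> Y \<rightarrow> carrier R" "i \<in> {1..s}" "j \<in> {1..r i}"
  shows "tuple_of c i j \<in> I i"
proof -
  interpret Ii: ideal "I i" R using ideals[OF assms(3)] .
  have c: "c (i, j, l) \<in> carrier R" if "l < N i" for l
    using assms that unfolding variables_def by blast
  have "k \<le> N i \<Longrightarrow> (\<Oplus>l\<in>{..<k}. c (i, j, l) \<otimes> g i l) \<in> I i" for k
  proof (induction k)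
    case (Suc k)
    have "(\<Oplus>l\<in>{..<Suc k}. c (i, j, l) \<otimes> g i l) =
        c (i, j, k) \<otimes> g i k \<oplus> (\<Oplus>l\<in>{..<k}. c (i, j, l) \<otimes> g i l)"
      unfolding lessThan_Suc
      by (rule finsum_insert) (use Suc.prems c gens_carrier[OF assms(3)] in auto)
    then show ?case using Suc c[of k] gens_mem[OF assms(3), of k] Ii.I_l_closed by simp
  qed simp
  then show ?thesis by (simp add: tuple_of_def)
qed

lemma tuples_carrier: "y \<in> tuples r \<Longrightarrow> i \<in> {1..s} \<Longrightarrow> j \<in> {1..r i} \<Longrightarrow> y i j \<in> carrier R"
  using ideal_subset_carrier[OF ideals, of i] unfolding tuples_def by blast

lemma multiples_subset:
  assumes "y \<in> tuples r"
  shows "multiples n r y \<subseteq> Mon n"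
  using assms monomial_mult unfolding multiples_def tuples_def by blast

lemma tuple_of_surj:
  assumes "y \<in> tuples r"
  shows "\<exists>c\<in>UNIV \<rightarrow> carrier R. \<forall>i\<in>{1..s}. \<forall>j\<in>{1..r i}. \<exists>e\<in>\<mm> \<cdot> I i. y i j = e \<oplus> tuple_of c i j"
proof -
  have "\<exists>c. (\<forall>l<N i. c l \<in> carrier R) \<and>
      (\<exists>e\<in>\<mm> \<cdot> I i. y i j = e \<oplus> (\<Oplus>l\<in>{..<N i}. c l \<otimes> g i l))"
    if ij: "i \<in> {1..s}" "j \<in> {1..r i}" for i j
  proof -
    have "y i j \<in> span_upto (\<mm> \<cdot> I i) (g i) (N i)"
      using assms ij span_gens unfolding tuples_def by auto
    from span_upto_coefficients[OF ideal_prod_is_ideal[OF is_ideal ideals[OF ij(1)]] _ this]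
      gens_carrier[OF ij(1)]
    show ?thesis by (auto simp: Pi_iff)
  qed
  then obtain c where c: "\<And>i j l. i \<in> {1..s} \<Longrightarrow> j \<in> {1..r i} \<Longrightarrow> l < N i \<Longrightarrow> c i j l \<in> carrier R"
    "\<And>i j. i \<in> {1..s} \<Longrightarrow> j \<in> {1..r i} \<Longrightarrow>
      \<exists>e\<in>\<mm> \<cdot> I i. y i j = e \<oplus> (\<Oplus>l\<in>{..<N i}. c i j l \<otimes> g i l)"
    by metis
  let ?c = "\<lambda>(i, j, l). if (i, j, l) \<in> variables r then c i j l else \<zero>"
  have "tuple_of ?c i j = (\<Oplus>l\<in>{..<N i}. c i j l \<otimes> g i l)"
    if "i \<in> {1..s}" "j \<in> {1..r i}" for i j
    unfolding tuple_of_def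
    by (rule finsum_cong') (use c that gens_carrier in \<open>auto simp: variables_def\<close>)
  moreover have "?c \<in> UNIV \<rightarrow> carrier R" using c by (auto simp: variables_def)
  ultimately show ?thesis using c(2) by (intro bexI[of _ ?c]) auto
qed

text \<open>
  The condition depends only on the residue classes: \<open>e \<in> \<mm> \<cdot> I i\<close> changes the
  multiples by elements of
  \<open>\<mm> \<cdot> I i \<cdot> I\<^bsup>n - e\<^sub>i\<^esup> = \<mm> \<cdot> I\<^sup>n\<close>, which lie
  in \<open>J\<close>.
\<close>
lemma generates_modulo_perturb:
  assumes J: "ideal J R" "\<mm> \<cdot> Mon n \<subseteq> J" and y: "y \<in> tuples r"
    and yz: "\<And>i j. i \<in> {1..s} \<Longrightarrow> j \<in> {1..r i} \<Longrightarrow> \<exists>e\<in>\<mm> \<cdot> I i. y i j = e \<oplus> z i j"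
    and z: "z \<in> tuples r" and gen: "generates_modulo n r J y"
  shows "generates_modulo n r J z"
proof -
  have "J \<union> multiples n r z \<subseteq> carrier R"
    using ideal_subset_carrier[OF J(1)] multiples_subset[OF z] ideal_subset_carrier[OF monomial_ideal]
    by blast
  note sE = genideal_self[OF this] and iE = genideal_ideal[OF this]
  interpret E: ideal "Idl (J \<union> multiples n r z)" R by (rule iE)
  have "multiples n r y \<subseteq> Idl (J \<union> multiples n r z)"
  proof
    fix w assume "w \<in> multiples n r y"
    then obtain i j a where w: "i \<in> {1..s}" "0 < n i" "j \<in> {1..r i}"
      "a \<in> Mon (n(i := n i - 1))" "w = y i j \<otimes> a" unfolding multiples_def by blast
    obtain e where e: "e \<in> \<mm> \<cdot> I i" "y i j = e \<oplus> z i j" using yz[OF w(1,3)] by blast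
    have aC: "a \<in> carrier R" using ideal_subset_carrier[OF monomial_ideal] w(4) by blast
    have eC: "e \<in> carrier R" using ideal_prod_in_carrier[OF is_ideal ideals[OF w(1)]] e(1) by blast
    have "\<mm> \<cdot> I i \<subseteq> {x \<in> carrier R. \<forall>w\<in>{a}. x \<otimes> w \<in> J}"
    proof (rule ideal_prod_subset[OF ideal_quotient_ideal[OF J(1)]])
      fix t x assume tx: "t \<in> \<mm>" "x \<in> I i"
      have "t \<otimes> (x \<otimes> a) \<in> J"
        using J(2) ideal_prod.prod[OF tx(1) monomial_mult[OF w(1,2) tx(2) w(4)], of R] by blast
      then show "t \<otimes> x \<in> {x \<in> carrier R. \<forall>w\<in>{a}. x \<otimes> w \<in> J}"
        using max_carrier[OF tx(1)] ideal.Icarr[OF ideals[OF w(1)] tx(2)] aC by (simp add: m_assoc)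
    qed (use aC in simp)
    then have "e \<otimes> a \<in> J" using e(1) by blast
    moreover have "z i j \<otimes> a \<in> multiples n r z" using w unfolding multiples_def by blast
    ultimately have "e \<otimes> a \<oplus> z i j \<otimes> a \<in> Idl (J \<union> multiples n r z)"
      using sE by (intro E.a_closed) blast+
    moreover have "w = e \<otimes> a \<oplus> z i j \<otimes> a"
      using w(5) e(2) eC aC tuples_carrier[OF z w(1,3)] by (simp add: l_distr)
    ultimately show "w \<in> Idl (J \<union> multiples n r z)" by simp
  qed
  then have "Idl (J \<union> multiples n r y) \<subseteq> Idl (J \<union> multiples n r z)"
    using sE by (intro genideal_minimal[OF iE]) blast
  then show ?thesis using gen unfolding generates_modulo_def by (rule order_trans[rotated])
qed

text \<open>
  Each multiple \<open>tuple_of c i j \<otimes> a\<close> is linear in \<open>c\<close> with coefficients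
  \<open>g i l \<otimes> a\<close> in \<open>I\<^sup>n\<close>, so \<open>generic_generation\<close> applies.
  The set \<open>Y\<close> of variables is left open: all variables are allowed in the induction below, and
  exactly those of the tuple in the comparison with Zariski-open sets.
\<close>
lemma generates_modulo_open:
  assumes J: "ideal J R" "\<mm> \<cdot> Mon n \<subseteq> J" "J \<subseteq> Mon n"
    and Y: "variables r \<subseteq> Y" and c0: "c0 \<in> Y \<rightarrow> carrier R"
    and gen: "generates_modulo n r J (tuple_of c0)"
  shows "\<exists>f\<in>polyfun R Y. f c0 \<notin> \<mm> \<and>
    (\<forall>c\<in>Y \<rightarrow> carrier R. f c \<notin> \<mm> \<longrightarrow> generates_modulo n r J (tuple_of c))"
proof -
  obtain A where A: "finite A" "A \<subseteq> carrier R" "Mon n = Idl A"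
    using finitely_generated[OF monomial_ideal] .
  obtain b d where b: "span_upto J b d = Idl (J \<union> A)"
    "\<And>l. l < d \<Longrightarrow> b l \<in> carrier R" "\<And>l. l < d \<Longrightarrow> b l \<notin> span_upto J b l"
    using exists_independent_span[OF J(1) A(1,2)] by blast
  have JA: "J \<union> A \<subseteq> carrier R" using ideal_subset_carrier[OF J(1)] A(2) by simp
  have AM: "A \<subseteq> Mon n" using A(3) genideal_self[OF A(2)] by simp
  have sp: "span_upto J b d = Mon n"
  proof
    show "span_upto J b d \<subseteq> Mon n"
      unfolding b(1) using J(3) AM by (intro genideal_minimal[OF monomial_ideal]) simp
    show "Mon n \<subseteq> span_upto J b d"
      unfolding b(1) A(3) using JA by (rule subset_Idl_subset) simp
  qed
  have bM: "b l \<in> Mon n" if "l < d" for l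
  proof -
    have "b l \<in> span_upto J b k" if "l < k" "k \<le> d" for k
      using that
    proof (induction k)
      case (Suc k)
      have "ideal (span_upto J b k) R"
        by (rule span_upto_ideal[OF J(1)]) (use b(2) Suc.prems in auto)
      from adjoin_superset[OF this, of "b k"] show ?case
        using Suc b(2)[of k] by (cases "l = k") auto
    qed simp
    then show ?thesis using sp that by blast
  qed
  define Q where "Q = {\<lambda>c. tuple_of c i j \<otimes> a | i j a. i \<in> {1..s} \<and> 0 < n i \<and> j \<in> {1..r i} \<and>
     a \<in> Mon (n(i := n i - 1))}"
  have Qc: "(\<lambda>v. v c) ` Q = multiples n r (tuple_of c)" for c
    unfolding Q_def multiples_def by (auto simp: image_iff) blast
  have "polyvec Y J b d v" if vQ: "v \<in> Q" for v
  proof -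
    obtain i j a where v: "i \<in> {1..s}" "0 < n i" "j \<in> {1..r i}" "a \<in> Mon (n(i := n i - 1))"
      "v = (\<lambda>c. tuple_of c i j \<otimes> a)" using vQ unfolding Q_def
      by (elim CollectE exE conjE) (rule that)
    have aC: "a \<in> carrier R" using ideal_subset_carrier[OF monomial_ideal] v(4) by blast
    have Yl: "(i, j, l) \<in> Y" if "l < N i" for l using Y v that unfolding variables_def by blast
    have gC: "g i l \<in> carrier R" if "l < N i" for l using gens_carrier[OF v(1) that] .
    have "k \<le> N i \<Longrightarrow> polyvec Y J b d (\<lambda>c. (\<Oplus>l\<in>{..<k}. c (i, j, l) \<otimes> g i l) \<otimes> a)" for k
    proof (induction k)
      case 0
      have "\<zero> \<in> span_upto J b d" using sp ideal.axioms(1)[OF monomial_ideal]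
        by (simp add: additive_subgroup.zero_closed)
      then show ?case by (rule polyvec_cong[OF polyvec_const]) (simp add: aC)
    next
      case (Suc k)
      show ?case
      proof (rule polyvec_cong)
        have "g i k \<otimes> a \<in> span_upto J b d"
          unfolding sp using monomial_mult[OF v(1,2) gens_mem[OF v(1)] v(4)] Suc.prems by simp
        then have "polyvec Y J b d (\<lambda>c. c (i, j, k) \<otimes> (g i k \<otimes> a))"
          using Suc.prems by (intro polyvec_mult[OF J(1) b(2) polyvec_const polyfun_var] Yl) simp_all
        then show "polyvec Y J b d (\<lambda>c. c (i, j, k) \<otimes> (g i k \<otimes> a) \<oplus>
            (\<Oplus>l\<in>{..<k}. c (i, j, l) \<otimes> g i l) \<otimes> a)"
          using Suc.IH Suc.prems by (intro polyvec_add[OF J(1) b(2)]) simp_all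
        fix c assume c: "c \<in> Y \<rightarrow> carrier R"
        have cC: "c (i, j, l) \<in> carrier R" if "l < N i" for l using c Yl[OF that] by blast
        have sC: "(\<Oplus>l\<in>{..<k}. c (i, j, l) \<otimes> g i l) \<in> carrier R"
          by (rule finsum_closed) (use cC gC Suc.prems in auto)
        have "(\<Oplus>l\<in>{..<Suc k}. c (i, j, l) \<otimes> g i l) =
            c (i, j, k) \<otimes> g i k \<oplus> (\<Oplus>l\<in>{..<k}. c (i, j, l) \<otimes> g i l)"
          unfolding lessThan_Suc by (rule finsum_insert) (use Suc.prems cC gC in auto)
        then show "(\<Oplus>l\<in>{..<Suc k}. c (i, j, l) \<otimes> g i l) \<otimes> a =
            c (i, j, k) \<otimes> (g i k \<otimes> a) \<oplus> (\<Oplus>l\<in>{..<k}. c (i, j, l) \<otimes> g i l) \<otimes> a"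
          using sC cC[of k] gC[of k] aC Suc.prems by (simp add: l_distr m_assoc)
      qed
    qed
    from this[of "N i"] show ?thesis unfolding v(5) tuple_of_def by simp
  qed
  moreover have "t \<otimes> b l \<in> J" if "t \<in> \<mm>" "l < d" for t l
    using J(2) ideal_prod.prod[OF that(1) bM[OF that(2)], of R] by blast
  ultimately show ?thesis
    using generic_generation[OF J(1) b(2,3), of d Q Y c0] c0 gen
    unfolding generates_modulo_def Qc sp by blast
qed

end

context minimally_generated_ideals
begin

section \<open>Existence of generating elements by induction\<close>

lemma has_ideal_chain_single:
  "ideal V R \<Longrightarrow> L \<subset> V \<Longrightarrow> has_ideal_chain R 1 L V"
  using has_ideal_chain_SucI[of V R L 0 V] by simp

lemma tuples_carrier_union:
  assumes "ideal J R" "y \<in> tuples r"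
  shows "J \<union> multiples n r y \<subseteq> carrier R"
  using ideal_subset_carrier[OF assms(1)] multiples_subset[OF assms(2)]
    ideal_subset_carrier[OF monomial_ideal] by blast

lemma tuple_of_tuples:
  assumes "variables r \<subseteq> Y" "c \<in> Y \<rightarrow> carrier R"
  shows "tuple_of c \<in> tuples r"
  unfolding tuples_def using tuple_of_mem[OF assms] by blast

lemma multiplesI:
  "i \<in> {1..s} \<Longrightarrow> 0 < n i \<Longrightarrow> j \<in> {1..r i} \<Longrightarrow> a \<in> Mon (n(i := n i - 1)) \<Longrightarrow>
    y i j \<otimes> a \<in> multiples n r y"
  unfolding multiples_def by blast

text \<open>
  If \<open>g \<in> I p\<close> and \<open>I\<^bsup>n - e\<^sub>p\<^esup>\<close> is contained in
  \<open>(J : g) + \<Sum>i,j. y i j \<cdot> I\<^bsup>n - e\<^sub>p - e\<^sub>i\<^esup>\<close>, then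
  multiplication by \<open>g\<close> puts \<open>g I\<^bsup>n - e\<^sub>p\<^esup>\<close> into
  \<open>J + \<Sum>i,j. y i j \<cdot> I\<^bsup>n - e\<^sub>i\<^esup>\<close>. If this holds for all generators
  \<open>g\<close> of \<open>I p\<close>, it exhausts
  \<open>I\<^sup>n = I p \<cdot> I\<^bsup>n - e\<^sub>p\<^esup>\<close>.
\<close>
lemma generates_modulo_quotient_step:
  assumes J: "ideal J R" "\<mm> \<cdot> Mon n \<subseteq> J" and p: "p \<in> {1..s}" "0 < n p"
    and c: "c \<in> UNIV \<rightarrow> carrier R"
    and gen: "\<And>l. l < N p \<Longrightarrow> generates_modulo (n(p := n p - 1)) r
      {a \<in> Mon (n(p := n p - 1)). g p l \<otimes> a \<in> J} (tuple_of c)"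
  shows "generates_modulo n r J (tuple_of c)"
proof -
  let ?n = "n(p := n p - 1)"
  have y: "tuple_of c \<in> tuples r"
    by (rule tuple_of_tuples[OF subset_UNIV c])
  let ?E = "Idl (J \<union> multiples n r (tuple_of c))"
  note JC = tuples_carrier_union[OF J(1) y, of n]
  have iE: "ideal ?E R" using JC by (rule genideal_ideal)
  have sE: "J \<union> multiples n r (tuple_of c) \<subseteq> ?E" using JC by (rule genideal_self)
  have MC: "Mon k \<subseteq> carrier R" for k using ideal_subset_carrier[OF monomial_ideal] .
  have gE: "g p l \<otimes> a \<in> ?E" if l: "l < N p" and a: "a \<in> Mon ?n" for l a
  proof -
    let ?J = "{a \<in> Mon ?n. g p l \<otimes> a \<in> J}"
    let ?Z = "{x \<in> carrier R. \<forall>w\<in>{g p l}. x \<otimes> w \<in> ?E}"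
    have gC: "g p l \<in> carrier R" using gens_carrier[OF p(1) l] .
    have "?J \<union> multiples ?n r (tuple_of c) \<subseteq> ?Z"
    proof
      fix z assume "z \<in> ?J \<union> multiples ?n r (tuple_of c)"
      then consider "z \<in> ?J" | "z \<in> multiples ?n r (tuple_of c)" by blast
      then show "z \<in> ?Z"
      proof cases
        case 1
        then have "z \<in> carrier R" "g p l \<otimes> z \<in> ?E" using MC sE by blast+
        then show ?thesis using m_comm[OF _ gC] by simp
      next
        case 2
        then obtain i j b where b: "i \<in> {1..s}" "0 < ?n i" "j \<in> {1..r i}"
          "b \<in> Mon (?n(i := ?n i - 1))" "z = tuple_of c i j \<otimes> b" unfolding multiples_def by blast
        have ni: "0 < n i" using b(2) by (cases "i = p") auto
        have eq: "?n(i := ?n i - 1) = (n(i := n i - 1))(p := (n(i := n i - 1)) p - 1)"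
          by (auto simp: fun_eq_iff)
        have "0 < (n(i := n i - 1)) p" using p(2) b(2) by (cases "i = p") auto
        from monomial_mult[of p "n(i := n i - 1)", OF p(1) this gens_mem[OF p(1) l]] b(4)
        have "g p l \<otimes> b \<in> Mon (n(i := n i - 1))" unfolding eq by simp
        then have "tuple_of c i j \<otimes> (g p l \<otimes> b) \<in> ?E"
          using sE b(1,3) ni unfolding multiples_def by blast
        moreover have "b \<in> carrier R" using b(4) MC by blast
        ultimately show ?thesis
          using b(5) gC tuples_carrier[OF y b(1,3)] by (simp add: m_assoc m_comm[of b "g p l"])
      qed
    qed
    then have "Idl (?J \<union> multiples ?n r (tuple_of c)) \<subseteq> ?Z"
      using gC by (intro genideal_minimal ideal_quotient_ideal[OF iE]) auto
    then have "a \<in> ?Z" using gen[OF l] a unfolding generates_modulo_def by blast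
    then show ?thesis using m_comm[OF _ gC, of a] by simp
  qed
  have step: "I p \<subseteq> {x \<in> carrier R. \<forall>w\<in>Mon ?n. x \<otimes> w \<in> ?E}"
  proof -
    let ?Z = "{x \<in> carrier R. \<forall>w\<in>Mon ?n. x \<otimes> w \<in> ?E}"
    have iZ: "ideal ?Z R" using ideal_quotient_ideal[OF iE MC] .
    have "span_upto (\<mm> \<cdot> I p) (g p) (N p) \<subseteq> ?Z"
    proof (rule span_upto_minimal[OF iZ])
      show "\<mm> \<cdot> I p \<subseteq> ?Z"
      proof (rule ideal_prod_subset[OF iZ])
        fix t x assume tx: "t \<in> \<mm>" "x \<in> I p"
        have xC: "x \<in> carrier R" using ideal_subset_carrier[OF ideals[OF p(1)]] tx(2) by blast
        have "t \<otimes> (x \<otimes> w) \<in> ?E" if "w \<in> Mon ?n" for w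
          using ideal_prod.prod[OF tx(1) monomial_mult[OF p tx(2) that], of R] J(2) sE by blast
        then show "t \<otimes> x \<in> ?Z" using max_carrier[OF tx(1)] xC MC[of ?n] by (auto simp: m_assoc)
      qed
      show "g p l \<in> ?Z" if "l < N p" for l using gE[OF that] gens_carrier[OF p(1) that] by blast
    qed
    then show ?thesis using span_gens[OF p(1)] by simp
  qed
  have "Mon n \<subseteq> ?E"
    unfolding monomial_step[of p n, OF p] using step by (intro ideal_prod_subset[OF iE]) blast
  then show ?thesis unfolding generates_modulo_def .
qed

lemma ideal_colon_in_monomial:
  assumes "ideal J R" "x \<in> carrier R"
  shows "ideal {a \<in> Mon n. x \<otimes> a \<in> J} R"
proof -
  have "{a \<in> Mon n. x \<otimes> a \<in> J} = Mon n \<inter> {a \<in> carrier R. \<forall>w\<in>{x}. a \<otimes> w \<in> J}"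
  proof -
    have "a \<in> carrier R" "a \<otimes> x = x \<otimes> a" if "a \<in> Mon n" for a
      using ideal.Icarr[OF monomial_ideal that] m_comm[OF _ assms(2)] by simp_all
    then show ?thesis by auto
  qed
  then show ?thesis
    using i_intersect[OF monomial_ideal ideal_quotient_ideal[OF assms(1), of "{x}"]] assms(2) by simp
qed

text \<open>
  An element \<open>x\<close> whose multiples were added to \<open>J\<close> is counted as the last element of
  index \<open>p\<close> instead.
\<close>
lemma generates_modulo_extend:
  assumes J: "ideal J R" and p: "p \<in> {1..s}" "0 < n p" "0 < r p" and x: "x \<in> I p"
    and y: "y \<in> tuples (r(p := r p - 1))"
    and gen: "generates_modulo n (r(p := r p - 1)) (plus_multiples J x (Mon (n(p := n p - 1)))) y"
  shows "y(p := (y p)(r p := x)) \<in> tuples r" "generates_modulo n r J (y(p := (y p)(r p := x)))"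
proof -
  let ?y = "y(p := (y p)(r p := x))" and ?r = "r(p := r p - 1)"
  have eq: "?y i j = y i j" if "j \<in> {1..?r i}" for i j using that p(3) by auto
  have r': "j \<in> {1..?r i} \<or> (i = p \<and> j = r p)" if "j \<in> {1..r i}" for i j
    using that by (cases "i = p") auto
  show y': "?y \<in> tuples r"
    unfolding tuples_def
  proof (clarify, goal_cases)
    case (1 i j)
    show ?case
    proof (cases "i = p \<and> j = r p")
      case False
      with r' 1 have j: "j \<in> {1..?r i}" by blast
      then show ?thesis using eq[OF j] y 1 unfolding tuples_def by simp
    qed (use x in simp)
  qed
  note JC = tuples_carrier_union[OF J y', of n]
  let ?E = "Idl (J \<union> multiples n r ?y)"
  have iE: "ideal ?E R" using JC by (rule genideal_ideal)
  have sE: "J \<union> multiples n r ?y \<subseteq> ?E" using JC by (rule genideal_self)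
  have "plus_multiples J x (Mon (n(p := n p - 1))) \<subseteq> ?E"
  proof (rule plus_multiples_minimal[OF iE])
    fix u assume "u \<in> Mon (n(p := n p - 1))"
    then have "?y p (r p) \<otimes> u \<in> multiples n r ?y" using p by (intro multiplesI) simp_all
    then have "x \<otimes> u \<in> multiples n r ?y" by simp
    then show "x \<otimes> u \<in> ?E" using sE by blast
  qed (use sE in simp)
  moreover have "multiples n ?r y \<subseteq> multiples n r ?y"
  proof
    fix w assume "w \<in> multiples n ?r y"
    then obtain i j a where w: "i \<in> {1..s}" "0 < n i" "j \<in> {1..?r i}"
      "a \<in> Mon (n(i := n i - 1))" "w = y i j \<otimes> a" unfolding multiples_def by blast
    have "j \<in> {1..r i}" using w(3) by (auto split: if_splits)
    then show "w \<in> multiples n r ?y"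
      unfolding multiples_def w(5) eq[OF w(3), symmetric] using w(1,2,4) by blast
  qed
  ultimately have "Idl (plus_multiples J x (Mon (n(p := n p - 1))) \<union> multiples n ?r y) \<subseteq> ?E"
    using sE by (intro genideal_minimal[OF iE]) blast
  then show "generates_modulo n r J ?y"
    using gen unfolding generates_modulo_def by (rule order_trans[rotated])
qed

text \<open>
  Pascal's rule in the factor of index \<open>p\<close>.
\<close>
lemma prod_binomial_split:
  fixes n r :: "nat \<Rightarrow> nat"
  assumes "p \<in> {1..s}" "0 < n p" "0 < r p"
  shows "(\<Prod>i\<in>{1..s}. (n i + r i) choose r i) =
    (\<Prod>i\<in>{1..s}. ((n(p := n p - 1)) i + r i) choose r i) +
    (\<Prod>i\<in>{1..s}. (n i + (r(p := r p - 1)) i) choose (r(p := r p - 1)) i)"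
proof -
  obtain a b where ab: "n p = Suc a" "r p = Suc b" using assms gr0_implies_Suc by metis
  have eq: "(\<Prod>i\<in>{1..s}. f i) = f p * (\<Prod>i\<in>{1..s} - {p}. h i)"
    if "\<And>i. i \<noteq> p \<Longrightarrow> f i = h i" for f h :: "nat \<Rightarrow> nat"
    using prod.remove[OF _ assms(1), of f] that by (auto intro!: prod.cong)
  let ?P = "\<Prod>i\<in>{1..s} - {p}. (n i + r i) choose r i"
  have "(\<Prod>i\<in>{1..s}. (n i + r i) choose r i) = ((n p + r p) choose r p) * ?P"
    by (rule eq) simp
  moreover have "(\<Prod>i\<in>{1..s}. ((n(p := n p - 1)) i + r i) choose r i) = ((a + Suc b) choose Suc b) * ?P"
    by (subst eq[of _ "\<lambda>i. (n i + r i) choose r i"]) (simp_all add: ab)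
  moreover have "(\<Prod>i\<in>{1..s}. (n i + (r(p := r p - 1)) i) choose (r(p := r p - 1)) i) =
      ((Suc a + b) choose b) * ?P"
    by (subst eq[of _ "\<lambda>i. (n i + r i) choose r i"]) (simp_all add: ab)
  moreover have "(n p + r p) choose r p = ((a + Suc b) choose Suc b) + ((Suc a + b) choose b)"
    by (simp add: ab)
  ultimately show ?thesis by (simp add: add_mult_distrib)
qed

text \<open>
  The ideal \<open>J\<close> takes the place of the relations of a multigraded quotient algebra; only its
  component of degree \<open>n\<close> matters, which is why an arbitrary ideal between
  \<open>\<mm> \<cdot> I\<^sup>n\<close> and \<open>I\<^sup>n\<close> can be carried through the induction. If
  \<open>n i\<close> or \<open>r i\<close> is zero for every \<open>i\<close>, the product is
  \<open>1\<close>, and the absence of a chain of length \<open>1\<close> means \<open>J = I\<^sup>n\<close>.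
\<close>
theorem exists_generating_tuple:
  assumes "ideal J R" "\<mm> \<cdot> Mon n \<subseteq> J" "J \<subseteq> Mon n"
    and "\<not> has_ideal_chain R (\<Prod>i\<in>{1..s}. (n i + r i) choose r i) J (Mon n)"
  shows "\<exists>y\<in>tuples r. generates_modulo n r J y"
  using assms
proof (induction "\<Sum>i\<in>{1..s}. n i + r i" arbitrary: n r J rule: less_induct)
  case less
  note J = less.prems(1-3)
  show ?case
  proof (cases "\<exists>p\<in>{1..s}. 0 < n p \<and> 0 < r p")
    case False
    then have "(\<Prod>i\<in>{1..s}. (n i + r i) choose r i) = 1" by (intro prod.neutral) auto
    from less.prems(4)[unfolded this] have "\<not> J \<subset> Mon n"
      using has_ideal_chain_single[OF monomial_ideal] by blast
    then have "Mon n = J" using J(3) by blast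
    moreover have y: "(\<lambda>_ _. \<zero>) \<in> tuples r"
      unfolding tuples_def using additive_subgroup.zero_closed[OF ideal.axioms(1)[OF ideals]] by simp
    ultimately show ?thesis
      using genideal_self[OF tuples_carrier_union[OF J(1) y, of n]] unfolding generates_modulo_def
      by blast
  next
    case True
    then obtain p where p: "p \<in> {1..s}" "0 < n p" "0 < r p" by blast
    let ?n = "n(p := n p - 1)" and ?r = "r(p := r p - 1)"
    let ?a = "\<Prod>i\<in>{1..s}. (?n i + r i) choose r i"
    let ?b = "\<Prod>i\<in>{1..s}. (n i + ?r i) choose ?r i"
    have sum1: "(\<Sum>i\<in>{1..s}. ?n i + r i) < (\<Sum>i\<in>{1..s}. n i + r i)"
      by (rule sum_strict_mono_ex1) (use p in \<open>auto intro!: bexI[of _ p]\<close>)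
    have sum2: "(\<Sum>i\<in>{1..s}. n i + ?r i) < (\<Sum>i\<in>{1..s}. n i + r i)"
      by (rule sum_strict_mono_ex1) (use p in \<open>auto intro!: bexI[of _ p]\<close>)
    have xC: "x \<in> carrier R" if "x \<in> I p" for x
      using ideal_subset_carrier[OF ideals[OF p(1)]] that by blast
    have JxM: "plus_multiples J x (Mon ?n) \<subseteq> Mon n" if "x \<in> I p" for x
      using plus_multiples_minimal[OF monomial_ideal J(3)] monomial_mult[of p n, OF p(1,2) that] by blast
    have iJx: "ideal (plus_multiples J x (Mon ?n)) R" if "x \<in> I p" for x
      using plus_multiples_ideal[OF J(1) monomial_ideal xC[OF that]] .
    show ?thesis
    proof (cases "\<exists>x\<in>I p. \<not> has_ideal_chain R ?b (plus_multiples J x (Mon ?n)) (Mon n)")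
      case True
      then obtain x where x: "x \<in> I p"
        "\<not> has_ideal_chain R ?b (plus_multiples J x (Mon ?n)) (Mon n)" by blast
      have "J \<subseteq> plus_multiples J x (Mon ?n)"
        using plus_multiples_superset(1)[OF J(1) monomial_ideal xC[OF x(1)]] .
      with J(2) have "\<mm> \<cdot> Mon n \<subseteq> plus_multiples J x (Mon ?n)" by blast
      from less.hyps[OF sum2 iJx[OF x(1)] this JxM[OF x(1)] x(2)]
      obtain y where "y \<in> tuples ?r" "generates_modulo n ?r (plus_multiples J x (Mon ?n)) y" by blast
      from generates_modulo_extend[of J p n r, OF J(1) p x(1) this] show ?thesis by blast
    next
      case False
      \<comment> \<open>A chain in \<open>I\<^bsup>n - e\<^sub>p\<^esup>\<close> would become one from \<open>J\<close> to \<open>J\<^sub>x\<close> and could be continued to \<open>I\<^sup>n\<close>.\<close>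
      have no_chain: "\<not> has_ideal_chain R ?a {a \<in> Mon ?n. x \<otimes> a \<in> J} (Mon ?n)" if x: "x \<in> I p" for x
      proof
        assume "has_ideal_chain R ?a {a \<in> Mon ?n. x \<otimes> a \<in> J} (Mon ?n)"
        from has_ideal_chain_colon[OF J(1) xC[OF x] ideal_colon_in_monomial[OF J(1) xC[OF x]] _
            monomial_ideal this]
        have 1: "has_ideal_chain R ?a (plus_multiples J x {a \<in> Mon ?n. x \<otimes> a \<in> J})
            (plus_multiples J x (Mon ?n))" by blast
        have "J \<subseteq> plus_multiples J x {a \<in> Mon ?n. x \<otimes> a \<in> J}"
          using plus_multiples_superset(1)[OF J(1) ideal_colon_in_monomial[OF J(1) xC[OF x]] xC[OF x]] .
        from has_ideal_chain_lower[OF 1 this]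
        have "has_ideal_chain R ?a J (plus_multiples J x (Mon ?n))" .
        moreover have "has_ideal_chain R ?b (plus_multiples J x (Mon ?n)) (Mon n)"
          using False x by blast
        ultimately have "has_ideal_chain R (?a + ?b) J (Mon n)" by (rule has_ideal_chain_append)
        then show False using less.prems(4) prod_binomial_split[of p n r, OF p] by simp
      qed
      let ?J = "\<lambda>l. {a \<in> Mon ?n. g p l \<otimes> a \<in> J}"
      \<comment> \<open>For each generator of \<open>I p\<close> a non-empty open set of coordinates solves the problem in degree \<open>n - e\<^sub>p\<close>.\<close>
      have "\<exists>f\<in>polyfun R UNIV. (\<exists>c\<in>UNIV \<rightarrow> carrier R. f c \<notin> \<mm>) \<and>
          (\<forall>c\<in>UNIV \<rightarrow> carrier R. f c \<notin> \<mm> \<longrightarrow> generates_modulo ?n r (?J l) (tuple_of c))"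
        if l: "l < N p" for l
      proof -
        note gI = gens_mem[OF p(1) l]
        have iJl: "ideal (?J l) R" using ideal_colon_in_monomial[OF J(1) xC[OF gI]] .
        have mJl: "\<mm> \<cdot> Mon ?n \<subseteq> ?J l"
        proof (rule ideal_prod_subset[OF iJl])
          fix t a assume ta: "t \<in> \<mm>" "a \<in> Mon ?n"
          have aC: "a \<in> carrier R" using ideal_subset_carrier[OF monomial_ideal] ta(2) by blast
          have "t \<otimes> (g p l \<otimes> a) \<in> J"
            using J(2) ideal_prod.prod[OF ta(1) monomial_mult[of p n, OF p(1,2) gI ta(2)], of R] by blast
          moreover have "t \<otimes> a \<in> Mon ?n"
            using ideal.I_l_closed[OF monomial_ideal ta(2) max_carrier[OF ta(1)]] .
          ultimately show "t \<otimes> a \<in> ?J l"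
            using m_lcomm[OF max_carrier[OF ta(1)] xC[OF gI] aC] by simp
        qed
        from less.hyps[OF sum1 iJl mJl _ no_chain[OF gI]]
        obtain y where y: "y \<in> tuples r" "generates_modulo ?n r (?J l) y" by blast
        obtain c where c: "c \<in> UNIV \<rightarrow> carrier R"
          "\<forall>i\<in>{1..s}. \<forall>j\<in>{1..r i}. \<exists>e\<in>\<mm> \<cdot> I i. y i j = e \<oplus> tuple_of c i j"
          using tuple_of_surj[OF y(1)] by blast
        have tc: "tuple_of c \<in> tuples r"
          by (rule tuple_of_tuples[OF subset_UNIV c(1)])
        have "generates_modulo ?n r (?J l) (tuple_of c)"
          using generates_modulo_perturb[OF iJl mJl y(1) _ tc y(2)] c(2) by blast
        from generates_modulo_open[OF iJl mJl _ subset_UNIV c(1) this]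
        show ?thesis using c(1) by blast
      qed
      then have "\<forall>l\<in>{..<N p}. \<exists>f. f \<in> polyfun R UNIV \<and> (\<exists>c\<in>UNIV \<rightarrow> carrier R. f c \<notin> \<mm>) \<and>
          (\<forall>c\<in>UNIV \<rightarrow> carrier R. f c \<notin> \<mm> \<longrightarrow> generates_modulo ?n r (?J l) (tuple_of c))"
        by (simp only: lessThan_iff Bex_def) blast
      from bchoice[OF this] obtain f where
        "\<forall>l\<in>{..<N p}. f l \<in> polyfun R UNIV \<and> (\<exists>c\<in>UNIV \<rightarrow> carrier R. f l c \<notin> \<mm>) \<and>
          (\<forall>c\<in>UNIV \<rightarrow> carrier R. f l c \<notin> \<mm> \<longrightarrow> generates_modulo ?n r (?J l) (tuple_of c))" ..
      then have f: "\<And>l. l < N p \<Longrightarrow> f l \<in> polyfun R UNIV \<and> (\<exists>c\<in>UNIV \<rightarrow> carrier R. f l c \<notin> \<mm>)"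
        "\<And>l c. l < N p \<Longrightarrow> c \<in> UNIV \<rightarrow> carrier R \<Longrightarrow> f l c \<notin> \<mm> \<Longrightarrow>
          generates_modulo ?n r (?J l) (tuple_of c)"
        unfolding Ball_def lessThan_iff by simp_all
      from polyfun_family_common_nonzero[OF is_cring infinite_residue_field f(1)]
      have "\<exists>c\<in>UNIV \<rightarrow> carrier R. \<forall>l<N p. f l c \<notin> \<mm>" by simp
      then obtain c where c: "c \<in> UNIV \<rightarrow> carrier R" "\<forall>l<N p. f l c \<notin> \<mm>" ..
      have "tuple_of c \<in> tuples r"
        by (rule tuple_of_tuples[OF subset_UNIV c(1)])
      moreover have "generates_modulo n r J (tuple_of c)"
        by (rule generates_modulo_quotient_step[of J n p, OF J(1,2) p(1,2) c(1)])
          (rule f(2)[OF _ c(1)], use c(2) in auto)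
      ultimately show ?thesis by blast
    qed
  qed
qed

section \<open>From one degree to all larger degrees\<close>

lemma finsum_ideals:
  assumes "finite A" "\<And>i. i \<in> A \<Longrightarrow> ideal (F i) R"
  shows "ideal (\<Oplus>\<^bsub>ideals_set R\<^esub>i\<in>A. F i) R" "i \<in> A \<Longrightarrow> F i \<subseteq> (\<Oplus>\<^bsub>ideals_set R\<^esub>i\<in>A. F i)"
    "ideal V R \<Longrightarrow> (\<And>i. i \<in> A \<Longrightarrow> F i \<subseteq> V) \<Longrightarrow> (\<Oplus>\<^bsub>ideals_set R\<^esub>i\<in>A. F i) \<subseteq> V"
proof -
  interpret S: semiring "ideals_set R" by (rule ideals_set_is_semiring)
  have mem: "x \<in> set_add R U W \<longleftrightarrow> (\<exists>u\<in>U. \<exists>w\<in>W. x = u \<oplus> w)" for x U W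
    unfolding set_add_def' by blast
  have "ideal (\<Oplus>\<^bsub>ideals_set R\<^esub>i\<in>A. F i) R \<and> (\<forall>i\<in>A. F i \<subseteq> (\<Oplus>\<^bsub>ideals_set R\<^esub>i\<in>A. F i)) \<and>
    (\<forall>V. ideal V R \<longrightarrow> (\<forall>i\<in>A. F i \<subseteq> V) \<longrightarrow> (\<Oplus>\<^bsub>ideals_set R\<^esub>i\<in>A. F i) \<subseteq> V)"
    using assms
  proof (induction A rule: finite_induct)
    case empty
    have "(\<Oplus>\<^bsub>ideals_set R\<^esub>i\<in>{}. F i) = {\<zero>}"
      unfolding S.finsum_empty by (simp add: ideals_set_def)
    then show ?case using zeroideal additive_subgroup.zero_closed[OF ideal.axioms(1)] by auto
  next
    case (insert a A)
    let ?S = "\<Oplus>\<^bsub>ideals_set R\<^esub>i\<in>A. F i"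
    have "(\<Oplus>\<^bsub>ideals_set R\<^esub>i\<in>insert a A. F i) = F a \<oplus>\<^bsub>ideals_set R\<^esub> ?S"
      using insert by (intro S.finsum_insert) (auto simp: ideals_set_def)
    then have eq: "(\<Oplus>\<^bsub>ideals_set R\<^esub>i\<in>insert a A. F i) = set_add R (F a) ?S"
      by (simp add: ideals_set_def)
    have ih: "ideal ?S R" "\<And>i. i \<in> A \<Longrightarrow> F i \<subseteq> ?S"
      "\<And>V. ideal V R \<Longrightarrow> (\<forall>i\<in>A. F i \<subseteq> V) \<Longrightarrow> ?S \<subseteq> V" using insert.IH insert.prems by auto
    have iFa: "ideal (F a) R" using insert.prems by simp
    interpret Fa: ideal "F a" R by (rule iFa)
    interpret SS: ideal ?S R by (rule ih(1))
    have "F a \<subseteq> set_add R (F a) ?S"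
    proof
      fix x assume "x \<in> F a"
      then show "x \<in> set_add R (F a) ?S" unfolding mem
        by (intro bexI[of _ x] bexI[of _ \<zero>]) (simp_all add: Fa.Icarr)
    qed
    moreover have "?S \<subseteq> set_add R (F a) ?S"
    proof
      fix x assume "x \<in> ?S"
      then show "x \<in> set_add R (F a) ?S" unfolding mem
        by (intro bexI[of _ \<zero>] bexI[of _ x]) (simp_all add: SS.Icarr)
    qed
    moreover have "set_add R (F a) ?S \<subseteq> V" if V: "ideal V R" "\<forall>i\<in>insert a A. F i \<subseteq> V" for V
    proof
      fix x assume "x \<in> set_add R (F a) ?S"
      then obtain u w where "u \<in> F a" "w \<in> ?S" "x = u \<oplus> w" unfolding mem by blast
      moreover have "?S \<subseteq> V" using ih(3)[OF V(1)] V(2) by simp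
      ultimately show "x \<in> V"
        using V(2) additive_subgroup.a_closed[OF ideal.axioms(1)[OF V(1)]] by blast
    qed
    moreover have "F i \<subseteq> set_add R (F a) ?S" if "i \<in> A" for i
      using ih(2)[OF that] \<open>?S \<subseteq> set_add R (F a) ?S\<close> by (rule order_trans)
    ultimately show ?case
      unfolding eq using add_ideals[OF iFa ih(1)] by simp
  qed
  then show "ideal (\<Oplus>\<^bsub>ideals_set R\<^esub>i\<in>A. F i) R"
    "i \<in> A \<Longrightarrow> F i \<subseteq> (\<Oplus>\<^bsub>ideals_set R\<^esub>i\<in>A. F i)"
    "ideal V R \<Longrightarrow> (\<And>i. i \<in> A \<Longrightarrow> F i \<subseteq> V) \<Longrightarrow> (\<Oplus>\<^bsub>ideals_set R\<^esub>i\<in>A. F i) \<subseteq> V"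
    by blast+
qed

text \<open>
  Nakayama's lemma gives \<open>I\<^sup>n = \<Sum>i,j. x i j \<cdot> I\<^bsup>n - e\<^sub>i\<^esup>\<close>,
  where only \<open>i\<close> with \<open>n i > 0\<close> occur. Multiplication by
  \<open>I\<^bsup>m - n\<^esup>\<close> turns each summand into a part of the summand of degree
  \<open>m\<close> with the same index.
\<close>
lemma monomial_eq_sum:
  assumes x: "x \<in> tuples r" and gen: "generates_modulo n r (\<mm> \<cdot> Mon n) x"
    and m: "\<And>i. i \<in> {1..s} \<Longrightarrow> n i \<le> m i"
  shows "Mon m = (\<Oplus>\<^bsub>ideals_set R\<^esub>i\<in>{1..s}. if m i = 0 then {\<zero>}
     else genideal R (x i ` {1..r i}) \<cdot> Mon (m(i := m i - 1)))" (is "_ = ?T")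
proof -
  let ?F = "\<lambda>i. if m i = 0 then {\<zero>} else genideal R (x i ` {1..r i}) \<cdot> Mon (m(i := m i - 1))"
  have xI: "x i ` {1..r i} \<subseteq> I i" if "i \<in> {1..s}" for i
    using x that unfolding tuples_def by auto
  have xC: "x i ` {1..r i} \<subseteq> carrier R" if "i \<in> {1..s}" for i
    using xI[OF that] ideal_subset_carrier[OF ideals[OF that]] by blast
  have iX: "ideal (Idl (x i ` {1..r i})) R" if "i \<in> {1..s}" for i
    using genideal_ideal[OF xC[OF that]] .
  have iF: "ideal (?F i) R" if "i \<in> {1..s}" for i
    using zeroideal ideal_prod_is_ideal[OF iX[OF that] monomial_ideal] by simp
  have iT: "ideal ?T R" by (rule finsum_ideals(1)[of "{1..s}" ?F, OF finite_atLeastAtMost iF])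
  show ?thesis
  proof
    show "?T \<subseteq> Mon m"
    proof (rule finsum_ideals(3)[OF _ iF monomial_ideal])
      fix i assume i: "i \<in> {1..s}"
      have "Idl (x i ` {1..r i}) \<subseteq> I i" using genideal_minimal[OF ideals[OF i] xI[OF i]] .
      then have "(Idl (x i ` {1..r i})) \<cdot> Mon (m(i := m i - 1)) \<subseteq> Mon m" if "0 < m i"
        using monomial_mult[of i m, OF i that] by (intro ideal_prod_subset[OF monomial_ideal]) blast
      moreover have "\<zero> \<in> Mon m"
        using additive_subgroup.zero_closed[OF ideal.axioms(1)[OF monomial_ideal]] .
      ultimately show "?F i \<subseteq> Mon m" by simp
    qed simp
    let ?k = "\<lambda>i. m i - n i"
    let ?Z = "{u \<in> carrier R. \<forall>w\<in>Mon ?k. u \<otimes> w \<in> ?T}"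
    have MC: "Mon k \<subseteq> carrier R" for k using ideal_subset_carrier[OF monomial_ideal] .
    have iZ: "ideal ?Z R" using ideal_quotient_ideal[OF iT MC] .
    have mC: "multiples n r x \<subseteq> carrier R" using multiples_subset[OF x] MC by blast
    have "multiples n r x \<subseteq> ?Z"
    proof
      fix z assume "z \<in> multiples n r x"
      then obtain i j a where z: "i \<in> {1..s}" "0 < n i" "j \<in> {1..r i}"
        "a \<in> Mon (n(i := n i - 1))" "z = x i j \<otimes> a" unfolding multiples_def by blast
      have mi: "0 < m i" using m[OF z(1)] z(2) by simp
      have xij: "x i j \<in> Idl (x i ` {1..r i})" using genideal_self[OF xC[OF z(1)]] z(3) by blast
      have "z \<otimes> w \<in> ?T" if w: "w \<in> Mon ?k" for w
      proof -
        have "Mon (m(i := m i - 1)) = Mon (\<lambda>l. (n(i := n i - 1)) l + ?k l)"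
          by (rule monomial_cong) (use m z(2) in auto)
        then have "a \<otimes> w \<in> Mon (m(i := m i - 1))"
          using ideal_prod.prod[OF z(4) w, of R] by (simp only: monomial_add)
        then have "x i j \<otimes> (a \<otimes> w) \<in> ?F i" using mi ideal_prod.prod[OF xij, of _ _ R] by simp
        then have "x i j \<otimes> (a \<otimes> w) \<in> ?T" using finsum_ideals(2)[of "{1..s}" ?F, OF finite_atLeastAtMost iF z(1)] by blast
        moreover have "a \<in> carrier R" "w \<in> carrier R" using z(4) w MC by blast+
        ultimately show ?thesis using z(5) tuples_carrier[OF x z(1,3)] by (simp add: m_assoc)
      qed
      then show "z \<in> ?Z" using \<open>z \<in> multiples n r x\<close> mC by blast
    qed
    then have "Idl (multiples n r x) \<subseteq> ?Z" by (rule genideal_minimal[OF iZ])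
    moreover have "Mon n \<subseteq> Idl (multiples n r x)"
      using nakayama[OF monomial_ideal mC] gen unfolding generates_modulo_def by blast
    ultimately have "Mon n \<cdot> Mon ?k \<subseteq> ?T" by (intro ideal_prod_subset[OF iT]) blast
    moreover have "Mon m = Mon (\<lambda>i. n i + ?k i)" by (rule monomial_cong) (use m in simp)
    ultimately show "Mon m \<subseteq> ?T" by (simp only: monomial_add)
  qed
qed

end

section \<open>Polynomial functions as evaluations of polynomials\<close>

context cring
begin

lemma indexed_pset_coeff_carrier:
  "F \<in> indexed_pset V (carrier R) \<Longrightarrow> F u \<in> carrier R"
  using indexed_pset_in_carrier[OF subset_refl, of F V] by (simp add: carrier_coeff_def)

lemma indexed_pmult_support:
  "{u. (indexed_pmult F i) u \<noteq> \<zero>} = add_mset i ` {u. F u \<noteq> \<zero>}"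
proof (intro equalityI subsetI)
  fix u assume "u \<in> {u. (indexed_pmult F i) u \<noteq> \<zero>}"
  then have "i \<in># u" "F (u - {#i#}) \<noteq> \<zero>" by (auto simp: indexed_pmult_def split: if_splits)
  then show "u \<in> add_mset i ` {u. F u \<noteq> \<zero>}"
    by (intro image_eqI[of _ _ "u - {#i#}"]) simp_all
qed (auto simp: indexed_pmult_def)

lemma indexed_pset_finite_support:
  assumes "F \<in> indexed_pset V (carrier R)"
  shows "finite {u. F u \<noteq> \<zero>}"
  using assms
proof induction
  case (indexed_const k)
  have "{u. indexed_const k u \<noteq> \<zero>} \<subseteq> {{#}}" by (auto simp: indexed_const_def)
  then show ?case by (rule finite_subset) simp
next
  case (indexed_padd P Q)
  have "{u. indexed_padd P Q u \<noteq> \<zero>} \<subseteq> {u. P u \<noteq> \<zero>} \<union> {u. Q u \<noteq> \<zero>}"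
    by (auto simp: indexed_padd_def)
  then show ?case using indexed_padd.IH by (meson finite_UnI finite_subset)
next
  case (indexed_pmult P i)
  then show ?case by (simp add: indexed_pmult_support)
qed

definition monomial_value :: "nat \<Rightarrow> (nat \<Rightarrow> 'a) \<Rightarrow> nat multiset \<Rightarrow> 'a" where
  "monomial_value N c u = (\<Otimes>l\<in>{..<N}. c l [^] count u l)"

lemma monomial_value_closed:
  "c \<in> {..<N} \<rightarrow> carrier R \<Longrightarrow> monomial_value N c u \<in> carrier R"
  unfolding monomial_value_def by (intro finprod_closed) (auto simp: Pi_iff)

lemma monomial_value_add_mset:
  assumes "c \<in> {..<N} \<rightarrow> carrier R" "i < N"
  shows "monomial_value N c (add_mset i u) = monomial_value N c u \<otimes> c i"
proof -
  have c: "c l \<in> carrier R" if "l < N" for l using assms(1) that by (simp add: Pi_iff)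
  have "monomial_value N c (add_mset i u) =
      (\<Otimes>l\<in>{..<N}. c l [^] count u l \<otimes> (if i = l then c l else \<one>))"
    unfolding monomial_value_def by (rule finprod_cong') (use c in \<open>auto simp: nat_pow_Suc\<close>)
  also have "\<dots> = monomial_value N c u \<otimes> (\<Otimes>l\<in>{..<N}. if i = l then c l else \<one>)"
    unfolding monomial_value_def by (rule finprod_multf) (use c in auto)
  also have "(\<Otimes>l\<in>{..<N}. if i = l then c l else \<one>) = c i"
    by (rule finprod_singleton) (use assms c in auto)
  finally show ?thesis .
qed

lemma point_eval_superset:
  assumes "F \<in> indexed_pset V (carrier R)" "c \<in> {..<N} \<rightarrow> carrier R"
    and "finite S" "{u. F u \<noteq> \<zero>} \<subseteq> S"
  shows "point_eval R N F c = (\<Oplus>u\<in>S. F u \<otimes> monomial_value N c u)"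
  unfolding point_eval_def monomial_value_def[symmetric]
  using assms(3,4) monomial_value_closed[OF assms(2)] indexed_pset_coeff_carrier[OF assms(1)]
  by (intro add.finprod_mono_neutral_cong_left) auto

lemma point_eval_closed:
  assumes "F \<in> indexed_pset V (carrier R)" "c \<in> {..<N} \<rightarrow> carrier R"
  shows "point_eval R N F c \<in> carrier R"
  unfolding point_eval_superset[OF assms indexed_pset_finite_support[OF assms(1)] subset_refl]
  using monomial_value_closed[OF assms(2)] indexed_pset_coeff_carrier[OF assms(1)]
  by (intro finsum_closed) auto

lemma point_eval_const:
  assumes "k \<in> carrier R" "c \<in> {..<N} \<rightarrow> carrier R"
  shows "point_eval R N (indexed_const k) c = k"
proof -
  have "monomial_value N c {#} = \<one>" unfolding monomial_value_def by (simp add: finprod_one_eqI)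
  moreover have "point_eval R N (indexed_const k) c =
      (\<Oplus>u\<in>{{#}}. indexed_const k u \<otimes> monomial_value N c u)"
    by (rule point_eval_superset[OF indexed_pset.indexed_const[OF assms(1)] assms(2)])
      (auto simp: indexed_const_def)
  ultimately show ?thesis using assms(1) by (simp add: indexed_const_def)
qed

lemma point_eval_add:
  assumes F: "F \<in> indexed_pset V (carrier R)" and G: "G \<in> indexed_pset V (carrier R)"
    and c: "c \<in> {..<N} \<rightarrow> carrier R"
  shows "point_eval R N (indexed_padd F G) c = point_eval R N F c \<oplus> point_eval R N G c"
proof -
  let ?S = "{u. F u \<noteq> \<zero>} \<union> {u. G u \<noteq> \<zero>}"
  have fin: "finite ?S" using indexed_pset_finite_support F G by blast
  note FC = indexed_pset_coeff_carrier[OF F] and GC = indexed_pset_coeff_carrier[OF G]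
  have "point_eval R N (indexed_padd F G) c =
      (\<Oplus>u\<in>?S. indexed_padd F G u \<otimes> monomial_value N c u)"
    by (rule point_eval_superset[OF indexed_pset.indexed_padd[OF F G] c fin])
      (auto simp: indexed_padd_def)
  also have "\<dots> = (\<Oplus>u\<in>?S. F u \<otimes> monomial_value N c u \<oplus> G u \<otimes> monomial_value N c u)"
    using FC GC monomial_value_closed[OF c]
    by (intro finsum_cong') (auto simp: indexed_padd_def l_distr)
  also have "\<dots> = (\<Oplus>u\<in>?S. F u \<otimes> monomial_value N c u) \<oplus> (\<Oplus>u\<in>?S. G u \<otimes> monomial_value N c u)"
    using FC GC monomial_value_closed[OF c] by (intro finsum_addf) auto
  finally show ?thesis
    using point_eval_superset[OF F c fin] point_eval_superset[OF G c fin] by simp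
qed

lemma point_eval_pmult:
  assumes F: "F \<in> indexed_pset {..<N} (carrier R)" and i: "i < N"
    and c: "c \<in> {..<N} \<rightarrow> carrier R"
  shows "point_eval R N (indexed_pmult F i) c = point_eval R N F c \<otimes> c i"
proof -
  note FC = indexed_pset_coeff_carrier[OF F] and mC = monomial_value_closed[OF c]
  have ci: "c i \<in> carrier R" using c i by (simp add: Pi_iff)
  let ?S = "{u. F u \<noteq> \<zero>}"
  have fin: "finite ?S" using indexed_pset_finite_support[OF F] .
  have Fi: "indexed_pmult F i \<in> indexed_pset {..<N} (carrier R)"
    using indexed_pset.indexed_pmult[OF F] i by simp
  have "point_eval R N (indexed_pmult F i) c =
      (\<Oplus>u\<in>add_mset i ` ?S. indexed_pmult F i u \<otimes> monomial_value N c u)"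
    by (rule point_eval_superset[OF Fi c]) (use fin in \<open>auto simp: indexed_pmult_support\<close>)
  also have "\<dots> = (\<Oplus>u\<in>?S. indexed_pmult F i (add_mset i u) \<otimes> monomial_value N c (add_mset i u))"
    by (rule finsum_reindex) (auto simp: inj_on_def indexed_pmult_def FC mC)
  also have "\<dots> = (\<Oplus>u\<in>?S. (F u \<otimes> monomial_value N c u) \<otimes> c i)"
    by (rule finsum_cong')
      (auto simp: indexed_pmult_def FC mC ci monomial_value_add_mset[OF c i] m_assoc)
  also have "\<dots> = (\<Oplus>u\<in>?S. F u \<otimes> monomial_value N c u) \<otimes> c i"
    by (rule finsum_ldistr[symmetric]) (use fin ci FC mC in auto)
  finally show ?thesis using point_eval_superset[OF F c fin subset_refl] by simp
qed

lemma point_eval_scale_exists: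
  assumes "F \<in> indexed_pset {..<N} (carrier R)" "k \<in> carrier R"
  shows "\<exists>H\<in>indexed_pset {..<N} (carrier R). \<forall>c\<in>{..<N} \<rightarrow> carrier R.
    point_eval R N H c = point_eval R N F c \<otimes> k"
  using assms(1)
proof induction
  case (indexed_const a)
  then show ?case using assms(2)
    by (intro bexI[of _ "indexed_const (a \<otimes> k)"])
      (auto simp: point_eval_const intro: indexed_pset.indexed_const)
next
  case (indexed_padd P Q)
  then obtain P' Q' where h: "P' \<in> indexed_pset {..<N} (carrier R)" "Q' \<in> indexed_pset {..<N} (carrier R)"
    "\<forall>c\<in>{..<N} \<rightarrow> carrier R. point_eval R N P' c = point_eval R N P c \<otimes> k"
    "\<forall>c\<in>{..<N} \<rightarrow> carrier R. point_eval R N Q' c = point_eval R N Q c \<otimes> k" by blast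
  show ?case
    by (rule bexI[OF _ indexed_pset.indexed_padd[OF h(1,2)]])
      (use h indexed_padd.hyps assms(2) in \<open>simp add: point_eval_add point_eval_closed l_distr\<close>)
next
  case (indexed_pmult P i)
  then obtain P' where h: "P' \<in> indexed_pset {..<N} (carrier R)"
    "\<forall>c\<in>{..<N} \<rightarrow> carrier R. point_eval R N P' c = point_eval R N P c \<otimes> k" by blast
  have "point_eval R N P c \<otimes> k \<otimes> c i = point_eval R N P c \<otimes> c i \<otimes> k"
    if "c \<in> {..<N} \<rightarrow> carrier R" for c
    using point_eval_closed[OF indexed_pmult.hyps(1) that] assms(2) that indexed_pmult.hyps(2)
    by (simp add: m_assoc m_comm[of k] Pi_iff)
  then show ?case
    by (intro bexI[OF _ indexed_pset.indexed_pmult[OF h(1) indexed_pmult.hyps(2)]])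
      (use h indexed_pmult.hyps in \<open>simp add: point_eval_pmult\<close>)
qed

text \<open>
  The indexed polynomials come with products by a variable only. General products are obtained by induction on
  the second factor, from scalar multiples, sums and products by a variable.
\<close>
lemma point_eval_mult_exists:
  assumes "G \<in> indexed_pset {..<N} (carrier R)" "F \<in> indexed_pset {..<N} (carrier R)"
  shows "\<exists>H\<in>indexed_pset {..<N} (carrier R). \<forall>c\<in>{..<N} \<rightarrow> carrier R.
    point_eval R N H c = point_eval R N F c \<otimes> point_eval R N G c"
  using assms(1)
proof induction
  case (indexed_const a)
  from point_eval_scale_exists[OF assms(2) this] show ?case
    by (simp add: point_eval_const indexed_const)
next
  case (indexed_padd P Q)
  then obtain P' Q' where h: "P' \<in> indexed_pset {..<N} (carrier R)" "Q' \<in> indexed_pset {..<N} (carrier R)"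
    "\<forall>c\<in>{..<N} \<rightarrow> carrier R. point_eval R N P' c = point_eval R N F c \<otimes> point_eval R N P c"
    "\<forall>c\<in>{..<N} \<rightarrow> carrier R. point_eval R N Q' c = point_eval R N F c \<otimes> point_eval R N Q c" by blast
  show ?case
    by (rule bexI[OF _ indexed_pset.indexed_padd[OF h(1,2)]])
      (use h indexed_padd.hyps assms(2) in \<open>simp add: point_eval_add point_eval_closed r_distr\<close>)
next
  case (indexed_pmult P i)
  then obtain P' where h: "P' \<in> indexed_pset {..<N} (carrier R)"
    "\<forall>c\<in>{..<N} \<rightarrow> carrier R. point_eval R N P' c = point_eval R N F c \<otimes> point_eval R N P c" by blast
  have "c i \<in> carrier R" if "c \<in> {..<N} \<rightarrow> carrier R" for c
    using that indexed_pmult.hyps(2) by (simp add: Pi_iff)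
  then show ?case
    by (intro bexI[OF _ indexed_pset.indexed_pmult[OF h(1) indexed_pmult.hyps(2)]])
      (use h indexed_pmult.hyps assms(2) in \<open>simp add: point_eval_pmult point_eval_closed m_assoc\<close>)
qed

lemma point_eval_cong:
  assumes "\<And>l. l < N \<Longrightarrow> c l = c' l" "c' \<in> {..<N} \<rightarrow> carrier R"
  shows "point_eval R N F c = point_eval R N F c'"
proof -
  have "(\<Otimes>l\<in>{..<N}. c l [^] count u l) = (\<Otimes>l\<in>{..<N}. c' l [^] count u l)" for u
    by (rule finprod_cong') (use assms in \<open>auto simp: Pi_iff\<close>)
  then show ?thesis unfolding point_eval_def by simp
qed

text \<open>
  Along the reduction \<open>h\<close> to the residue field, polynomial functions become evaluations of
  polynomials; \<open>e\<close> numbers the variables.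
\<close>
lemma polyfun_image_polynomial:
  assumes hom: "ring_hom_ring S R h" and e: "e \<in> {..<N} \<rightarrow> Y" "Y \<subseteq> e ` {..<N}"
    and f: "f \<in> polyfun S Y"
  shows "\<exists>H\<in>indexed_pset {..<N} (carrier R). \<forall>c\<in>Y \<rightarrow> carrier S.
    point_eval R N H (\<lambda>q. h (c (e q))) = h (f c)"
proof -
  interpret h: ring_hom_ring S R h by (rule hom)
  have C: "(\<lambda>q. h (c (e q))) \<in> {..<N} \<rightarrow> carrier R" if "c \<in> Y \<rightarrow> carrier S" for c
    using that e(1) by (auto simp: Pi_iff)
  show ?thesis using f
  proof induction
    case (polyfun_const a)
    then show ?case
      by (intro bexI[of _ "indexed_const (h a)"])
        (auto simp: point_eval_const C intro: indexed_pset.indexed_const)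
  next
    case (polyfun_var i)
    then obtain q where q: "q < N" "i = e q" using e(2) by auto
    have o: "indexed_const \<one> \<in> indexed_pset {..<N} (carrier R)" by (simp add: indexed_pset.indexed_const)
    have qN: "q \<in> {..<N}" using q by simp
    have "h (c (e q)) \<in> carrier R" if "c \<in> Y \<rightarrow> carrier S" for c using C[OF that] qN by blast
    then show ?case
      by (intro bexI[OF _ indexed_pset.indexed_pmult[OF o qN]])
        (simp add: point_eval_pmult[OF o q(1)] C point_eval_const q(2))
  next
    case (polyfun_add f g)
    then obtain F G where FG: "F \<in> indexed_pset {..<N} (carrier R)" "G \<in> indexed_pset {..<N} (carrier R)"
      "\<forall>c\<in>Y \<rightarrow> carrier S. point_eval R N F (\<lambda>q. h (c (e q))) = h (f c)"
      "\<forall>c\<in>Y \<rightarrow> carrier S. point_eval R N G (\<lambda>q. h (c (e q))) = h (g c)" by blast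
    show ?case
      by (rule bexI[OF _ indexed_pset.indexed_padd[OF FG(1,2)]])
        (use FG(3,4) h.R.polyfun_closed[OF polyfun_add.hyps(1)] h.R.polyfun_closed[OF polyfun_add.hyps(2)]
          in \<open>simp add: point_eval_add[OF FG(1,2)] C\<close>)
  next
    case (polyfun_mult f g)
    then obtain F G where FG: "F \<in> indexed_pset {..<N} (carrier R)" "G \<in> indexed_pset {..<N} (carrier R)"
      "\<forall>c\<in>Y \<rightarrow> carrier S. point_eval R N F (\<lambda>q. h (c (e q))) = h (f c)"
      "\<forall>c\<in>Y \<rightarrow> carrier S. point_eval R N G (\<lambda>q. h (c (e q))) = h (g c)" by blast
    obtain H where H: "H \<in> indexed_pset {..<N} (carrier R)" "\<forall>c\<in>{..<N} \<rightarrow> carrier R.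
        point_eval R N H c = point_eval R N F c \<otimes> point_eval R N G c"
      using point_eval_mult_exists[OF FG(2,1)] by blast
    show ?case
      by (rule bexI[OF _ H(1)])
        (use FG(3,4) H(2) C h.R.polyfun_closed[OF polyfun_mult.hyps(1)]
          h.R.polyfun_closed[OF polyfun_mult.hyps(2)] in simp)
  qed
qed

end

section \<open>Coordinates on the space of residue classes\<close>

text \<open>
  If the last coefficient were a unit, the last \<open>b l\<close> would lie in the span of the earlier ones.
  So it lies in \<open>\<mm>\<close>, its summand lies in \<open>L\<close>, and the sum can be shortened.
\<close>
lemma (in noetherian_local_ring) independent_coefficients:
  assumes "ideal L R" "\<And>l. l < d \<Longrightarrow> b l \<in> carrier R" "\<And>l. l < d \<Longrightarrow> b l \<notin> span_upto L b l"
    and "\<And>t l. t \<in> \<mm> \<Longrightarrow> l < d \<Longrightarrow> t \<otimes> b l \<in> L"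
    and "c \<in> {..<d} \<rightarrow> carrier R" "(\<Oplus>l\<in>{..<d}. c l \<otimes> b l) \<in> L" "l < d"
  shows "c l \<in> \<mm>"
  using assms(2-)
proof (induction d)
  case (Suc d)
  interpret L: ideal L R by fact
  have bC: "b l \<in> carrier R" and cC: "c l \<in> carrier R" if "l \<le> d" for l
    using Suc.prems(1,4) that by (auto simp: Pi_iff)
  let ?s = "\<lambda>k. \<Oplus>l\<in>{..<k}. c l \<otimes> b l"
  have sC: "?s k \<in> carrier R" if "k \<le> d" for k
    by (rule finsum_closed) (use bC cC that in auto)
  have step: "?s (Suc k) = c k \<otimes> b k \<oplus> ?s k" if "k \<le> d" for k
    unfolding lessThan_Suc by (rule finsum_insert) (use bC cC that in auto)
  have iV: "ideal (span_upto L b k) R" if "k \<le> d" for k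
    by (rule span_upto_ideal[OF assms(1)]) (use bC that in auto)
  have LV: "L \<subseteq> span_upto L b d" by (rule span_upto_superset[OF assms(1)]) (use bC in auto)
  interpret V: ideal "span_upto L b d" R using iV by simp
  have "?s k \<in> span_upto L b k" if "k \<le> d" for k
    using that
  proof (induction k)
    case (Suc k)
    then have k: "k \<le> d" by simp
    interpret W: ideal "adjoin (span_upto L b k) (b k)" R
      using adjoin_ideal[OF iV[OF k] bC[OF k]] .
    show ?case unfolding step[OF k] span_upto.simps
      using adjoin_superset[OF iV[OF k] bC[OF k]] Suc.IH[OF k] W.I_l_closed[OF _ cC[OF k]]
      by (intro W.a_closed) blast+
  qed simp
  then have sV: "?s d \<in> span_upto L b d" by simp
  have cd: "c d \<in> \<mm>"
  proof (rule ccontr)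
    assume n: "c d \<notin> \<mm>"
    have "?s (Suc d) \<ominus> ?s d \<in> span_upto L b d"
      using Suc.prems(5) LV sV by (auto simp: minus_eq)
    moreover have "?s (Suc d) \<ominus> ?s d = c d \<otimes> b d"
      unfolding step[OF le_refl] using sC[of d] cC[of d] bC[of d]
      by (simp add: minus_eq a_assoc r_neg)
    ultimately have "b d \<in> span_upto L b d"
      using unit_multiple_cancel[OF iV[OF le_refl] cC[of d] n bC[of d]] by simp
    then show False using Suc.prems(2) by simp
  qed
  have "c d \<otimes> b d \<in> L" using Suc.prems(3)[OF cd] by simp
  then have "?s (Suc d) \<ominus> c d \<otimes> b d \<in> L" using Suc.prems(5) by (auto simp: minus_eq)
  moreover have "?s (Suc d) \<ominus> c d \<otimes> b d = ?s d"
    unfolding step[OF le_refl] using sC[of d] cC[of d] bC[of d] by (simp add: add_diff_cancel_left)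
  ultimately have "?s d \<in> L" by simp
  then have "l < d \<Longrightarrow> c l \<in> \<mm>"
    using Suc.prems by (intro Suc.IH) (auto simp: Pi_iff)
  then show ?case using cd Suc.prems(6) by (auto simp: less_Suc_eq)
qed simp

lemma (in ideal) rcos_eq_iff:
  assumes "x \<in> carrier R" "y \<in> carrier R"
  shows "I +> x = I +> y \<longleftrightarrow> x \<ominus> y \<in> I"
  using quotient_eq_iff_same_a_r_cos[OF is_ideal assms] by blast

context minimally_generated_ideals
begin

abbreviation residue_vectors :: "(nat \<Rightarrow> nat) \<Rightarrow> ('a set, nat \<times> nat \<Rightarrow> 'a set) module" where
  "residue_vectors r \<equiv> residue_space R \<mm> s I r"

abbreviation residues :: "(nat \<Rightarrow> nat) \<Rightarrow> (nat \<Rightarrow> nat \<Rightarrow> 'a) \<Rightarrow> nat \<times> nat \<Rightarrow> 'a set" where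
  "residues r \<equiv> residue_tuple R \<mm> s I r"

lemma fibre_ideal: "i \<in> {1..s} \<Longrightarrow> ideal (\<mm> \<cdot> I i) R"
  using ideal_prod_is_ideal[OF is_ideal ideals] .

lemma residues_eqI:
  assumes "\<And>i j. i \<in> {1..s} \<Longrightarrow> j \<in> {1..r i} \<Longrightarrow> \<mm> \<cdot> I i +> y i j = \<mm> \<cdot> I i +> z i j"
  shows "residues r y = residues r z"
  unfolding residue_tuple_def by (rule restrict_ext) (use assms in auto)

lemma residues_eq_iff:
  assumes "y \<in> tuples r" "z \<in> tuples r"
  shows "residues r y = residues r z \<longleftrightarrow>
    (\<forall>i\<in>{1..s}. \<forall>j\<in>{1..r i}. y i j \<ominus> z i j \<in> \<mm> \<cdot> I i)"
proof -
  have "residues r y = residues r z \<longleftrightarrow>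
      (\<forall>i\<in>{1..s}. \<forall>j\<in>{1..r i}. \<mm> \<cdot> I i +> y i j = \<mm> \<cdot> I i +> z i j)"
  proof
    assume eq: "residues r y = residues r z"
    show "\<forall>i\<in>{1..s}. \<forall>j\<in>{1..r i}. \<mm> \<cdot> I i +> y i j = \<mm> \<cdot> I i +> z i j"
    proof (intro ballI)
      fix i j assume "i \<in> {1..s}" "j \<in> {1..r i}"
      then show "\<mm> \<cdot> I i +> y i j = \<mm> \<cdot> I i +> z i j"
        using fun_cong[OF eq, of "(i, j)"] by (simp add: residue_tuple_def)
    qed
  qed (rule residues_eqI, blast)
  then show ?thesis
    using ideal.rcos_eq_iff[OF fibre_ideal tuples_carrier[OF assms(1)] tuples_carrier[OF assms(2)]]
    by simp
qed

lemma residue_vectors_simps: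
  "carrier (residue_vectors r) =
    (\<Pi>\<^sub>E p\<in>(SIGMA i:{1..s}. {1..r i}). (\<lambda>x. \<mm> \<cdot> I (fst p) +> x) ` I (fst p))"
  "\<zero>\<^bsub>residue_vectors r\<^esub> = (\<lambda>p\<in>(SIGMA i:{1..s}. {1..r i}). \<mm> \<cdot> I (fst p))"
  "v \<oplus>\<^bsub>residue_vectors r\<^esub> w = (\<lambda>p\<in>(SIGMA i:{1..s}. {1..r i}). set_add R (v p) (w p))"
  "a \<odot>\<^bsub>residue_vectors r\<^esub> v =
    (\<lambda>p\<in>(SIGMA i:{1..s}. {1..r i}). a \<odot>\<^bsub>ideal_fibre R \<mm> (I (fst p))\<^esub> v p)"
  by (simp_all add: residue_space_def product_module_def ideal_fibre_def case_prod_unfold)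

text \<open>
  Each vector of the product space is the family of residue classes of a tuple, and by the next lemmas the
  operations are induced by those on tuples. This is how the laws of the product space are obtained.
\<close>
lemma residue_vectors_carrier:
  "carrier (residue_vectors r) = residues r ` tuples r"
proof (intro equalityI subsetI)
  fix v assume v: "v \<in> carrier (residue_vectors r)"
  have "\<forall>p\<in>(SIGMA i:{1..s}. {1..r i}). \<exists>x. x \<in> I (fst p) \<and> v p = \<mm> \<cdot> I (fst p) +> x"
  proof
    fix p assume p: "p \<in> (SIGMA i:{1..s}. {1..r i})"
    have "v p \<in> (\<lambda>x. \<mm> \<cdot> I (fst p) +> x) ` I (fst p)"
      using PiE_mem[OF v[unfolded residue_vectors_simps(1)] p] .
    then show "\<exists>x. x \<in> I (fst p) \<and> v p = \<mm> \<cdot> I (fst p) +> x" by blast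
  qed
  from bchoice[OF this] obtain x where
    x: "\<forall>p\<in>(SIGMA i:{1..s}. {1..r i}). x p \<in> I (fst p) \<and> v p = \<mm> \<cdot> I (fst p) +> x p" ..
  have "v = residues r (\<lambda>i j. x (i, j))"
  proof
    fix p
    show "v p = residues r (\<lambda>i j. x (i, j)) p"
    proof (cases "p \<in> (SIGMA i:{1..s}. {1..r i})")
      case True
      moreover from this have "v p = \<mm> \<cdot> I (fst p) +> x p" using x by blast
      ultimately show ?thesis by (simp add: residue_tuple_def case_prod_unfold)
    next
      case False
      then show ?thesis using PiE_arb[OF v[unfolded residue_vectors_simps(1)]]
        by (simp add: residue_tuple_def)
    qed
  qed
  moreover have "(\<lambda>i j. x (i, j)) \<in> tuples r" using x unfolding tuples_def by auto
  ultimately show "v \<in> residues r ` tuples r" by blast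
next
  fix v assume "v \<in> residues r ` tuples r"
  then obtain y where "y \<in> tuples r" "v = residues r y" by blast
  then show "v \<in> carrier (residue_vectors r)"
    unfolding residue_vectors_simps residue_tuple_def tuples_def by auto
qed

lemma residues_add:
  assumes "y \<in> tuples r" "z \<in> tuples r"
  shows "residues r y \<oplus>\<^bsub>residue_vectors r\<^esub> residues r z = residues r (\<lambda>i j. y i j \<oplus> z i j)"
  unfolding residue_vectors_simps(3) unfolding residue_tuple_def
proof (rule restrict_ext, clarify)
  fix i j assume ij: "i \<in> {1..s}" "j \<in> {1..r i}"
  interpret F: ideal "\<mm> \<cdot> I i" R using fibre_ideal[OF ij(1)] .
  show "set_add R ((\<lambda>(i, j)\<in>SIGMA i:{1..s}. {1..r i}. \<mm> \<cdot> I i +> y i j) (i, j))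
      ((\<lambda>(i, j)\<in>SIGMA i:{1..s}. {1..r i}. \<mm> \<cdot> I i +> z i j) (i, j)) = \<mm> \<cdot> I i +> y i j \<oplus> z i j"
    using ij F.a_rcos_sum[OF tuples_carrier[OF assms(1) ij] tuples_carrier[OF assms(2) ij]] by simp
qed

lemma residues_smult:
  assumes "a \<in> carrier R" "y \<in> tuples r"
  shows "(\<mm> +> a) \<odot>\<^bsub>residue_vectors r\<^esub> residues r y = residues r (\<lambda>i j. a \<otimes> y i j)"
  unfolding residue_vectors_simps(4) unfolding residue_tuple_def
proof (rule restrict_ext, clarify)
  fix i j assume ij: "i \<in> {1..s}" "j \<in> {1..r i}"
  have "y i j \<in> I i" using assms(2) ij unfolding tuples_def by blast
  then show "(\<mm> +> a) \<odot>\<^bsub>ideal_fibre R \<mm> (I (fst (i, j)))\<^esub>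
      (\<lambda>(i, j)\<in>SIGMA i:{1..s}. {1..r i}. \<mm> \<cdot> I i +> y i j) (i, j) = \<mm> \<cdot> I i +> a \<otimes> y i j"
    using ij ideal_fibre_smult[OF is_ideal ideals[OF ij(1)] assms(1)] by simp
qed

lemma residues_zero: "residues r (\<lambda>i j. \<zero>) = \<zero>\<^bsub>residue_vectors r\<^esub>"
  unfolding residue_vectors_simps(2) residue_tuple_def
proof (rule restrict_ext, clarify)
  fix i j assume i: "i \<in> {1..s}"
  interpret F: ideal "\<mm> \<cdot> I i" R using fibre_ideal[OF i] .
  show "\<mm> \<cdot> I i +> \<zero> = \<mm> \<cdot> I (fst (i, j))" using F.a_rcos_const[of \<zero>] by simp
qed

lemma tuples_zero: "(\<lambda>i j. \<zero>) \<in> tuples r"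
  unfolding tuples_def using additive_subgroup.zero_closed[OF ideal.axioms(1)[OF ideals]] by simp

lemma tuples_add:
  assumes "y \<in> tuples r" "z \<in> tuples r"
  shows "(\<lambda>i j. y i j \<oplus> z i j) \<in> tuples r"
  using assms additive_subgroup.a_closed[OF ideal.axioms(1)[OF ideals]] unfolding tuples_def by simp

lemma tuples_smult:
  assumes "a \<in> carrier R" "y \<in> tuples r"
  shows "(\<lambda>i j. a \<otimes> y i j) \<in> tuples r"
  using assms ideal.I_l_closed[OF ideals] unfolding tuples_def by simp

lemma residue_vectors_abelian_monoid: "abelian_monoid (residue_vectors r)"
proof (rule abelian_monoidI)
  let ?W = "residue_vectors r"
  show "\<zero>\<^bsub>?W\<^esub> \<in> carrier ?W"
    unfolding residue_vectors_carrier residues_zero[symmetric] using tuples_zero by blast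
  fix u v assume "u \<in> carrier ?W" "v \<in> carrier ?W"
  then obtain y z where yz: "y \<in> tuples r" "z \<in> tuples r" "u = residues r y" "v = residues r z"
    unfolding residue_vectors_carrier by blast
  note C = tuples_carrier[OF yz(1)] tuples_carrier[OF yz(2)]
  show "u \<oplus>\<^bsub>?W\<^esub> v \<in> carrier ?W"
    unfolding yz(3,4) residues_add[OF yz(1,2)] residue_vectors_carrier
    using tuples_add[OF yz(1,2)] by blast
  show "u \<oplus>\<^bsub>?W\<^esub> v = v \<oplus>\<^bsub>?W\<^esub> u"
    unfolding yz(3,4) residues_add[OF yz(1,2)] residues_add[OF yz(2,1)]
    by (rule residues_eqI) (simp add: C a_comm)
  show "\<zero>\<^bsub>?W\<^esub> \<oplus>\<^bsub>?W\<^esub> u = u"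
    unfolding yz(3) residues_zero[symmetric] residues_add[OF tuples_zero yz(1)]
    by (rule residues_eqI) (simp add: C)
  fix w assume "w \<in> carrier ?W"
  then obtain x where x: "x \<in> tuples r" "w = residues r x"
    unfolding residue_vectors_carrier by blast
  show "(u \<oplus>\<^bsub>?W\<^esub> v) \<oplus>\<^bsub>?W\<^esub> w = u \<oplus>\<^bsub>?W\<^esub> (v \<oplus>\<^bsub>?W\<^esub> w)"
    unfolding yz(3,4) x(2) residues_add[OF yz(1,2)] residues_add[OF yz(2) x(1)]
      residues_add[OF tuples_add[OF yz(1,2)] x(1)] residues_add[OF yz(1) tuples_add[OF yz(2) x(1)]]
    by (rule residues_eqI) (simp add: C tuples_carrier[OF x(1)] a_assoc)
qed

definition unit_tuple :: "nat \<times> nat \<times> nat \<Rightarrow> nat \<Rightarrow> nat \<Rightarrow> 'a" where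
  "unit_tuple v i j = (if (i, j) = (fst v, fst (snd v)) then g i (snd (snd v)) else \<zero>)"

lemma unit_tuple_mem:
  assumes "v \<in> variables r"
  shows "unit_tuple v \<in> tuples r"
proof -
  obtain i' j' l where v: "v = (i', j', l)" "i' \<in> {1..s}" "l < N i'"
    using assms unfolding variables_def by blast
  have "unit_tuple v i j \<in> I i" if "i \<in> {1..s}" for i j
    using gens_mem[OF v(2,3)] additive_subgroup.zero_closed[OF ideal.axioms(1)[OF ideals[OF that]]]
    by (simp add: unit_tuple_def v(1))
  then show ?thesis unfolding tuples_def by blast
qed

lemma finite_variables: "finite (variables r)"
proof -
  have "variables r = (SIGMA i:{1..s}. {1..r i} \<times> {..<N i})" unfolding variables_def by auto
  then show ?thesis by simp
qed

text \<open>
  In the entry \<open>(i, j)\<close> only the variables \<open>(i, j, l)\<close> contribute.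
\<close>
lemma tuple_of_unit_tuples:
  assumes c: "c \<in> variables r \<rightarrow> carrier R" and e: "bij_betw e {..<M} (variables r)"
    and ij: "i \<in> {1..s}" "j \<in> {1..r i}"
  shows "(\<Oplus>q\<in>{..<M}. c (e q) \<otimes> unit_tuple (e q) i j) = tuple_of c i j"
proof -
  have uC: "unit_tuple v i j \<in> carrier R" if "v \<in> variables r" for v
    using tuples_carrier[OF unit_tuple_mem[OF that] ij] .
  have cC: "c v \<in> carrier R" if "v \<in> variables r" for v using c that by (rule funcset_mem)
  let ?h = "\<lambda>l. (i, j, l)"
  have im: "?h ` {..<N i} \<subseteq> variables r" using ij unfolding variables_def by auto
  have "(\<Oplus>q\<in>{..<M}. c (e q) \<otimes> unit_tuple (e q) i j) =
      (\<Oplus>v\<in>variables r. c v \<otimes> unit_tuple v i j)"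
    using e uC cC unfolding bij_betw_def by (subst finsum_reindex[symmetric, of _ e]) auto
  also have "\<dots> = (\<Oplus>v\<in>?h ` {..<N i}. c v \<otimes> unit_tuple v i j)"
  proof (rule add.finprod_mono_neutral_cong_right[OF finite_variables im])
    fix v assume "v \<in> variables r - ?h ` {..<N i}"
    then show "c v \<otimes> unit_tuple v i j = \<zero>"
      using cC[of v] unfolding variables_def unit_tuple_def by auto
  qed (use uC cC in auto)
  also have "\<dots> = (\<Oplus>l\<in>{..<N i}. c (?h l) \<otimes> unit_tuple (?h l) i j)"
    by (rule finsum_reindex) (use im uC cC in \<open>auto simp: inj_on_def\<close>)
  also have "\<dots> = tuple_of c i j" unfolding tuple_of_def by (simp add: unit_tuple_def)
  finally show ?thesis .
qed

lemma lin_comb_residues: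
  assumes c: "c \<in> variables r \<rightarrow> carrier R" and e: "bij_betw e {..<M} (variables r)"
    and \<gamma>: "\<And>q. q < M \<Longrightarrow> \<gamma> q = \<mm> +> c (e q)"
  shows "lin_comb (residue_vectors r) M (\<lambda>q. residues r (unit_tuple (e q))) \<gamma> =
    residues r (tuple_of c)"
proof -
  let ?W = "residue_vectors r"
  interpret W: abelian_monoid ?W by (rule residue_vectors_abelian_monoid)
  have ev: "e q \<in> variables r" if "q < M" for q using e that unfolding bij_betw_def by blast
  have cC: "c (e q) \<in> carrier R" if "q < M" for q using c ev[OF that] by (rule funcset_mem)
  have u: "unit_tuple (e q) \<in> tuples r" if "q < M" for q using unit_tuple_mem[OF ev[OF that]] .
  let ?y = "\<lambda>k i j. \<Oplus>q\<in>{..<k}. c (e q) \<otimes> unit_tuple (e q) i j"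
  have smul: "\<gamma> q \<odot>\<^bsub>?W\<^esub> residues r (unit_tuple (e q)) =
      residues r (\<lambda>i j. c (e q) \<otimes> unit_tuple (e q) i j)" if "q < M" for q
    using \<gamma>[OF that] residues_smult[OF cC[OF that] u[OF that]] by simp
  have tC: "\<gamma> q \<odot>\<^bsub>?W\<^esub> residues r (unit_tuple (e q)) \<in> carrier ?W" if "q < M" for q
    unfolding smul[OF that] residue_vectors_carrier
    using tuples_smult[OF cC[OF that] u[OF that]] by blast
  have "?y k \<in> tuples r \<and>
      (\<Oplus>\<^bsub>?W\<^esub>q\<in>{..<k}. \<gamma> q \<odot>\<^bsub>?W\<^esub> residues r (unit_tuple (e q))) = residues r (?y k)"
    if "k \<le> M" for k
    using that
  proof (induction k)
    case 0
    then show ?case using tuples_zero residues_zero by simp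
  next
    case (Suc k)
    then have k: "k < M" and ih: "?y k \<in> tuples r" by auto
    let ?t = "\<lambda>i j. c (e k) \<otimes> unit_tuple (e k) i j"
    have t: "?t \<in> tuples r" using tuples_smult[OF cC[OF k] u[OF k]] .
    have y: "?y (Suc k) i j = ?t i j \<oplus> ?y k i j" if ij: "i \<in> {1..s}" "j \<in> {1..r i}" for i j
      unfolding lessThan_Suc
      by (rule finsum_insert) (use k cC tuples_carrier[OF u ij] in auto)
    have "(\<Oplus>\<^bsub>?W\<^esub>q\<in>{..<Suc k}. \<gamma> q \<odot>\<^bsub>?W\<^esub> residues r (unit_tuple (e q))) =
        \<gamma> k \<odot>\<^bsub>?W\<^esub> residues r (unit_tuple (e k)) \<oplus>\<^bsub>?W\<^esub>
        (\<Oplus>\<^bsub>?W\<^esub>q\<in>{..<k}. \<gamma> q \<odot>\<^bsub>?W\<^esub> residues r (unit_tuple (e q)))"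
      unfolding lessThan_Suc by (rule W.finsum_insert) (use k tC in auto)
    also have "\<dots> = residues r ?t \<oplus>\<^bsub>?W\<^esub> residues r (?y k)"
      using Suc.IH k smul[OF k] by simp
    also have "\<dots> = residues r (\<lambda>i j. ?t i j \<oplus> ?y k i j)" by (rule residues_add[OF t ih])
    also have "\<dots> = residues r (?y (Suc k))" by (rule residues_eqI) (simp only: y)
    finally have "(\<Oplus>\<^bsub>?W\<^esub>q\<in>{..<Suc k}. \<gamma> q \<odot>\<^bsub>?W\<^esub> residues r (unit_tuple (e q))) =
        residues r (?y (Suc k))" .
    moreover have "?y (Suc k) \<in> tuples r"
      using tuples_add[OF t ih] unfolding tuples_def by (simp only: y mem_Collect_eq) (simp add: y)
    ultimately show ?case by blast
  qed
  from this[of M] have "lin_comb ?W M (\<lambda>q. residues r (unit_tuple (e q))) \<gamma> = residues r (?y M)"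
    unfolding lin_comb_def by simp
  also have "\<dots> = residues r (tuple_of c)"
    by (rule residues_eqI) (simp only: tuple_of_unit_tuples[OF c e])
  finally show ?thesis .
qed

lemma representatives:
  assumes "\<gamma> \<in> {..<M} \<rightarrow> carrier (R Quot \<mm>)" "bij_betw e {..<M} (variables r)"
  obtains c where "c \<in> variables r \<rightarrow> carrier R" "\<And>q. q < M \<Longrightarrow> \<gamma> q = \<mm> +> c (e q)"
proof -
  have "\<forall>q\<in>{..<M}. \<exists>t. t \<in> carrier R \<and> \<gamma> q = \<mm> +> t"
  proof
    fix q assume "q \<in> {..<M}"
    then have "\<gamma> q \<in> carrier (R Quot \<mm>)" using assms(1) by blast
    then show "\<exists>t. t \<in> carrier R \<and> \<gamma> q = \<mm> +> t" by (rule quotient_carrierE) blast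
  qed
  from bchoice[OF this] obtain t where t: "\<forall>q\<in>{..<M}. t q \<in> carrier R \<and> \<gamma> q = \<mm> +> t q" ..
  let ?c = "\<lambda>v. t (the_inv_into {..<M} e v)"
  have inj: "inj_on e {..<M}" and im: "e ` {..<M} = variables r"
    using assms(2) unfolding bij_betw_def by auto
  have "?c \<in> variables r \<rightarrow> carrier R"
    using t the_inv_into_into[OF inj _ subset_refl] im by auto
  moreover have "\<gamma> q = \<mm> +> ?c (e q)" if "q < M" for q
    using t the_inv_into_f_f[OF inj] that by simp
  ultimately show ?thesis using that by blast
qed

lemma tuple_surj_residues:
  assumes "y \<in> tuples r"
  obtains c where "c \<in> UNIV \<rightarrow> carrier R" "residues r y = residues r (tuple_of c)"
    "\<And>i j. i \<in> {1..s} \<Longrightarrow> j \<in> {1..r i} \<Longrightarrow> \<exists>e\<in>\<mm> \<cdot> I i. y i j = e \<oplus> tuple_of c i j"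
proof -
  obtain c where c: "c \<in> UNIV \<rightarrow> carrier R"
    "\<forall>i\<in>{1..s}. \<forall>j\<in>{1..r i}. \<exists>e\<in>\<mm> \<cdot> I i. y i j = e \<oplus> tuple_of c i j"
    using tuple_of_surj[OF assms] by blast
  have tc: "tuple_of c \<in> tuples r" using tuple_of_tuples[OF subset_UNIV c(1)] .
  have "y i j \<ominus> tuple_of c i j \<in> \<mm> \<cdot> I i" if ij: "i \<in> {1..s}" "j \<in> {1..r i}" for i j
  proof -
    obtain e where e: "e \<in> \<mm> \<cdot> I i" "y i j = e \<oplus> tuple_of c i j" using c(2) ij by blast
    have "e \<in> carrier R" using ideal.Icarr[OF fibre_ideal[OF ij(1)] e(1)] .
    then show ?thesis using e tuples_carrier[OF tc ij] by (simp add: minus_eq a_assoc r_neg)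
  qed
  then have "residues r y = residues r (tuple_of c)" using residues_eq_iff[OF assms tc] by blast
  then show ?thesis using that c by blast
qed

lemma unit_tuples_basis:
  assumes e: "bij_betw e {..<M} (variables r)"
  shows "is_basis (R Quot \<mm>) (residue_vectors r) M (\<lambda>q. residues r (unit_tuple (e q)))"
  unfolding is_basis_def
proof (intro conjI ballI impI allI)
  have ev: "e q \<in> variables r" if "q < M" for q using e that unfolding bij_betw_def by blast
  show "(\<lambda>q. residues r (unit_tuple (e q))) \<in> {..<M} \<rightarrow> carrier (residue_vectors r)"
    unfolding residue_vectors_carrier using unit_tuple_mem ev by auto
next
  fix w assume "w \<in> carrier (residue_vectors r)"
  then obtain y where y: "y \<in> tuples r" "w = residues r y" unfolding residue_vectors_carrier by blast
  obtain c where c: "c \<in> UNIV \<rightarrow> carrier R" "residues r y = residues r (tuple_of c)"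
    using tuple_surj_residues[OF y(1)] by metis
  have "c \<in> variables r \<rightarrow> carrier R" using c(1) by auto
  from lin_comb_residues[OF this e, of "\<lambda>q. \<mm> +> c (e q)"]
  have "w = lin_comb (residue_vectors r) M (\<lambda>q. residues r (unit_tuple (e q))) (\<lambda>q. \<mm> +> c (e q))"
    using y(2) c(2) by simp
  moreover have "(\<lambda>q. \<mm> +> c (e q)) \<in> {..<M} \<rightarrow> carrier (R Quot \<mm>)"
    using c(1) by (auto simp: FactRing_def intro: a_rcosetsI[OF a_subset])
  ultimately show "\<exists>\<gamma>\<in>{..<M} \<rightarrow> carrier (R Quot \<mm>).
      w = lin_comb (residue_vectors r) M (\<lambda>q. residues r (unit_tuple (e q))) \<gamma>" by blast
next
  fix \<gamma> q
  assume \<gamma>: "\<gamma> \<in> {..<M} \<rightarrow> carrier (R Quot \<mm>)" and q: "q < M"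
    and z: "lin_comb (residue_vectors r) M (\<lambda>q. residues r (unit_tuple (e q))) \<gamma> =
      \<zero>\<^bsub>residue_vectors r\<^esub>"
  obtain c where c: "c \<in> variables r \<rightarrow> carrier R" "\<And>q. q < M \<Longrightarrow> \<gamma> q = \<mm> +> c (e q)"
    using representatives[OF \<gamma> e] by blast
  have tc: "tuple_of c \<in> tuples r" using tuple_of_tuples[OF subset_refl c(1)] .
  have "residues r (tuple_of c) = residues r (\<lambda>i j. \<zero>)"
    using z lin_comb_residues[OF c(1) e c(2)] residues_zero by simp
  then have t0: "tuple_of c i j \<in> \<mm> \<cdot> I i" if "i \<in> {1..s}" "j \<in> {1..r i}" for i j
  proof -
    have "tuple_of c i j \<ominus> \<zero> \<in> \<mm> \<cdot> I i"
      using residues_eq_iff[OF tc tuples_zero] \<open>residues r (tuple_of c) = _\<close> that by blast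
    then show ?thesis using tuples_carrier[OF tc that] by (simp add: minus_eq)
  qed
  obtain i j l where v: "e q = (i, j, l)" "i \<in> {1..s}" "j \<in> {1..r i}" "l < N i"
    using e q unfolding bij_betw_def variables_def by blast
  have "c (i, j, l) \<in> \<mm>"
  proof (rule independent_coefficients[OF fibre_ideal[OF v(2)], of "N i" "g i" "\<lambda>l. c (i, j, l)"])
    show "t \<otimes> g i l \<in> \<mm> \<cdot> I i" if "t \<in> \<mm>" "l < N i" for t l
      using ideal_prod.prod[OF that(1) gens_mem[OF v(2) that(2)]] .
    show "(\<lambda>l. c (i, j, l)) \<in> {..<N i} \<rightarrow> carrier R" using c(1) v unfolding variables_def by auto
    show "(\<Oplus>l\<in>{..<N i}. c (i, j, l) \<otimes> g i l) \<in> \<mm> \<cdot> I i"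
      using t0[OF v(2,3)] unfolding tuple_of_def .
  qed (use gens_carrier[OF v(2)] gens_independent[OF v(2)] v(4) in auto)
  then show "\<gamma> q = \<zero>\<^bsub>R Quot \<mm>\<^esub>"
    using c(2)[OF q] v(1) a_rcos_const by (simp add: FactRing_def)
qed

section \<open>General elements\<close>

lemma no_long_chain:
  assumes "min_gens R (Mon n) < d"
  shows "\<not> has_ideal_chain R d (\<mm> \<cdot> Mon n) (Mon n)"
proof
  assume ch: "has_ideal_chain R d (\<mm> \<cdot> Mon n) (Mon n)"
  have "\<exists>k. \<exists>A. finite A \<and> A \<subseteq> carrier R \<and> card A = k \<and> genideal R A = Mon n"
    using finitely_generated[OF monomial_ideal] by metis
  then have "\<exists>A. finite A \<and> A \<subseteq> carrier R \<and> card A = min_gens R (Mon n) \<and> genideal R A = Mon n"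
    unfolding min_gens_def by (rule LeastI_ex)
  then obtain A where A: "finite A" "A \<subseteq> carrier R" "card A = min_gens R (Mon n)" "Idl A = Mon n"
    by blast
  have AM: "A \<subseteq> Mon n" using genideal_self[OF A(2)] A(4) by simp
  have iL: "ideal (\<mm> \<cdot> Mon n) R" using ideal_prod_is_ideal[OF is_ideal monomial_ideal] .
  have LM: "\<mm> \<cdot> Mon n \<subseteq> Mon n" using has_ideal_chain_subset[OF ch] .
  have LA: "\<mm> \<cdot> Mon n \<union> A \<subseteq> carrier R" using ideal_subset_carrier[OF iL] A(2) by simp
  have "Mon n = Idl (\<mm> \<cdot> Mon n \<union> A)"
  proof
    show "Mon n \<subseteq> Idl (\<mm> \<cdot> Mon n \<union> A)"
      unfolding A(4)[symmetric] by (rule subset_Idl_subset) (use LA A(4) in auto)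
    show "Idl (\<mm> \<cdot> Mon n \<union> A) \<subseteq> Mon n" using LM AM by (intro genideal_minimal[OF monomial_ideal]) simp
  qed
  then have "d \<le> card A"
    using has_ideal_chain_le_card[OF A(1) iL _ AM ideal_prod.prod monomial_ideal ch] by blast
  then show False using assms A(3) by simp
qed

text \<open>
  A single solution \<open>y\<close> suffices: openness around coordinates \<open>c0\<close> of
  \<open>y\<close> yields a polynomial function that does not vanish at \<open>c0\<close>, and its reduction
  to the residue field defines a non-empty Zariski-open set of solutions.
\<close>
lemma generates_modulo_for_general_elements:
  assumes gen: "y \<in> tuples r" "generates_modulo n r (\<mm> \<cdot> Mon n) y"
  shows "for_general_elements R \<mm> s I r (\<lambda>x. x \<in> tuples r \<and> generates_modulo n r (\<mm> \<cdot> Mon n) x)"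
proof -
  let ?J = "\<mm> \<cdot> Mon n" and ?K = "R Quot \<mm>"
  have iJ: "ideal ?J R" using ideal_prod_is_ideal[OF is_ideal monomial_ideal] .
  have JM: "?J \<subseteq> Mon n" using ideal_prod_inter[OF is_ideal monomial_ideal] by blast
  obtain c0 where c0: "c0 \<in> UNIV \<rightarrow> carrier R"
    "\<And>i j. i \<in> {1..s} \<Longrightarrow> j \<in> {1..r i} \<Longrightarrow> \<exists>e\<in>\<mm> \<cdot> I i. y i j = e \<oplus> tuple_of c0 i j"
    using tuple_surj_residues[OF gen(1)] by metis
  have c0v: "c0 \<in> variables r \<rightarrow> carrier R" using c0(1) by auto
  have "generates_modulo n r ?J (tuple_of c0)"
    using generates_modulo_perturb[OF iJ subset_refl gen(1) c0(2) tuple_of_tuples[OF subset_refl c0v] gen(2)] .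
  from generates_modulo_open[OF iJ subset_refl JM subset_refl c0v this]
  obtain f where f: "f \<in> polyfun R (variables r)" "f c0 \<notin> \<mm>"
    "\<forall>c\<in>variables r \<rightarrow> carrier R. f c \<notin> \<mm> \<longrightarrow> generates_modulo n r ?J (tuple_of c)" by blast
  obtain M e where e: "bij_betw e {..<M::nat} (variables r)"
    using ex_bij_betw_nat_finite[OF finite_variables] by (metis atLeast0LessThan)
  interpret K: field ?K using quotient_is_field[OF is_cring] .
  have hom: "ring_hom_ring R ?K ((+>) \<mm>)" by (rule rcos_ring_hom_ring)
  interpret h: ring_hom_ring R ?K "(+>) \<mm>" by (rule hom)
  have e1: "e \<in> {..<M} \<rightarrow> variables r" "variables r \<subseteq> e ` {..<M}" using e unfolding bij_betw_def by auto
  obtain H where H: "H \<in> K.indexed_pset {..<M} (carrier ?K)"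
    "\<forall>c\<in>variables r \<rightarrow> carrier R. point_eval ?K M H (\<lambda>q. \<mm> +> c (e q)) = \<mm> +> f c"
    using K.polyfun_image_polynomial[OF hom e1 f(1)] by blast
  define A where "A = {\<gamma> \<in> {..<M} \<rightarrow>\<^sub>E carrier ?K. point_eval ?K M H \<gamma> \<noteq> \<zero>\<^bsub>?K\<^esub>}"
  let ?b = "\<lambda>q. residues r (unit_tuple (e q))"
  let ?U = "lin_comb (residue_vectors r) M ?b ` A"
  have eC: "c (e q) \<in> carrier R" if "c \<in> variables r \<rightarrow> carrier R" "q < M" for c q
    using that e1(1) by (auto simp: Pi_iff)
  have f_iff: "point_eval ?K M H \<gamma> \<noteq> \<zero>\<^bsub>?K\<^esub> \<longleftrightarrow> f c \<notin> \<mm>"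
    if c: "c \<in> variables r \<rightarrow> carrier R" and \<gamma>: "\<And>q. q < M \<Longrightarrow> \<gamma> q = \<mm> +> c (e q)" for \<gamma> c
  proof -
    have "point_eval ?K M H \<gamma> = point_eval ?K M H (\<lambda>q. \<mm> +> c (e q))"
      by (rule K.point_eval_cong) (use \<gamma> eC[OF c] in auto)
    then show ?thesis using H(2) c rcos_eq_zero_iff[OF polyfun_closed[OF f(1) c]] by simp
  qed
  let ?\<gamma>0 = "\<lambda>q\<in>{..<M}. \<mm> +> c0 (e q)"
  have g0: "?\<gamma>0 \<in> A" unfolding A_def using f_iff[OF c0v, of ?\<gamma>0] f(2) eC[OF c0v] by auto
  have "H \<noteq> K.indexed_const \<zero>\<^bsub>?K\<^esub>"
  proof
    assume "H = K.indexed_const \<zero>\<^bsub>?K\<^esub>"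
    moreover have "?\<gamma>0 \<in> {..<M} \<rightarrow> carrier ?K" using eC[OF c0v] by auto
    ultimately have "point_eval ?K M H ?\<gamma>0 = \<zero>\<^bsub>?K\<^esub>" using K.point_eval_const[OF K.zero_closed] by simp
    then show False using g0 unfolding A_def by simp
  qed
  then have "affine_open ?K M A"
    unfolding affine_open_def using H(1) by (intro exI[of _ "{H}"]) (auto simp: A_def)
  then have "zariski_open ?K (residue_vectors r) ?U"
    unfolding zariski_open_def using unit_tuples_basis[OF e] by blast
  moreover have "?U \<noteq> {}" using g0 by blast
  moreover have "x \<in> tuples r \<and> generates_modulo n r ?J x"
    if x: "\<forall>i\<in>{1..s}. \<forall>j\<in>{1..r i}. x i j \<in> I i" and xU: "residues r x \<in> ?U" for x
  proof -
    have xt: "x \<in> tuples r" using x unfolding tuples_def by blast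
    obtain \<gamma> where \<gamma>: "\<gamma> \<in> A" "residues r x = lin_comb (residue_vectors r) M ?b \<gamma>" using xU by blast
    have "\<gamma> \<in> {..<M} \<rightarrow> carrier ?K" using \<gamma>(1) unfolding A_def by (auto simp: PiE_iff)
    from representatives[OF this e] obtain c where
      c: "c \<in> variables r \<rightarrow> carrier R" "\<And>q. q < M \<Longrightarrow> \<gamma> q = \<mm> +> c (e q)" by blast
    have tc: "tuple_of c \<in> tuples r" using tuple_of_tuples[OF subset_refl c(1)] .
    have "f c \<notin> \<mm>" using f_iff[OF c] \<gamma>(1) unfolding A_def by simp
    then have gc: "generates_modulo n r ?J (tuple_of c)" using f(3) c(1) by blast
    have "residues r (tuple_of c) = residues r x"
      using \<gamma>(2) lin_comb_residues[OF c(1) e c(2)] by simp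
    then have d: "tuple_of c i j \<ominus> x i j \<in> \<mm> \<cdot> I i" if "i \<in> {1..s}" "j \<in> {1..r i}" for i j
      using residues_eq_iff[OF tc xt] that by blast
    have "\<exists>e\<in>\<mm> \<cdot> I i. tuple_of c i j = e \<oplus> x i j" if ij: "i \<in> {1..s}" "j \<in> {1..r i}" for i j
      using d[OF ij] tuples_carrier[OF tc ij] tuples_carrier[OF xt ij]
      by (intro bexI[of _ "tuple_of c i j \<ominus> x i j"]) (simp_all add: minus_eq a_assoc l_neg)
    then show ?thesis
      using generates_modulo_perturb[OF iJ subset_refl tc _ xt gc] xt by blast
  qed
  ultimately show ?thesis unfolding for_general_elements_def by blast
qed

end

lemma for_general_elements_mono:
  assumes "for_general_elements R \<mm> s I r P" "\<And>x. P x \<Longrightarrow> Q x"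
  shows "for_general_elements R \<mm> s I r Q"
  using assms unfolding for_general_elements_def by metis

lemma (in noetherian_local_ring) exists_minimal_generators:
  assumes "ideal V R"
  shows "\<exists>b d. span_upto (\<mm> \<cdot> V) b d = V \<and>
    (\<forall>l<d. b l \<in> carrier R \<and> b l \<notin> span_upto (\<mm> \<cdot> V) b l)"
proof -
  obtain A where A: "finite A" "A \<subseteq> carrier R" "V = Idl A" using finitely_generated[OF assms] .
  have iL: "ideal (\<mm> \<cdot> V) R" using ideal_prod_is_ideal[OF is_ideal assms] .
  have LA: "\<mm> \<cdot> V \<union> A \<subseteq> carrier R" using ideal_subset_carrier[OF iL] A(2) by simp
  have "Idl (\<mm> \<cdot> V \<union> A) = V"
  proof
    have "A \<subseteq> V" using genideal_self[OF A(2)] A(3) by simp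
    then show "Idl (\<mm> \<cdot> V \<union> A) \<subseteq> V"
      using ideal_prod_inter[OF is_ideal assms] by (intro genideal_minimal[OF assms]) blast
    show "V \<subseteq> Idl (\<mm> \<cdot> V \<union> A)"
      using subset_Idl_subset[OF LA, of A] A(3) by simp
  qed
  with exists_independent_span[OF iL A(1,2)] show ?thesis by simp
qed

theorem corollary1p4:
  fixes R :: "('a, 'b) ring_scheme" and \<mm> :: "'a set"
    and s :: nat and I :: "nat \<Rightarrow> 'a set" and n r :: "nat \<Rightarrow> nat"
  assumes "noetherian_local_ring \<mm> R"
    and "infinite (carrier (R Quot \<mm>))"
    and "\<And>i. i \<in> {1..s} \<Longrightarrow> ideal (I i) R"
    and "(\<Sum>i\<in>{1..s}. n i) \<ge> 1"
    and "(\<Sum>i\<in>{1..s}. r i) \<ge> 0"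
    and "min_gens R (ideal_monomial R s I n) < (\<Prod>i\<in>{1..s}. (n i + r i) choose r i)"
  shows "for_general_elements R \<mm> s I r (\<lambda>x.
    \<forall>m. (\<forall>i\<in>{1..s}. m i \<ge> n i) \<longrightarrow>
      ideal_monomial R s I m =
        (\<Oplus>\<^bsub>ideals_set R\<^esub>i\<in>{1..s}.
           if m i = 0 then {\<zero>\<^bsub>R\<^esub>}
           else genideal R (x i ` {1..r i}) \<cdot>\<^bsub>R\<^esub> ideal_monomial R s I (m(i := m i - 1))))"
proof -
  interpret noetherian_local_ring \<mm> R by fact
  have "\<forall>i\<in>{1..s}. \<exists>b. \<exists>d. span_upto (\<mm> \<cdot>\<^bsub>R\<^esub> I i) b d = I i \<and>
      (\<forall>l<d. b l \<in> carrier R \<and> b l \<notin> span_upto (\<mm> \<cdot>\<^bsub>R\<^esub> I i) b l)"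
    using exists_minimal_generators[OF assms(3)] by blast
  from bchoice[OF this] obtain g where "\<forall>i\<in>{1..s}. \<exists>d. span_upto (\<mm> \<cdot>\<^bsub>R\<^esub> I i) (g i) d = I i \<and>
      (\<forall>l<d. g i l \<in> carrier R \<and> g i l \<notin> span_upto (\<mm> \<cdot>\<^bsub>R\<^esub> I i) (g i) l)" ..
  from bchoice[OF this] obtain N where gN: "\<forall>i\<in>{1..s}. span_upto (\<mm> \<cdot>\<^bsub>R\<^esub> I i) (g i) (N i) = I i \<and>
      (\<forall>l<N i. g i l \<in> carrier R \<and> g i l \<notin> span_upto (\<mm> \<cdot>\<^bsub>R\<^esub> I i) (g i) l)" ..
  interpret minimally_generated_ideals \<mm> R s I g N
    by (intro minimally_generated_ideals.intro minimally_generated_ideals_axioms.intro)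
      (fact noetherian_local_ring_axioms, fact assms(3), use gN in blast, use gN in blast,
        use gN in blast, fact assms(2))
  have iJ: "ideal (\<mm> \<cdot>\<^bsub>R\<^esub> Mon n) R" using ideal_prod_is_ideal[OF is_ideal monomial_ideal] .
  have JM: "\<mm> \<cdot>\<^bsub>R\<^esub> Mon n \<subseteq> Mon n" using ideal_prod_inter[OF is_ideal monomial_ideal] by blast
  from exists_generating_tuple[OF iJ subset_refl JM no_long_chain[OF assms(6)]]
  obtain y where "y \<in> tuples r" "generates_modulo n r (\<mm> \<cdot>\<^bsub>R\<^esub> Mon n) y" by blast
  from generates_modulo_for_general_elements[OF this] show ?thesis
    by (rule for_general_elements_mono) (use monomial_eq_sum in blast)
qed

end
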